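(* For each $n\in\mathbb N$ the operator $A_n^*$ generates a sub-Markov semigroup in $L^1(S)$. Moreover, if the semigroup in $C(S)$ generated by $A_n$ is conservative, then $A_n^*$ generates a Markov semigroup in $L^1(S)$.
   Context: Graph. Let $\mathcal G=(\mathcal V,\mathcal E)$ be a finite directed geometric graph in $\mathbb R^3$ without loops: $\mathcal V$ is the finite set of vertices and the edges $E_1,\dots,E_N$ are $C^1$ curves of finite lengths $d_i>0$ connecting vertices; put $\mathcal N=\{1,\dots,N\}$, $\mathbb N=\{1,2,\dots\}$. The initial and terminal vertices of $E_i$ are denoted $L_i$ (left endpoint) and $R_i$ (right endpoint); $L_i\ne R_i$ as vertices. $S$ is the disjoint union of the edges (endpoints of different edges are different points of $S$). Each $E_i$ is identified with $[0,d_i]$ by arc length, $L_i$ corresponding to $0$ and $R_i$ to $d_i$. A function $f$ on $S$ is identified with $(f_i)_{i\in\mathcal N}$, $f_i$ a function on $[0,d_i]$; $f(L_i)=f_i(0)$, $f(R_i)=f_i(d_i)$, and $f'(L_i)=f_i'(0)$, $f'(R_i)=f_i'(d_i)$ (one-sided derivatives). If a vertex $V$ is an endpoint of $E_j$, then $V_j$ denotes $V$ regarded as an endpoint of $E_j$ (a point of $S$); otherwise $V_j$ is undefined. Coefficients. $\sigma_i>0$ ($i\in\mathcal N$) are given and $\sigma$ is the function on $S$ equal to $\sigma_i$ on $E_i$. $l_i,r_i\ge 0$ and, for $i\neq j$, $l_{ij},r_{ij}\ge 0$ are real numbers with $\sum_{j\ne i}l_{ij}\le l_i$, $\sum_{j\neq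 i}r_{ij}\le r_i$; $l_{ij}=0$ if $E_j$ is not incident with the vertex $L_i$, and $r_{ij}=0$ if $E_j$ is not incident with the vertex $R_i$ (terms with undefined $V_j$ are read as $0$). $(\kappa_n)_{n\in\mathbb N}$ is a nondecreasing sequence of positive numbers converging to $+\infty$. Operator $A_n$. $C(S)$ is the space of continuous real functions on $S$ with the supremum norm. $A_nf=\kappa_n\sigma f''$, with domain $D(A_n)$ the set of twice continuously differentiable $f$ on $S$ such that for all $i\in\mathcal N$: with $V=L_i$, $\kappa_n f'(L_i)=l_if(L_i)-\sum_{j\ne i}l_{ij}f(V_j)$; and with $V=R_i$, $-\kappa_nf'(R_i)=r_if(R_i)-\sum_{j\neq i}r_{ij}f(V_j)$. It is known that $A_n$ generates a Feller semigroup $\{e^{tA_n}\}_{t\ge0}$ in $C(S)$ (a strongly continuous semigroup of positive contractions). The semigroup is conservative if $e^{tA_n}1_S=1_S$ for all $t\geq 0$, where $1_S\equiv 1$ on $S$. Operator $A_n^*$. $L^1(S)=\{\phi=(\phi_i)_{i\in\mathcal N}:\phi_i\in L^1(0,d_i)\}$ (real functions), $\int_S\phi=\sum_i\int_0^{d_i}\phi_i$, $\|\phi\|_{L^1(S)}=\sum_i\|\phi_i\|_{L^1(0,d_i)}$. $W^{2,1}(S)$ is the set of $\phi\in L^1(S)$ such that $\phi,\phi'$ are weakly differentiable (on each edge) with $\phi',\phi''\in L^1(S)$. Functionals $F_{L,i},F_{R,i}$ on $W^{2,1}(S)$ are defined by $$\sigma_iF_{L,i}\phi=\sigma_il_i\phi(L_i)-\sum_{j\neq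 i:\,L_j=L_i}\sigma_jl_{ji}\phi(L_j)-\sum_{j\ne i:\,R_j=L_i}\sigma_jr_{ji}\phi(R_j),$$ $$\sigma_iF_{R,i}\phi=\sum_{j\neq i:\,L_j=R_i}\sigma_jl_{ji}\phi(L_j)+\sum_{j\ne i:\,R_j=R_i}\sigma_jr_{ji}\phi(R_j)-\sigma_ir_i\phi(R_i),$$ where equalities under the sums are equalities of vertices in $\mathcal V$. Then $A_n^*\phi=\kappa_n\sigma\phi''$ with $D(A_n^* )=\{\phi\in W^{2,1}(S):\ \kappa_n\phi'(L_i)=F_{L,i}\phi,\ \kappa_n\phi'(R_i)=F_{R,i}\phi,\ i\in\mathcal N\}$. Sub-Markov and Markov semigroups. A strongly continuous semigroup $\{T(t)\}_{t\geq0}$ in $L^1(S)$ is sub-Markov if for every nonnegative $\phi\in L^1(S)$ and $t\ge0$ we have $T(t)\phi\ge0$ and $\int_ST(t)\phi\le\int_S\phi$; it is Markov if moreover $\int_ST(t)\phi=\int_S\phi$ for all such $\phi$ and $t$. *)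

theory Defs
  imports "HOL-Analysis.Analysis"
begin

section \<open>Strongly continuous semigroups on seminormed spaces of functions\<close>

text \<open>
  A Banach space of (classes of) functions is given by a carrier \<open>X\<close> of representatives together
  with its norm \<open>p\<close>, read as a seminorm on representatives: \<open>f\<close> and \<open>g\<close> represent the same
  element iff \<open>p (f - g) = 0\<close>. For \<open>L\<^sup>1(S)\<close> this is equality almost everywhere; for \<open>C(S)\<close> it is
  equality on \<open>S\<close>, the values of a HOL function outside \<open>S\<close> being irrelevant. All identities
  between elements are therefore stated as \<open>p (\<dots>) = 0\<close>. By linearity and boundedness,
  each \<open>T t\<close> acts on classes.
\<close>

definition c0_semigroup ::
  "('s \<Rightarrow> real) set \<Rightarrow> (('s \<Rightarrow> real) \<Rightarrow> real) \<Rightarrow> (real \<Rightarrow> ('s \<Rightarrow> real) \<Rightarrow> 's \<Rightarrow> real) \<Rightarrow> bool"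
  where
  "c0_semigroup X p T \<longleftrightarrow>
     (\<forall>t\<ge>0. \<forall>f\<in>X. T t f \<in> X) \<and>
     (\<forall>t\<ge>0. \<forall>f\<in>X. \<forall>g\<in>X. \<forall>a b.
        p (\<lambda>s. T t (\<lambda>u. a * f u + b * g u) s - (a * T t f s + b * T t g s)) = 0) \<and>
     (\<forall>t\<ge>0. \<exists>C. \<forall>f\<in>X. p (T t f) \<le> C * p f) \<and>
     (\<forall>f\<in>X. p (\<lambda>s. T 0 f s - f s) = 0) \<and>
     (\<forall>t\<ge>0. \<forall>u\<ge>0. \<forall>f\<in>X. p (\<lambda>s. T (t + u) f s - T t (T u f) s) = 0) \<and>
     (\<forall>f\<in>X. ((\<lambda>t. p (\<lambda>s. T t f s - f s)) \<longlongrightarrow> 0) (at_right 0))"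

text \<open>The operator \<open>A\<close> with domain \<open>D\<close> is the infinitesimal generator of \<open>T\<close>: the graph of \<open>A\<close> consists
  exactly of the pairs \<open>(f, g)\<close> for which the difference quotients of \<open>T\<close> at \<open>f\<close> converge to \<open>g\<close>.\<close>

definition generates ::
  "('s \<Rightarrow> real) set \<Rightarrow> (('s \<Rightarrow> real) \<Rightarrow> real) \<Rightarrow> ('s \<Rightarrow> real) set \<Rightarrow> (('s \<Rightarrow> real) \<Rightarrow> 's \<Rightarrow> real) \<Rightarrow>
   (real \<Rightarrow> ('s \<Rightarrow> real) \<Rightarrow> 's \<Rightarrow> real) \<Rightarrow> bool"
  where
  "generates X p D A T \<longleftrightarrow>
     c0_semigroup X p T \<and> D \<subseteq> X \<and> (\<forall>f\<in>D. A f \<in> X) \<and>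
     (\<forall>f\<in>X. \<forall>g\<in>X.
        ((\<lambda>t. p (\<lambda>s. (T t f s - f s) / t - g s)) \<longlongrightarrow> 0) (at_right 0) \<longleftrightarrow>
        f \<in> D \<and> p (\<lambda>s. A f s - g s) = 0)"


section \<open>The graph\<close>

definition curve_length :: "(real \<Rightarrow> real^3) \<Rightarrow> real" where
  "curve_length g = integral {0..1} (\<lambda>t. norm (vector_derivative g (at t)))"

text \<open>
  \<open>\<gamma> i\<close> is a parametrization over \<open>[0, 1]\<close> of the edge \<open>i\<close>, running from its left vertex to its right
  vertex. \<open>C1_differentiable_on\<close> uses two-sided derivatives at \<open>0\<close> and \<open>1\<close>; this is no restriction,
  since a curve that is \<open>C\<^sup>1\<close> on \<open>[0, 1]\<close> has a \<open>C\<^sup>1\<close> extension.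
\<close>

definition left_vertex :: "('e \<Rightarrow> real \<Rightarrow> real^3) \<Rightarrow> 'e \<Rightarrow> real^3" where
  "left_vertex \<gamma> i = pathstart (\<gamma> i)"

definition right_vertex :: "('e \<Rightarrow> real \<Rightarrow> real^3) \<Rightarrow> 'e \<Rightarrow> real^3" where
  "right_vertex \<gamma> i = pathfinish (\<gamma> i)"

definition geometric_graph ::
  "(real^3) set \<Rightarrow> ('e::finite \<Rightarrow> real \<Rightarrow> real^3) \<Rightarrow> ('e \<Rightarrow> real) \<Rightarrow> bool" where
  "geometric_graph V \<gamma> d \<longleftrightarrow>
     finite V \<and>
     (\<forall>i. \<gamma> i C1_differentiable_on {0..1} \<and> d i = curve_length (\<gamma> i) \<and> d i > 0 \<and>
          left_vertex \<gamma> i \<in> V \<and> right_vertex \<gamma> i \<in> V \<and> left_vertex \<gamma> i \<noteq> right_vertex \<gamma> i)"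

definition incident :: "('e \<Rightarrow> real \<Rightarrow> real^3) \<Rightarrow> 'e \<Rightarrow> real^3 \<Rightarrow> bool" where
  "incident \<gamma> j v \<longleftrightarrow> v = left_vertex \<gamma> j \<or> v = right_vertex \<gamma> j"

text \<open>The disjoint union of the edges, each identified with \<open>[0, d i]\<close> by arc length.\<close>

definition edge_union :: "('e \<Rightarrow> real) \<Rightarrow> ('e \<times> real) set" where
  "edge_union d = {(i, x). 0 \<le> x \<and> x \<le> d i}"

text \<open>\<open>f(V\<^sub>j)\<close>, where \<open>V\<^sub>j\<close> is the vertex \<open>v\<close> regarded as an endpoint of the edge \<open>j\<close>; it is read as \<open>0\<close>
  if \<open>v\<close> is not an endpoint of \<open>j\<close>.\<close>

definition vertex_value ::
  "('e \<Rightarrow> real \<Rightarrow> real^3) \<Rightarrow> ('e \<Rightarrow> real) \<Rightarrow> ('e \<times> real \<Rightarrow> real) \<Rightarrow> real^3 \<Rightarrow> 'e \<Rightarrow> real" where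
  "vertex_value \<gamma> d f v j =
     (if v = left_vertex \<gamma> j then f (j, 0) else if v = right_vertex \<gamma> j then f (j, d j) else 0)"


section \<open>The operator in \<open>C(S)\<close>\<close>

text \<open>As \<open>S\<close> is a disjoint union, continuity on \<open>S\<close> is continuity on each edge.\<close>

definition C_space :: "('e \<Rightarrow> real) \<Rightarrow> ('e \<times> real \<Rightarrow> real) set" where
  "C_space d = {f. \<forall>i. continuous_on {0..d i} (\<lambda>x. f (i, x))}"

definition C_norm :: "('e \<Rightarrow> real) \<Rightarrow> ('e \<times> real \<Rightarrow> real) \<Rightarrow> real" where
  "C_norm d f = (SUP s\<in>edge_union d. \<bar>f s\<bar>)"

text \<open>One-sided at the endpoints.\<close>

definition edge_deriv :: "('e \<Rightarrow> real) \<Rightarrow> ('e \<times> real \<Rightarrow> real) \<Rightarrow> 'e \<times> real \<Rightarrow> real" where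
  "edge_deriv d f = (\<lambda>(i, x). vector_derivative (\<lambda>y. f (i, y)) (at x within {0..d i}))"

definition C2_space :: "('e \<Rightarrow> real) \<Rightarrow> ('e \<times> real \<Rightarrow> real) set" where
  "C2_space d = {f. \<forall>i.
      (\<lambda>x. f (i, x)) differentiable_on {0..d i} \<and>
      (\<lambda>x. edge_deriv d f (i, x)) differentiable_on {0..d i} \<and>
      continuous_on {0..d i} (\<lambda>x. edge_deriv d (edge_deriv d f) (i, x))}"

definition A_op ::
  "('e \<Rightarrow> real) \<Rightarrow> ('e \<Rightarrow> real) \<Rightarrow> real \<Rightarrow> ('e \<times> real \<Rightarrow> real) \<Rightarrow> 'e \<times> real \<Rightarrow> real" where
  "A_op d \<sigma> k f = (\<lambda>(i, x). k * \<sigma> i * edge_deriv d (edge_deriv d f) (i, x))"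

text \<open>\<open>lc i j\<close> and \<open>rc i j\<close> are the coefficients \<open>l\<^sub>i\<^sub>j\<close> and \<open>r\<^sub>i\<^sub>j\<close>; only their values for \<open>i \<noteq> j\<close> are used.\<close>

definition A_dom ::
  "('e::finite \<Rightarrow> real \<Rightarrow> real^3) \<Rightarrow> ('e \<Rightarrow> real) \<Rightarrow> ('e \<Rightarrow> real) \<Rightarrow> ('e \<Rightarrow> real) \<Rightarrow>
   ('e \<Rightarrow> 'e \<Rightarrow> real) \<Rightarrow> ('e \<Rightarrow> 'e \<Rightarrow> real) \<Rightarrow> real \<Rightarrow> ('e \<times> real \<Rightarrow> real) set" where
  "A_dom \<gamma> d l r lc rc k = {f \<in> C2_space d. \<forall>i.
      k * edge_deriv d f (i, 0) =
        l i * f (i, 0) - (\<Sum>j\<in>-{i}. lc i j * vertex_value \<gamma> d f (left_vertex \<gamma> i) j) \<and>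
      - k * edge_deriv d f (i, d i) =
        r i * f (i, d i) - (\<Sum>j\<in>-{i}. rc i j * vertex_value \<gamma> d f (right_vertex \<gamma> i) j)}"

definition conservative ::
  "('e \<Rightarrow> real) \<Rightarrow> (real \<Rightarrow> ('e \<times> real \<Rightarrow> real) \<Rightarrow> 'e \<times> real \<Rightarrow> real) \<Rightarrow> bool" where
  "conservative d T \<longleftrightarrow> (\<forall>t\<ge>0. \<forall>s\<in>edge_union d. T t (\<lambda>_. 1) s = 1)"


section \<open>The operator in \<open>L\<^sup>1(S)\<close>\<close>

definition L1_space :: "('e \<Rightarrow> real) \<Rightarrow> ('e \<times> real \<Rightarrow> real) set" where
  "L1_space d = {\<phi>. \<forall>i. set_integrable lborel {0<..<d i} (\<lambda>x. \<phi> (i, x))}"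

definition L1_norm :: "('e::finite \<Rightarrow> real) \<Rightarrow> ('e \<times> real \<Rightarrow> real) \<Rightarrow> real" where
  "L1_norm d \<phi> = (\<Sum>i\<in>UNIV. LINT x:{0<..<d i}|lborel. \<bar>\<phi> (i, x)\<bar>)"

definition S_integral :: "('e::finite \<Rightarrow> real) \<Rightarrow> ('e \<times> real \<Rightarrow> real) \<Rightarrow> real" where
  "S_integral d \<phi> = (\<Sum>i\<in>UNIV. LINT x:{0<..<d i}|lborel. \<phi> (i, x))"

definition AE_nonneg :: "('e \<Rightarrow> real) \<Rightarrow> ('e \<times> real \<Rightarrow> real) \<Rightarrow> bool" where
  "AE_nonneg d \<phi> \<longleftrightarrow> (\<forall>i. AE x\<in>{0<..<d i} in lborel. 0 \<le> \<phi> (i, x))"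

text \<open>Weak derivatives are tested against \<open>C\<^sup>1\<close> functions with compact support in the open interval.\<close>

definition test_function :: "real \<Rightarrow> (real \<Rightarrow> real) \<Rightarrow> bool" where
  "test_function b \<psi> \<longleftrightarrow> \<psi> C1_differentiable_on UNIV \<and>
     (\<exists>u v. 0 < u \<and> u < v \<and> v < b \<and> (\<forall>x. x \<notin> {u..v} \<longrightarrow> \<psi> x = 0))"

definition has_weak_deriv ::
  "('e \<Rightarrow> real) \<Rightarrow> ('e \<times> real \<Rightarrow> real) \<Rightarrow> ('e \<times> real \<Rightarrow> real) \<Rightarrow> bool" where
  "has_weak_deriv d \<phi> \<phi>' \<longleftrightarrow> (\<forall>i \<psi>. test_function (d i) \<psi> \<longrightarrow>
     (LINT x:{0<..<d i}|lborel. \<phi> (i, x) * deriv \<psi> x) =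
     - (LINT x:{0<..<d i}|lborel. \<phi>' (i, x) * \<psi> x))"

text \<open>A representative of the weak derivative, which is unique up to equality almost everywhere.\<close>

definition weak_deriv :: "('e \<Rightarrow> real) \<Rightarrow> ('e \<times> real \<Rightarrow> real) \<Rightarrow> 'e \<times> real \<Rightarrow> real" where
  "weak_deriv d \<phi> = (SOME \<phi>'. \<phi>' \<in> L1_space d \<and> has_weak_deriv d \<phi> \<phi>')"

definition W21_space :: "('e \<Rightarrow> real) \<Rightarrow> ('e \<times> real \<Rightarrow> real) set" where
  "W21_space d = {\<phi> \<in> L1_space d. \<exists>\<phi>'\<in>L1_space d. \<exists>\<phi>''\<in>L1_space d.
     has_weak_deriv d \<phi> \<phi>' \<and> has_weak_deriv d \<phi>' \<phi>''}"

text \<open>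
  The point values \<open>\<phi>(L\<^sub>i)\<close>, \<open>\<phi>'(L\<^sub>i)\<close> etc. of \<open>\<phi> \<in> W\<^sup>2\<^sup>,\<^sup>1(S)\<close> are those of the continuous
  representatives on \<open>[0, d i]\<close> of \<open>\<phi>\<close> and of its weak derivative.
\<close>

definition point_value ::
  "('e \<Rightarrow> real) \<Rightarrow> ('e \<times> real \<Rightarrow> real) \<Rightarrow> 'e \<times> real \<Rightarrow> real" where
  "point_value d \<phi> = (\<lambda>(i, x). THE c. \<exists>g. continuous_on {0..d i} g \<and>
     (AE y\<in>{0<..<d i} in lborel. \<phi> (i, y) = g y) \<and> g x = c)"

definition F_left ::
  "('e::finite \<Rightarrow> real \<Rightarrow> real^3) \<Rightarrow> ('e \<Rightarrow> real) \<Rightarrow> ('e \<Rightarrow> real) \<Rightarrow> ('e \<Rightarrow> real) \<Rightarrow>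
   ('e \<Rightarrow> 'e \<Rightarrow> real) \<Rightarrow> ('e \<Rightarrow> 'e \<Rightarrow> real) \<Rightarrow> 'e \<Rightarrow> ('e \<times> real \<Rightarrow> real) \<Rightarrow> real" where
  "F_left \<gamma> d \<sigma> l lc rc i \<phi> =
     (\<sigma> i * l i * point_value d \<phi> (i, 0)
      - (\<Sum>j | j \<noteq> i \<and> left_vertex \<gamma> j = left_vertex \<gamma> i. \<sigma> j * lc j i * point_value d \<phi> (j, 0))
      - (\<Sum>j | j \<noteq> i \<and> right_vertex \<gamma> j = left_vertex \<gamma> i. \<sigma> j * rc j i * point_value d \<phi> (j, d j)))
     / \<sigma> i"

definition F_right ::
  "('e::finite \<Rightarrow> real \<Rightarrow> real^3) \<Rightarrow> ('e \<Rightarrow> real) \<Rightarrow> ('e \<Rightarrow> real) \<Rightarrow> ('e \<Rightarrow> real) \<Rightarrow>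
   ('e \<Rightarrow> 'e \<Rightarrow> real) \<Rightarrow> ('e \<Rightarrow> 'e \<Rightarrow> real) \<Rightarrow> 'e \<Rightarrow> ('e \<times> real \<Rightarrow> real) \<Rightarrow> real" where
  "F_right \<gamma> d \<sigma> r lc rc i \<phi> =
     ((\<Sum>j | j \<noteq> i \<and> left_vertex \<gamma> j = right_vertex \<gamma> i. \<sigma> j * lc j i * point_value d \<phi> (j, 0))
      + (\<Sum>j | j \<noteq> i \<and> right_vertex \<gamma> j = right_vertex \<gamma> i. \<sigma> j * rc j i * point_value d \<phi> (j, d j))
      - \<sigma> i * r i * point_value d \<phi> (i, d i))
     / \<sigma> i"

definition A_star_op ::
  "('e \<Rightarrow> real) \<Rightarrow> ('e \<Rightarrow> real) \<Rightarrow> real \<Rightarrow> ('e \<times> real \<Rightarrow> real) \<Rightarrow> 'e \<times> real \<Rightarrow> real" where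
  "A_star_op d \<sigma> k \<phi> = (\<lambda>(i, x). k * \<sigma> i * weak_deriv d (weak_deriv d \<phi>) (i, x))"

definition A_star_dom ::
  "('e::finite \<Rightarrow> real \<Rightarrow> real^3) \<Rightarrow> ('e \<Rightarrow> real) \<Rightarrow> ('e \<Rightarrow> real) \<Rightarrow> ('e \<Rightarrow> real) \<Rightarrow> ('e \<Rightarrow> real) \<Rightarrow>
   ('e \<Rightarrow> 'e \<Rightarrow> real) \<Rightarrow> ('e \<Rightarrow> 'e \<Rightarrow> real) \<Rightarrow> real \<Rightarrow> ('e \<times> real \<Rightarrow> real) set" where
  "A_star_dom \<gamma> d \<sigma> l r lc rc k = {\<phi> \<in> W21_space d. \<forall>i.
      k * point_value d (weak_deriv d \<phi>) (i, 0) = F_left \<gamma> d \<sigma> l lc rc i \<phi> \<and>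
      k * point_value d (weak_deriv d \<phi>) (i, d i) = F_right \<gamma> d \<sigma> r lc rc i \<phi>}"

definition sub_markov ::
  "('e::finite \<Rightarrow> real) \<Rightarrow> (real \<Rightarrow> ('e \<times> real \<Rightarrow> real) \<Rightarrow> 'e \<times> real \<Rightarrow> real) \<Rightarrow> bool" where
  "sub_markov d T \<longleftrightarrow> c0_semigroup (L1_space d) (L1_norm d) T \<and>
     (\<forall>t\<ge>0. \<forall>\<phi>\<in>L1_space d. AE_nonneg d \<phi> \<longrightarrow>
        AE_nonneg d (T t \<phi>) \<and> S_integral d (T t \<phi>) \<le> S_integral d \<phi>)"

definition markov ::
  "('e::finite \<Rightarrow> real) \<Rightarrow> (real \<Rightarrow> ('e \<times> real \<Rightarrow> real) \<Rightarrow> 'e \<times> real \<Rightarrow> real) \<Rightarrow> bool" where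
  "markov d T \<longleftrightarrow> sub_markov d T \<and>
     (\<forall>t\<ge>0. \<forall>\<phi>\<in>L1_space d. AE_nonneg d \<phi> \<longrightarrow> S_integral d (T t \<phi>) = S_integral d \<phi>)"

end

theory Submission
  imports Defs "HOL-Library.Function_Algebras"
begin

text \<open>
  With \<open>h > 0\<close> the equation \<open>u - h A\<^sub>n\<^sup>* u = f\<close> is solved explicitly on each edge by hyperbolic functions,
  given the endpoint values of \<open>u\<close>. If \<open>f \<ge> 0\<close>, the boundary conditions become a linear system for the
  numbers \<open>\<sigma>\<^sub>i u(L\<^sub>i)\<close>, \<open>\<sigma>\<^sub>i u(R\<^sub>i)\<close> with nonnegative right-hand side, whose matrix has nonpositive
  off-diagonal entries and positive column sums. Such a matrix is invertible with a nonnegative inverse,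
  so \<open>u\<close> exists, is unique, and is nonnegative. Integrating the equation gives \<open>\<integral> u \<le> \<integral> f\<close>, because
  \<open>\<integral> A\<^sub>n\<^sup>* u\<close> is minus the sum of the endpoint values weighted by the defects \<open>l\<^sub>i - \<Sum>\<^sub>j l\<^sub>i\<^sub>j\<close> and
  \<open>r\<^sub>i - \<Sum>\<^sub>j r\<^sub>i\<^sub>j\<close>. The resolvents are therefore positive contractions, and the semigroup is obtained as
  the limit of \<open>(I - t 2\<^sup>-\<^sup>n A)\<close> to the power \<open>-2\<^sup>n\<close>, which inherits these properties. If the semigroup in
  \<open>C(S)\<close> is conservative, then \<open>1\<close> belongs to the domain of \<open>A\<^sub>n\<close>, all the defects vanish, and \<open>\<integral> u = \<integral> f\<close>.
\<close>

section \<open>Contraction semigroups from resolvents\<close>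

text \<open>The spaces consist of representatives, and \<open>A\<close> is built with choice
  operators, so it is linear only up to null functions. The generation argument is therefore carried
  out in a real vector space with a seminorm, and every identity is a congruence modulo null
  vectors. Dyadic powers are used because a refinement replaces one resolvent of step 2h by two of
  step h. On the domain of the square of \<open>A\<close> these differ by at most h^2 times the
  seminorm of \<open>A (A x)\<close>; over 2^n steps this costs O(2^-n), which is summable. Density
  and contractivity then give convergence everywhere. The unknowns of the linear system carry the
  weight \<sigma> because the coefficients enter the boundary conditions of the operator in L^1
  transposed. After weighting, the column of an endpoint collects exactly the rates leaving that
  endpoint, and their sum is what the hypotheses on the coefficients bound. Strict positivity of the
  column sums does not come from these rates but from the absorption in the resolvent equation, so
  it persists when all defects vanish.\<close>

locale dissipative_operator =
  fixes X :: "'a::real_vector set" and p :: "'a \<Rightarrow> real" and D :: "'a set" and A :: "'a \<Rightarrow> 'a"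
  assumes subspace_X: "subspace X"
    and p_scale: "\<And>a x. x \<in> X \<Longrightarrow> p (a *\<^sub>R x) = \<bar>a\<bar> * p x"
    and p_add: "\<And>x y. x \<in> X \<Longrightarrow> y \<in> X \<Longrightarrow> p (x + y) \<le> p x + p y"
    and complete: "\<And>f :: nat \<Rightarrow> 'a. \<lbrakk>\<And>n. f n \<in> X; \<And>e. e > 0 \<Longrightarrow> \<exists>N. \<forall>m\<ge>N. \<forall>n\<ge>N. p (f m - f n) < e\<rbrakk>
                    \<Longrightarrow> \<exists>g\<in>X. (\<lambda>n. p (f n - g)) \<longlonglongrightarrow> 0"
    and D_X: "\<And>x. x \<in> D \<Longrightarrow> x \<in> X"
    and A_X: "\<And>x. x \<in> D \<Longrightarrow> A x \<in> X"
    and D_cong: "\<And>x y. x \<in> D \<Longrightarrow> y \<in> X \<Longrightarrow> p (x - y) = 0 \<Longrightarrow> y \<in> D \<and> p (A x - A y) = 0"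
    and D_linear: "\<And>a b x y. x \<in> D \<Longrightarrow> y \<in> D \<Longrightarrow>
          a *\<^sub>R x + b *\<^sub>R y \<in> D \<and> p (A (a *\<^sub>R x + b *\<^sub>R y) - (a *\<^sub>R A x + b *\<^sub>R A y)) = 0"
    and dissipative: "\<And>h x. h > 0 \<Longrightarrow> x \<in> D \<Longrightarrow> p x \<le> p (x - h *\<^sub>R A x)"
    and range_full: "\<And>h f. h > 0 \<Longrightarrow> f \<in> X \<Longrightarrow> \<exists>x\<in>D. p (x - h *\<^sub>R A x - f) = 0"
    and D_dense: "\<And>f e. f \<in> X \<Longrightarrow> e > 0 \<Longrightarrow> \<exists>g\<in>D. p (f - g) < e"
begin

section \<open>Calculus modulo vectors of seminorm zero\<close>

lemma X_closed [simp, intro]: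
  "0 \<in> X" "x \<in> X \<Longrightarrow> y \<in> X \<Longrightarrow> x + y \<in> X" "x \<in> X \<Longrightarrow> y \<in> X \<Longrightarrow> x - y \<in> X"
  "x \<in> X \<Longrightarrow> a *\<^sub>R x \<in> X" "x \<in> D \<Longrightarrow> x \<in> X" "x \<in> D \<Longrightarrow> A x \<in> X"
  using subspace_X by (auto simp: subspace_0 subspace_add subspace_diff subspace_scale D_X A_X)

lemma p_0: "p 0 = 0"
  using p_scale[of 0 0] by simp

lemma p_minus_commute: "x \<in> X \<Longrightarrow> y \<in> X \<Longrightarrow> p (x - y) = p (y - x)"
  using p_scale[of "y - x" "-1"] by simp

lemma p_nonneg: "x \<in> X \<Longrightarrow> 0 \<le> p x"
  using p_add[of x "- x"] p_scale[of x "-1"] subspace_neg[OF subspace_X, of x] p_0 by simp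

lemma p_triangle: "x \<in> X \<Longrightarrow> y \<in> X \<Longrightarrow> z \<in> X \<Longrightarrow> p (x - z) \<le> p (x - y) + p (y - z)"
  using p_add[of "x - y" "y - z"] by simp

lemma p_triangle_zero: "x \<in> X \<Longrightarrow> y \<in> X \<Longrightarrow> p x \<le> p (x - y) + p y"
  using p_add[of "x - y" "y"] by simp

text \<open>\<open>A\<close> and the resolvents act on representatives and are linear only up to
  vectors that represent zero. Stating congruences as membership in \<open>N\<close> lets the
  closure rules below chain them.\<close>

definition N where "N = {x \<in> X. p x = 0}"

lemma N_closed:
  "0 \<in> N" "x \<in> N \<Longrightarrow> y \<in> N \<Longrightarrow> x + y \<in> N" "x \<in> N \<Longrightarrow> y \<in> N \<Longrightarrow> x - y \<in> N" "x \<in> N \<Longrightarrow> a *\<^sub>R x \<in> N"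
proof -
  show "0 \<in> N" by (simp add: N_def p_0)
  show scale: "x \<in> N \<Longrightarrow> a *\<^sub>R x \<in> N" for a x by (simp add: N_def p_scale)
  show add: "x \<in> N \<Longrightarrow> y \<in> N \<Longrightarrow> x + y \<in> N" for x y
    using p_add[of x y] p_nonneg[of "x + y"] by (simp add: N_def)
  show "x \<in> N \<Longrightarrow> y \<in> N \<Longrightarrow> x - y \<in> N" for x y
    using add[of x "-1 *\<^sub>R y"] scale[of y "-1"] by simp
qed

lemma NI: "x \<in> X \<Longrightarrow> p x \<le> 0 \<Longrightarrow> x \<in> N"
  using p_nonneg[of x] by (simp add: N_def)

lemma N_sym: "x - y \<in> N \<Longrightarrow> y - x \<in> N"
  using N_closed(4)[of "x - y" "-1"] by simp

lemma N_trans: "x - y \<in> N \<Longrightarrow> y - z \<in> N \<Longrightarrow> x - z \<in> N"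
  using N_closed(2)[of "x - y" "y - z"] by simp

lemma p_cong: "x - y \<in> N \<Longrightarrow> x \<in> X \<Longrightarrow> y \<in> X \<Longrightarrow> p x = p y"
  using p_triangle_zero[of x y] p_triangle_zero[of y x] N_sym[of x y] by (simp add: N_def)

lemma D_cong': "x \<in> D \<Longrightarrow> y \<in> X \<Longrightarrow> x - y \<in> N \<Longrightarrow> y \<in> D"
  "x \<in> D \<Longrightarrow> y \<in> X \<Longrightarrow> x - y \<in> N \<Longrightarrow> A x - A y \<in> N"
  using D_cong[of x y] by (auto simp: N_def)

lemma D_linear': "x \<in> D \<Longrightarrow> y \<in> D \<Longrightarrow> a *\<^sub>R x + b *\<^sub>R y \<in> D"
  "x \<in> D \<Longrightarrow> y \<in> D \<Longrightarrow> A (a *\<^sub>R x + b *\<^sub>R y) - (a *\<^sub>R A x + b *\<^sub>R A y) \<in> N"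
  using D_linear[of x y a b] by (auto simp: N_def)

lemma D_diff: "x \<in> D \<Longrightarrow> y \<in> D \<Longrightarrow> x - y \<in> D"
  "x \<in> D \<Longrightarrow> y \<in> D \<Longrightarrow> A (x - y) - (A x - A y) \<in> N"
  using D_linear'[of x y 1 "-1"] by auto

lemma D_diff_scale: "x \<in> D \<Longrightarrow> y \<in> D \<Longrightarrow> x - a *\<^sub>R y \<in> D"
  "x \<in> D \<Longrightarrow> y \<in> D \<Longrightarrow> A (x - a *\<^sub>R y) - (A x - a *\<^sub>R A y) \<in> N"
  using D_linear'[of x y 1 "-a"] by auto

section \<open>Resolvents\<close>

definition J where "J h f = (SOME x. x \<in> D \<and> x - h *\<^sub>R A x - f \<in> N)"

lemma J_props:
  assumes "h > 0" "f \<in> X"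
  shows J_D: "J h f \<in> D" and J_N: "J h f - h *\<^sub>R A (J h f) - f \<in> N"
proof -
  have "\<exists>x. x \<in> D \<and> x - h *\<^sub>R A x - f \<in> N"
    using range_full[OF assms] assms(2) by (auto simp: N_def)
  from someI_ex[OF this] show "J h f \<in> D" "J h f - h *\<^sub>R A (J h f) - f \<in> N"
    by (auto simp: J_def)
qed

lemma J_X [simp]: "h > 0 \<Longrightarrow> f \<in> X \<Longrightarrow> J h f \<in> X"
  by (simp add: J_D)

text \<open>Dissipativity applied to the difference of two solutions. It makes \<open>J h\<close> a
  well-defined map on classes, although its values are chosen arbitrarily.\<close>

lemma J_unique:
  assumes "h > 0" "f \<in> X" "u \<in> D" "u - h *\<^sub>R A u - f \<in> N"
  shows "J h f - u \<in> N"
proof -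
  let ?v = "J h f"
  have v: "?v \<in> D" using assms J_D by blast
  have "(?v - u) - h *\<^sub>R A (?v - u)
      = (?v - h *\<^sub>R A ?v - f) - (u - h *\<^sub>R A u - f) - h *\<^sub>R (A (?v - u) - (A ?v - A u))"
    by (simp add: algebra_simps)
  also have "\<dots> \<in> N"
    using J_N[OF assms(1,2)] assms(4) D_diff(2)[OF v assms(3)] by - (assumption | rule N_closed(2-4))+
  finally have "p ((?v - u) - h *\<^sub>R A (?v - u)) = 0" by (simp add: N_def)
  with dissipative[OF assms(1) D_diff(1)[OF v assms(3)]] show ?thesis
    using v assms by (intro NI) auto
qed

lemma J_contraction:
  assumes "h > 0" "f \<in> X" shows "p (J h f) \<le> p f"
proof -
  have "p (J h f) \<le> p (J h f - h *\<^sub>R A (J h f))"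
    using dissipative J_D assms by blast
  also have "\<dots> = p f" using J_N[OF assms] J_D[OF assms] assms by (intro p_cong) auto
  finally show ?thesis .
qed

lemma J_linear:
  assumes "h > 0" "f \<in> X" "g \<in> X"
  shows "J h (a *\<^sub>R f + b *\<^sub>R g) - (a *\<^sub>R J h f + b *\<^sub>R J h g) \<in> N"
proof (rule J_unique)
  let ?u = "a *\<^sub>R J h f + b *\<^sub>R J h g"
  have D: "J h f \<in> D" "J h g \<in> D" using assms J_D by auto
  show "?u \<in> D" using D_linear' D by blast
  have "?u - h *\<^sub>R A ?u - (a *\<^sub>R f + b *\<^sub>R g)
    = a *\<^sub>R (J h f - h *\<^sub>R A (J h f) - f) + b *\<^sub>R (J h g - h *\<^sub>R A (J h g) - g)
      - h *\<^sub>R (A ?u - (a *\<^sub>R A (J h f) + b *\<^sub>R A (J h g)))"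
    by (simp add: algebra_simps)
  also have "\<dots> \<in> N" using J_N[OF assms(1,2)] J_N[OF assms(1,3)] D_linear'(2)[OF D]
    by - (assumption | rule N_closed(2-4))+
  finally show "?u - h *\<^sub>R A ?u - (a *\<^sub>R f + b *\<^sub>R g) \<in> N" .
qed (use assms in auto)

lemma A_J:
  assumes "h > 0" "f \<in> X"
  shows "A (J h f) - (1 / h) *\<^sub>R (J h f - f) \<in> N"
proof -
  have "A (J h f) - (1 / h) *\<^sub>R (J h f - f) = (- 1 / h) *\<^sub>R (J h f - h *\<^sub>R A (J h f) - f)"
    using assms by (simp add: algebra_simps)
  also have "\<dots> \<in> N" using J_N[OF assms] by - (assumption | rule N_closed(2-4))+
  finally show ?thesis .
qed

text \<open>Modulo null vectors \<open>A (J h x)\<close> is \<open>(J h x - x) / h\<close>, a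
  combination of elements of \<open>D\<close>; this gives the membership. Applying \<open>A\<close>
  to the resolvent equation then shows that \<open>A (J h x)\<close> solves it with right-hand side
  \<open>A x\<close>.\<close>

lemma A_J_commute:
  assumes "h > 0" "x \<in> D"
  shows "A (J h x) \<in> D" "A (J h x) - J h (A x) \<in> N"
proof -
  let ?u = "J h x"
  let ?w = "(1 / h) *\<^sub>R ?u + (- 1 / h) *\<^sub>R x"
  have u: "?u \<in> D" using J_D assms by blast
  have w: "?w \<in> D" "A ?w - ((1 / h) *\<^sub>R A ?u + (- 1 / h) *\<^sub>R A x) \<in> N"
    using D_linear' u assms(2) by blast+
  have uw: "A ?u - ?w \<in> N" using A_J[of h x] assms by (simp add: algebra_simps)
  show Au: "A ?u \<in> D" using D_cong'(1)[OF w(1) _ N_sym[OF uw]] u by auto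
  have "A (A ?u) - A ?w \<in> N"
    using D_cong'(2)[OF Au _ uw] w(1) by simp
  then have "A (A ?u) - ((1 / h) *\<^sub>R A ?u + (- 1 / h) *\<^sub>R A x) \<in> N"
    using N_trans w(2) by blast
  moreover have "A ?u - h *\<^sub>R A (A ?u) - A x
      = (- h) *\<^sub>R (A (A ?u) - ((1 / h) *\<^sub>R A ?u + (- 1 / h) *\<^sub>R A x))"
    using assms by (simp add: algebra_simps)
  ultimately have "A ?u - h *\<^sub>R A (A ?u) - A x \<in> N" by (simp only: N_closed(4))
  from J_unique[OF assms(1) _ Au this] assms(2) have "J h (A x) - A ?u \<in> N" by simp
  then show "A ?u - J h (A x) \<in> N" by (rule N_sym)
qed

text \<open>The part of the domain of the square of \<open>A\<close> on which the second-order error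
  of a resolvent step has a uniform bound. Resolvents map it into itself, so the bound is available
  along all iterates.\<close>

definition K where "K c = {x \<in> D. A x \<in> D \<and> p (A (A x)) \<le> c}"

lemma KD: "x \<in> K c \<Longrightarrow> x \<in> D" "x \<in> K c \<Longrightarrow> x \<in> X" "x \<in> K c \<Longrightarrow> A x \<in> D"
  "x \<in> K c \<Longrightarrow> p (A (A x)) \<le> c"
  by (auto simp: K_def)

lemma J_K:
  assumes "h > 0" "x \<in> K c" shows "J h x \<in> K c"
proof -
  have x: "x \<in> D" "A x \<in> D" "p (A (A x)) \<le> c" using assms by (auto simp: K_def)
  have u: "J h x \<in> D" "A (J h x) \<in> D" using J_D assms x A_J_commute by auto
  have "A (A (J h x)) - A (J h (A x)) \<in> N"
    using D_cong'(2)[OF u(2) _ A_J_commute(2)[OF assms(1) x(1)]] J_D assms(1) x by auto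
  from N_trans[OF this A_J_commute(2)[OF assms(1) x(2)]]
  have "A (A (J h x)) - J h (A (A x)) \<in> N" .
  then have "p (A (A (J h x))) = p (J h (A (A x)))" using u x assms by (intro p_cong) auto
  also have "\<dots> \<le> c" using J_contraction[of h "A (A x)"] assms x by auto
  finally show ?thesis using u by (simp add: K_def)
qed

text \<open>This is \<open>(I - b A) (I - a A) w = x\<close> multiplied out. The expanded form is
  symmetric in \<open>a\<close> and \<open>b\<close>, which is also the source of
  commutation.\<close>

lemma J_J:
  assumes "a > 0" "b > 0" "x \<in> X" and w: "w = J a (J b x)"
  shows "w \<in> D" "A w \<in> D" "w - (a + b) *\<^sub>R A w + (a * b) *\<^sub>R A (A w) - x \<in> N"
proof -
  define y where "y = J b x"
  have y: "y \<in> D" unfolding y_def using J_D assms by auto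
  show wD: "w \<in> D" unfolding w y_def[symmetric] using J_D assms(1) y by auto
  show Aw: "A w \<in> D" unfolding w y_def[symmetric] using A_J_commute assms(1) y by auto
  have Nw: "w - a *\<^sub>R A w - y \<in> N" unfolding w y_def[symmetric] using J_N assms(1) y by auto
  have Ny: "y - b *\<^sub>R A y - x \<in> N" unfolding y_def using J_N assms by auto
  have aw: "w - a *\<^sub>R A w \<in> D" "A (w - a *\<^sub>R A w) - (A w - a *\<^sub>R A (A w)) \<in> N"
    using D_diff_scale wD Aw by auto
  have "A (w - a *\<^sub>R A w) - A y \<in> N" using D_cong'(2)[OF aw(1) _ Nw] y by simp
  from N_trans[OF N_sym[OF this] aw(2)] have NA: "A y - (A w - a *\<^sub>R A (A w)) \<in> N" .
  have "w - (a + b) *\<^sub>R A w + (a * b) *\<^sub>R A (A w) - x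
     = (w - a *\<^sub>R A w - y) + (y - b *\<^sub>R A y - x) + b *\<^sub>R (A y - (A w - a *\<^sub>R A (A w)))"
    by (simp add: algebra_simps)
  also have "\<dots> \<in> N" using Nw Ny NA by - (assumption | rule N_closed(2-4))+
  finally show "w - (a + b) *\<^sub>R A w + (a * b) *\<^sub>R A (A w) - x \<in> N" .
qed

text \<open>With \<open>a = b\<close> this compares consecutive dyadic approximations of the semigroup; with arbitrary
  \<open>a\<close>, \<open>b\<close> it yields the semigroup law in the limit.\<close>

lemma J_product_estimate:
  assumes "a > 0" "b > 0" "x \<in> K c"
  shows "p (J (a + b) x - J a (J b x)) \<le> a * b * c"
proof -
  define w where "w = J a (J b x)"
  define z where "z = J (a + b) x"
  have x: "x \<in> X" using assms KD by auto
  note w = J_J[OF assms(1,2) x w_def]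
  have z: "z \<in> D" unfolding z_def using J_D x assms by auto
  have Nz: "z - (a + b) *\<^sub>R A z - x \<in> N" unfolding z_def using J_N assms x by auto
  have Nv: "A (z - w) - (A z - A w) \<in> N" using D_diff z w by blast
  have "(z - w) - (a + b) *\<^sub>R A (z - w) - (a * b) *\<^sub>R A (A w)
     = (z - (a + b) *\<^sub>R A z - x) - (w - (a + b) *\<^sub>R A w + (a * b) *\<^sub>R A (A w) - x)
       - (a + b) *\<^sub>R (A (z - w) - (A z - A w))"
    by (simp add: algebra_simps)
  also have "\<dots> \<in> N" using Nz w(3) Nv by - (assumption | rule N_closed(2-4))+
  finally have *: "p ((z - w) - (a + b) *\<^sub>R A (z - w)) = p ((a * b) *\<^sub>R A (A w))"
    using z w D_diff(1)[of z w] by (intro p_cong) auto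
  have "p (z - w) \<le> p ((z - w) - (a + b) *\<^sub>R A (z - w))"
    using dissipative[of "a + b"] D_diff z w assms by auto
  also have "\<dots> = a * b * p (A (A w))" using * p_scale w assms by simp
  also have "\<dots> \<le> a * b * c"
    using KD(4)[OF J_K[OF assms(1) J_K[OF assms(2,3)]]] assms(1,2) by (intro mult_left_mono) (auto simp: w_def)
  finally show ?thesis by (simp add: z_def w_def)
qed

lemma J_cong:
  assumes "h > 0" "f \<in> X" "g \<in> X" "f - g \<in> N" shows "J h f - J h g \<in> N"
proof (rule J_unique)
  show "J h g \<in> D" using J_D assms by auto
  have "J h g - h *\<^sub>R A (J h g) - f = (J h g - h *\<^sub>R A (J h g) - g) - (f - g)" by simp
  also have "\<dots> \<in> N" using J_N[OF assms(1,3)] assms(4) by - (assumption | rule N_closed(2-4))+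
  finally show "J h g - h *\<^sub>R A (J h g) - f \<in> N" .
qed (use assms in auto)

text \<open>The equation of \<open>J_J\<close> is factored in the other order:
  \<open>w - b A w\<close> solves the resolvent equation that determines
  \<open>J a x\<close>.\<close>

lemma J_commute:
  assumes "a > 0" "b > 0" "x \<in> X"
  shows "J a (J b x) - J b (J a x) \<in> N"
proof -
  define w where "w = J a (J b x)"
  define v where "v = w - b *\<^sub>R A w"
  note w = J_J[OF assms w_def]
  have v: "v \<in> D" "A v - (A w - b *\<^sub>R A (A w)) \<in> N" unfolding v_def using D_diff_scale w by auto
  have "v - a *\<^sub>R A v - x = (w - (a + b) *\<^sub>R A w + (a * b) *\<^sub>R A (A w) - x)
       - a *\<^sub>R (A v - (A w - b *\<^sub>R A (A w)))"
    by (simp add: algebra_simps v_def)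
  also have "\<dots> \<in> N" using w(3) v(2) by - (assumption | rule N_closed(2-4))+
  finally have "J a x - v \<in> N" using J_unique assms v by blast
  then have "w - b *\<^sub>R A w - J a x \<in> N" using N_sym by (auto simp: v_def)
  from J_unique[OF assms(2) _ w(1) this] assms have "J b (J a x) - w \<in> N" by simp
  from N_sym[OF this] show ?thesis by (simp add: w_def)
qed

text \<open>What telescoping needs from products of resolvents: contractivity carries an error
  through the remaining factors, and invariance of every \<open>K c\<close> keeps the one-step
  estimate applicable. All of it is stable under composition.\<close>

definition admissible where
  "admissible S \<longleftrightarrow> (\<forall>x\<in>X. S x \<in> X) \<and> (\<forall>c. \<forall>x\<in>K c. S x \<in> K c) \<and>
     (\<forall>x\<in>X. \<forall>y\<in>X. p (S x - S y) \<le> p (x - y)) \<and>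
     (\<forall>x\<in>X. \<forall>y\<in>X. \<forall>a b. S (a *\<^sub>R x + b *\<^sub>R y) - (a *\<^sub>R S x + b *\<^sub>R S y) \<in> N)"

lemma admissibleD:
  assumes "admissible S"
  shows "x \<in> X \<Longrightarrow> S x \<in> X" "x \<in> K c \<Longrightarrow> S x \<in> K c"
    "x \<in> X \<Longrightarrow> y \<in> X \<Longrightarrow> p (S x - S y) \<le> p (x - y)"
    "x \<in> X \<Longrightarrow> y \<in> X \<Longrightarrow> S (a *\<^sub>R x + b *\<^sub>R y) - (a *\<^sub>R S x + b *\<^sub>R S y) \<in> N"
  using assms by (auto simp: admissible_def)

lemma admissible_cong:
  assumes "admissible S" "x \<in> X" "y \<in> X" "x - y \<in> N" shows "S x - S y \<in> N"
proof (rule NI)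
  have "p (x - y) = 0" using assms(4) by (simp add: N_def)
  then show "p (S x - S y) \<le> 0" using admissibleD(3)[OF assms(1-3)] by simp
qed (use assms admissibleD(1) in auto)

lemma admissible_J: assumes "h > 0" shows "admissible (J h)"
  unfolding admissible_def
proof (intro conjI ballI allI)
  fix x y assume xy: "x \<in> X" "y \<in> X"
  have "J h (x - y) - (J h x - J h y) \<in> N" using J_linear[OF assms xy, of 1 "-1"] by simp
  then have "p (J h x - J h y) = p (J h (x - y))"
    using xy assms by (intro p_cong[symmetric]) auto
  also have "\<dots> \<le> p (x - y)" using J_contraction xy assms by auto
  finally show "p (J h x - J h y) \<le> p (x - y)" .
qed (use assms J_K J_linear in auto)

lemma admissible_comp: assumes "admissible S" "admissible R" shows "admissible (S \<circ> R)"
  unfolding admissible_def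
proof (intro conjI ballI allI)
  note S = admissibleD[OF assms(1)] note R = admissibleD[OF assms(2)]
  fix x y a b assume xy: "x \<in> X" "y \<in> X"
  show "p ((S \<circ> R) x - (S \<circ> R) y) \<le> p (x - y)"
    using R(3)[OF xy] S(3)[of "R x" "R y"] R(1) xy by fastforce
  have "S (R (a *\<^sub>R x + b *\<^sub>R y)) - S (a *\<^sub>R R x + b *\<^sub>R R y) \<in> N"
    using R xy by (intro admissible_cong[OF assms(1)]) auto
  from N_trans[OF this S(4)] R(1) xy
  show "(S \<circ> R) (a *\<^sub>R x + b *\<^sub>R y) - (a *\<^sub>R (S \<circ> R) x + b *\<^sub>R (S \<circ> R) y) \<in> N"
    by simp
qed (use assms admissibleD in auto)

lemma admissible_funpow: assumes "admissible S" shows "admissible (S ^^ n)"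
proof (induction n)
  case 0
  show ?case by (auto simp: admissible_def N_closed)
next
  case (Suc n)
  then show ?case using admissible_comp[OF assms Suc] by (simp only: funpow.simps)
qed

text \<open>The difference of the powers is the sum of \<open>S^(m-1-k) (S - R) R^k x\<close>. The
  inner power stays in \<open>K c\<close>, where the one-step error is at most \<open>e\<close>, and
  the outer power does not enlarge it.\<close>

lemma funpow_telescope:
  assumes "admissible S" "admissible R" and e: "\<And>x. x \<in> K c \<Longrightarrow> p (S x - R x) \<le> e" and "x \<in> K c"
  shows "p ((S ^^ m) x - (R ^^ m) x) \<le> real m * e"
  using assms(4)
proof (induction m arbitrary: x)
  case 0
  then show ?case by (simp add: p_0)
next
  case (Suc m)
  note S = admissibleD[OF assms(1)] note R = admissibleD[OF assms(2)]
  note Sm = admissibleD[OF admissible_funpow[OF assms(1), of m]]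
  note Rm = admissibleD[OF admissible_funpow[OF assms(2), of m]]
  have x: "x \<in> X" "R x \<in> K c" using Suc.prems KD R by auto
  have "p ((S ^^ m) (S x) - (R ^^ m) (R x))
      \<le> p ((S ^^ m) (S x) - (S ^^ m) (R x)) + p ((S ^^ m) (R x) - (R ^^ m) (R x))"
    using Sm(1) Rm(1) S(1) R(1) x by (intro p_triangle) auto
  also have "\<dots> \<le> p (S x - R x) + real m * e"
    using Sm(3) S(1) R(1) x Suc.IH[OF x(2)] by (intro add_mono) auto
  also have "\<dots> \<le> real (Suc m) * e" using e[OF Suc.prems] by (simp add: algebra_simps)
  finally show ?case by (simp add: funpow_Suc_right del: funpow.simps)
qed

lemma funpow_commute_mod:
  assumes "admissible S" "admissible R" and c: "\<And>x. x \<in> X \<Longrightarrow> S (R x) - R (S x) \<in> N" and "x \<in> X"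
  shows "(S ^^ m) (R x) - R ((S ^^ m) x) \<in> N"
proof (induction m)
  case 0
  then show ?case by (simp add: N_closed)
next
  case (Suc m)
  note S = admissibleD[OF assms(1)] note R = admissibleD[OF assms(2)]
  note Sm = admissibleD[OF admissible_funpow[OF assms(1), of m]]
  have "S ((S ^^ m) (R x)) - S (R ((S ^^ m) x)) \<in> N"
    by (rule admissible_cong[OF assms(1) _ _ Suc]) (use Sm(1) R(1) assms(4) in auto)
  from N_trans[OF this c] Sm(1) assms(4) show ?case by simp
qed

lemma funpow_comp_mod:
  assumes "admissible S" "admissible R" and c: "\<And>x. x \<in> X \<Longrightarrow> S (R x) - R (S x) \<in> N" and "x \<in> X"
  shows "((S \<circ> R) ^^ m) x - (S ^^ m) ((R ^^ m) x) \<in> N"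
proof (induction m)
  case 0
  then show ?case by (simp add: N_closed)
next
  case (Suc m)
  note S = admissibleD[OF assms(1)] note R = admissibleD[OF assms(2)]
  note Sm = admissibleD[OF admissible_funpow[OF assms(1), of m]]
  note Rm = admissibleD[OF admissible_funpow[OF assms(2), of m]]
  note SRm = admissibleD[OF admissible_funpow[OF admissible_comp[OF assms(1,2)], of m]]
  let ?y = "(R ^^ m) x"
  have y: "?y \<in> X" by (intro Rm(1) assms(4))
  have 1: "(S \<circ> R) (((S \<circ> R) ^^ m) x) - (S \<circ> R) ((S ^^ m) ?y) \<in> N"
    by (intro admissible_cong[OF admissible_comp[OF assms(1,2)] _ _ Suc] Sm(1) SRm(1) assms(4) y)
  have 2: "S (R ((S ^^ m) ?y)) - S ((S ^^ m) (R ?y)) \<in> N"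
    by (intro admissible_cong[OF assms(1) _ _ N_sym[OF funpow_commute_mod[OF assms(1-3) y]]] R(1) Sm(1) y)
  from N_trans[OF 1[unfolded o_apply] 2] show ?case by simp
qed

section \<open>Dyadic approximations and their limit\<close>

definition E where "E t n = J (t / 2 ^ n) ^^ (2 ^ n)"

lemma admissible_E: "t > 0 \<Longrightarrow> admissible (E t n)"
  unfolding E_def by (intro admissible_funpow admissible_J) simp

lemma E_X: "t > 0 \<Longrightarrow> x \<in> X \<Longrightarrow> E t n x \<in> X"
  using admissibleD(1)[OF admissible_E] .

lemma E_contraction: "t > 0 \<Longrightarrow> x \<in> X \<Longrightarrow> y \<in> X \<Longrightarrow> p (E t n x - E t n y) \<le> p (x - y)"
  using admissibleD(3)[OF admissible_E] .

lemma K_I: "x \<in> D \<Longrightarrow> A x \<in> D \<Longrightarrow> x \<in> K (p (A (A x)))"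
  by (simp add: K_def)

text \<open>By commutation \<open>J h x - x\<close> is \<open>h\<close> times
  \<open>J h (A x)\<close> modulo null vectors.\<close>

lemma J_minus_id:
  assumes "h > 0" "x \<in> D" shows "p (J h x - x) \<le> h * p (A x)"
proof -
  have x: "x \<in> X" "A x \<in> X" "J h x \<in> X" "J h (A x) \<in> X" "A (J h x) \<in> X"
    using assms J_D by auto
  have "(J h x - x) - h *\<^sub>R J h (A x) = h *\<^sub>R (A (J h x) - J h (A x)) + (J h x - h *\<^sub>R A (J h x) - x)"
    by (simp add: algebra_simps)
  also have "\<dots> \<in> N"
    using A_J_commute(2)[OF assms] J_N[OF assms(1) x(1)] by - (assumption | rule N_closed(2-4))+
  finally have "p (J h x - x) = p (h *\<^sub>R J h (A x))" using x by (intro p_cong) auto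
  also have "\<dots> = h * p (J h (A x))" using p_scale x assms by auto
  also have "\<dots> \<le> h * p (A x)" using J_contraction[OF assms(1) x(2)] assms by simp
  finally show ?thesis .
qed

text \<open>For \<open>y\<close> in \<open>D\<close> the vector \<open>J h y\<close> lies in the
  domain of the square of \<open>A\<close>, and by \<open>J_minus_id\<close> it tends to
  \<open>y\<close> as \<open>h\<close> tends to zero.\<close>

lemma K_dense:
  assumes "f \<in> X" "e > 0" obtains g c where "g \<in> K c" "p (f - g) < e"
proof -
  obtain y where y: "y \<in> D" "p (f - y) < e / 2" using D_dense[of f "e/2"] assms by auto
  \<comment> \<open>The summand 1 keeps the quotient meaningful when \<open>p (A y) = 0\<close> and
    makes \<open>h * p (A y)\<close> strictly smaller than \<open>e / 2\<close>.\<close>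
  define h where "h = e / (2 * (p (A y) + 1))"
  have pA: "p (A y) \<ge> 0" using y p_nonneg by auto
  have h: "h > 0" using assms pA by (simp add: h_def)
  have J: "J h y \<in> D" "A (J h y) \<in> D" using A_J_commute J_D h y by auto
  have "p (y - J h y) \<le> h * p (A y)" using J_minus_id[OF h y(1)] p_minus_commute y(1) J(1) by auto
  also have "\<dots> < e / 2" using pA assms by (simp add: h_def field_simps)
  finally have "p (f - J h y) < e" using p_triangle[of f y "J h y"] y J assms by auto
  with that[OF K_I[OF J]] show ?thesis by blast
qed

text \<open>Both approximations are powers with the same exponent 2^n, of
  \<open>J h \<circ> J h\<close> and of \<open>J (h + h)\<close> with h = t / 2^(n+1). Telescoping
  2^n one-step errors h^2 c gives the bound.\<close>

lemma E_step:
  assumes "t > 0" "x \<in> K c"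
  shows "p (E t (Suc n) x - E t n x) \<le> t\<^sup>2 * c / 4 * (1/2) ^ n"
proof -
  let ?h = "t / 2 ^ Suc n"
  have h: "?h > 0" "?h + ?h = t / 2 ^ n" using assms by auto
  have "E t (Suc n) = (J ?h ^^ 2) ^^ (2 ^ n)" by (simp add: E_def funpow_mult)
  also have "J ?h ^^ 2 = J ?h \<circ> J ?h" by (simp add: numeral_2_eq_2)
  finally have E: "E t (Suc n) = (J ?h \<circ> J ?h) ^^ (2 ^ n)" .
  have "p (E t (Suc n) x - E t n x) \<le> real (2 ^ n) * (?h * ?h * c)"
    unfolding E unfolding E_def
  proof (rule funpow_telescope[OF _ _ _ assms(2)])
    show "admissible (J ?h \<circ> J ?h)" "admissible (J (t / 2 ^ n))"
      using h admissible_J[of ?h] assms(1) by (auto intro!: admissible_comp admissible_J)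
    fix x assume x: "x \<in> K c"
    then have "J ?h (J ?h x) \<in> X" "J (t / 2 ^ n) x \<in> X" using KD[OF x] h assms(1) by auto
    then show "p ((J ?h \<circ> J ?h) x - J (t / 2 ^ n) x) \<le> ?h * ?h * c"
      using J_product_estimate[OF h(1) h(1) x] p_minus_commute unfolding h(2) by simp
  qed
  also have "\<dots> = t\<^sup>2 * c / 4 * (1/2) ^ n"
    by (simp add: power2_eq_square field_simps power_add)
  finally show ?thesis .
qed

lemma E_K_Cauchy:
  assumes "t > 0" "x \<in> K c" "m \<le> n"
  shows "p (E t n x - E t m x) \<le> t\<^sup>2 * c / 2 * (1/2) ^ m"
proof -
  have x: "x \<in> X" using assms KD by auto
  have c: "t\<^sup>2 * c \<ge> 0"
    using KD(3,4)[OF assms(2)] p_nonneg[of "A (A x)"] by (auto intro!: mult_nonneg_nonneg)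
  \<comment> \<open>The exact partial sum of the geometric series is carried along, since the final
    bound alone would not reproduce itself in the induction.\<close>
  have "p (E t (m + k) x - E t m x) \<le> t\<^sup>2 * c / 2 * ((1/2) ^ m - (1/2) ^ (m + k))" for k
  proof (induction k)
    case 0
    show ?case by (simp add: p_0)
  next
    case (Suc k)
    have "p (E t (m + Suc k) x - E t m x)
        \<le> p (E t (Suc (m + k)) x - E t (m + k) x) + p (E t (m + k) x - E t m x)"
      using E_X[OF assms(1) x] p_triangle by simp
    also have "\<dots> \<le> t\<^sup>2 * c / 4 * (1/2) ^ (m + k) + t\<^sup>2 * c / 2 * ((1/2) ^ m - (1/2) ^ (m + k))"
      by (intro add_mono E_step Suc assms)
    also have "\<dots> = t\<^sup>2 * c / 2 * ((1/2) ^ m - (1/2) ^ (m + Suc k))"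
      by (simp add: field_simps)
    finally show ?case .
  qed
  from this[of "n - m"] assms
  have "p (E t n x - E t m x) \<le> t\<^sup>2 * c / 2 * ((1/2) ^ m - (1/2) ^ n)" by simp
  also have "\<dots> \<le> t\<^sup>2 * c / 2 * (1/2) ^ m" using c by (intro mult_left_mono) auto
  finally show ?thesis .
qed

lemma E_Cauchy:
  assumes "t > 0" "f \<in> X" "e > 0"
  shows "\<exists>N0. \<forall>m\<ge>N0. \<forall>n\<ge>N0. p (E t m f - E t n f) < e"
proof -
  \<comment> \<open>A comparison with index \<open>N0\<close> costs three times
    \<open>e / 8\<close>: twice the distance of \<open>f\<close> to \<open>g\<close>, once the
    Cauchy estimate for \<open>g\<close>. Two such comparisons stay below \<open>e\<close>.\<close>
  obtain g c where g: "g \<in> K c" "p (f - g) < e / 8" using K_dense[of f "e/8"] assms by auto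
  have gX: "g \<in> X" using g KD by auto
  have "(\<lambda>m. t\<^sup>2 * c / 2 * (1/2) ^ m) \<longlonglongrightarrow> t\<^sup>2 * c / 2 * 0"
    by (intro tendsto_intros LIMSEQ_realpow_zero) auto
  then have "eventually (\<lambda>m. t\<^sup>2 * c / 2 * (1/2) ^ m < e / 8) sequentially"
    by (rule order_tendstoD(2)) (use assms in simp)
  then obtain N0 where N0: "t\<^sup>2 * c / 2 * (1/2) ^ N0 < e / 8" by (auto simp: eventually_sequentially)
  have *: "p (E t m f - E t N0 f) < 3 * (e / 8)" if "m \<ge> N0" for m
  proof -
    have X: "E t k f \<in> X" "E t k g \<in> X" for k using E_X assms gX by auto
    have "p (E t m f - E t m g) < e / 8" "p (E t N0 g - E t N0 f) < e / 8"
      using E_contraction[OF assms(1,2) gX, of m] E_contraction[OF assms(1) gX assms(2), of N0]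
        p_minus_commute[OF assms(2) gX] g(2) by simp_all
    moreover have "p (E t m g - E t N0 g) < e / 8" using le_less_trans[OF E_K_Cauchy[OF assms(1) g(1) that] N0] .
    ultimately show ?thesis
      using p_triangle[OF X(1)[of m] X(2)[of m] X(1)[of N0]]
        p_triangle[OF X(2)[of m] X(2)[of N0] X(1)[of N0]] by linarith
  qed
  show ?thesis
  proof (intro exI[of _ N0] allI impI)
    fix m n assume mn: "N0 \<le> m" "N0 \<le> n"
    have X: "E t k f \<in> X" for k using E_X assms by auto
    show "p (E t m f - E t n f) < e"
      using p_triangle[OF X[of m] X[of N0] X[of n]] *[OF mn(1)] *[OF mn(2)]
        p_minus_commute[OF X[of N0] X[of n]] assms(3) by simp
  qed
qed

text \<open>At \<open>t = 0\<close> the value is prescribed, since resolvents are controlled only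
  for positive step. For positive \<open>t\<close> any seminorm limit may be chosen; limits agree
  modulo \<open>N\<close>.\<close>

definition T where
  "T t f = (if t = 0 then f else SOME y. y \<in> X \<and> (\<lambda>n. p (E t n f - y)) \<longlonglongrightarrow> 0)"

lemma T_props:
  assumes "t > 0" "f \<in> X"
  shows "T t f \<in> X" and T_lim: "(\<lambda>n. p (E t n f - T t f)) \<longlonglongrightarrow> 0"
proof -
  have "\<exists>y\<in>X. (\<lambda>n. p (E t n f - y)) \<longlonglongrightarrow> 0"
    using E_X[OF assms] E_Cauchy[OF assms] by (intro complete) auto
  then have "\<exists>y. y \<in> X \<and> (\<lambda>n. p (E t n f - y)) \<longlonglongrightarrow> 0" by blast
  from someI_ex[OF this] show "T t f \<in> X" "(\<lambda>n. p (E t n f - T t f)) \<longlonglongrightarrow> 0"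
    using assms by (auto simp: T_def)
qed

lemma T_0: "T 0 f = f"
  by (simp add: T_def)

lemma T_X: "t \<ge> 0 \<Longrightarrow> f \<in> X \<Longrightarrow> T t f \<in> X"
  using T_props(1) T_0 by (cases "t = 0") auto

text \<open>Limits are determined only modulo null vectors, so estimates between approximations are
  passed to the limit through the triangle inequality.\<close>

lemma limit_estimate:
  assumes X: "\<And>n. x n \<in> X" "\<And>n. y n \<in> X" "a \<in> X" "b \<in> X"
    and lim: "(\<lambda>n. p (x n - a)) \<longlonglongrightarrow> 0" "(\<lambda>n. p (y n - b)) \<longlonglongrightarrow> 0" "c \<longlonglongrightarrow> c0"
    and le: "\<And>n. p (x n - y n) \<le> c n"
  shows "p (a - b) \<le> c0"
proof (rule LIMSEQ_le_const)
  show "(\<lambda>n. p (x n - a) + c n + p (y n - b)) \<longlonglongrightarrow> c0"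
    using tendsto_add[OF tendsto_add[OF lim(1,3)] lim(2)] by simp
  have "p (a - b) \<le> p (x n - a) + c n + p (y n - b)" for n
    using p_triangle[of a "x n" b] p_triangle[of "x n" "y n" b] p_minus_commute[of a "x n"] X le[of n] by simp
  then show "\<exists>N. \<forall>n\<ge>N. p (a - b) \<le> p (x n - a) + c n + p (y n - b)" by blast
qed

lemma T_nonexpansive:
  assumes "t \<ge> 0" "f \<in> X" "g \<in> X" shows "p (T t f - T t g) \<le> p (f - g)"
proof (cases "t = 0")
  case False
  then have t: "t > 0" using assms by simp
  show ?thesis
    by (rule limit_estimate[where x = "\<lambda>n. E t n f" and y = "\<lambda>n. E t n g" and c = "\<lambda>_. p (f - g)",
          OF _ _ _ _ T_lim[OF t assms(2)] T_lim[OF t assms(3)] tendsto_const])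
      (use t assms T_X E_X E_contraction in simp_all)
qed (simp add: T_0)

lemma T_linear:
  assumes "t \<ge> 0" "f \<in> X" "g \<in> X"
  shows "T t (a *\<^sub>R f + b *\<^sub>R g) - (a *\<^sub>R T t f + b *\<^sub>R T t g) \<in> N"
proof (cases "t = 0")
  case False
  then have t: "t > 0" using assms by simp
  have E: "E t n f \<in> X" "E t n g \<in> X" for n using t assms E_X by auto
  have T: "T t f \<in> X" "T t g \<in> X" using T_X assms by auto
  have "p (T t (a *\<^sub>R f + b *\<^sub>R g) - (a *\<^sub>R T t f + b *\<^sub>R T t g)) \<le> 0"
  proof (rule limit_estimate[where c = "\<lambda>_. 0"])
    show "(\<lambda>n. p (E t n (a *\<^sub>R f + b *\<^sub>R g) - T t (a *\<^sub>R f + b *\<^sub>R g))) \<longlonglongrightarrow> 0"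
      using T_lim t assms by simp
    show "(\<lambda>n. p ((a *\<^sub>R E t n f + b *\<^sub>R E t n g) - (a *\<^sub>R T t f + b *\<^sub>R T t g))) \<longlonglongrightarrow> 0"
    proof (rule Lim_null_comparison)
      show "(\<lambda>n. \<bar>a\<bar> * p (E t n f - T t f) + \<bar>b\<bar> * p (E t n g - T t g)) \<longlonglongrightarrow> 0"
        using tendsto_add[OF tendsto_mult_left[OF T_lim[OF t assms(2)], of "\<bar>a\<bar>"]
            tendsto_mult_left[OF T_lim[OF t assms(3)], of "\<bar>b\<bar>"]] by simp
      have "p ((a *\<^sub>R E t n f + b *\<^sub>R E t n g) - (a *\<^sub>R T t f + b *\<^sub>R T t g))
          \<le> \<bar>a\<bar> * p (E t n f - T t f) + \<bar>b\<bar> * p (E t n g - T t g)" for n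
      proof -
        have "(a *\<^sub>R E t n f + b *\<^sub>R E t n g) - (a *\<^sub>R T t f + b *\<^sub>R T t g)
            = a *\<^sub>R (E t n f - T t f) + b *\<^sub>R (E t n g - T t g)"
          by (simp add: algebra_simps)
        then show ?thesis
          using p_add[of "a *\<^sub>R (E t n f - T t f)" "b *\<^sub>R (E t n g - T t g)"] E T
          by (simp add: p_scale)
      qed
      then show "\<forall>\<^sub>F n in sequentially. norm (p ((a *\<^sub>R E t n f + b *\<^sub>R E t n g) - (a *\<^sub>R T t f + b *\<^sub>R T t g)))
          \<le> \<bar>a\<bar> * p (E t n f - T t f) + \<bar>b\<bar> * p (E t n g - T t g)"
        using p_nonneg E T by (intro always_eventually allI) simp
    qed
    show "p (E t n (a *\<^sub>R f + b *\<^sub>R g) - (a *\<^sub>R E t n f + b *\<^sub>R E t n g)) \<le> 0" for n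
      using admissibleD(4)[OF admissible_E[OF t] assms(2,3), of n a b] by (simp add: N_def)
  qed (use T_X E_X t assms E T in auto)
  then show ?thesis using T T_X assms by (intro NI) auto
qed (simp add: T_0 N_closed)

lemma T_contraction:
  assumes "t \<ge> 0" "f \<in> X" shows "p (T t f) \<le> p f"
proof -
  have "p (T t 0) = 0" using T_linear[OF assms(1) X_closed(1,1), of 0 0] by (simp add: N_def)
  then show ?thesis
    using T_nonexpansive[OF assms X_closed(1)] p_triangle_zero[of "T t f" "T t 0"] T_X assms by simp
qed

text \<open>With steps a = t / 2^n and b = u / 2^n, commutation turns \<open>E t n (E u n x)\<close>
  into the power of \<open>J a \<circ> J b\<close> with exponent 2^n. Replacing this product by
  \<open>J (a + b)\<close> costs a b c per factor, in total t u c / 2^n, which vanishes in the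
  limit.\<close>

lemma T_add_K:
  assumes "t > 0" "u > 0" "x \<in> K c" shows "p (T (t + u) x - T t (T u x)) \<le> 0"
proof (rule limit_estimate)
  have x: "x \<in> X" using assms KD by auto
  note X = x assms(1,2) E_X[OF assms(1)] E_X[OF assms(2) x] T_X
  show "(\<lambda>n. p (E (t + u) n x - T (t + u) x)) \<longlonglongrightarrow> 0" using T_lim assms x by simp
  show "(\<lambda>n. p (E t n (E u n x) - T t (T u x))) \<longlonglongrightarrow> 0"
  proof (rule Lim_null_comparison)
    show "(\<lambda>n. p (E u n x - T u x) + p (E t n (T u x) - T t (T u x))) \<longlonglongrightarrow> 0"
      using tendsto_add[OF T_lim[OF assms(2) x] T_lim[OF assms(1) T_X[OF _ x]]] assms by simp
    have "p (E t n (E u n x) - T t (T u x)) \<le> p (E u n x - T u x) + p (E t n (T u x) - T t (T u x))" for n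
      using p_triangle[of "E t n (E u n x)" "E t n (T u x)" "T t (T u x)"]
        E_contraction[of t "E u n x" "T u x" n] X by simp
    then show "\<forall>\<^sub>F n in sequentially. norm (p (E t n (E u n x) - T t (T u x)))
        \<le> p (E u n x - T u x) + p (E t n (T u x) - T t (T u x))"
      using p_nonneg X by (intro always_eventually allI) simp
  qed
  show "(\<lambda>n. t * u * c * (1/2) ^ n) \<longlonglongrightarrow> 0"
    using tendsto_mult_right_zero[OF LIMSEQ_realpow_zero[of "1/2::real"]] by simp
  fix n
  define a b where "a = t / 2 ^ n" and "b = u / 2 ^ n"
  have ab: "a > 0" "b > 0" "(t + u) / 2 ^ n = a + b" using assms by (auto simp: a_def b_def add_divide_distrib)
  note adm = admissible_J[OF ab(1)] admissible_J[OF ab(2)]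
  let ?m = "2 ^ n"
  have "((J a \<circ> J b) ^^ ?m) x - (J a ^^ ?m) ((J b ^^ ?m) x) \<in> N"
    using funpow_comp_mod[OF adm _ x] J_commute ab by blast
  moreover have "(J a ^^ ?m) ((J b ^^ ?m) x) = E t n (E u n x)" by (simp add: E_def a_def b_def)
  ultimately have 1: "p (((J a \<circ> J b) ^^ ?m) x - E t n (E u n x)) = 0" by (simp add: N_def)
  have "p ((J (a + b) ^^ ?m) x - ((J a \<circ> J b) ^^ ?m) x) \<le> real ?m * (a * b * c)"
    using J_product_estimate[OF ab(1,2)] ab adm assms
    by (intro funpow_telescope admissible_comp admissible_J) auto
  also have "\<dots> = t * u * c * (1/2) ^ n" by (simp add: a_def b_def field_simps)
  finally have 2: "p (E (t + u) n x - ((J a \<circ> J b) ^^ ?m) x) \<le> t * u * c * (1/2) ^ n"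
    by (simp add: E_def ab)
  have "((J a \<circ> J b) ^^ ?m) x \<in> X"
    by (intro admissibleD(1)[OF admissible_funpow] admissible_comp adm x)
  then show "p (E (t + u) n x - E t n (E u n x)) \<le> t * u * c * (1/2) ^ n"
    using 1 2 p_triangle[of "E (t + u) n x" "((J a \<circ> J b) ^^ ?m) x" "E t n (E u n x)"] X E_X[of "t + u" x n] by simp
qed (use assms KD E_X T_X in auto)

text \<open>Both sides are nonexpansive in \<open>f\<close>, so the law extends from the dense union
  of the sets \<open>K c\<close>.\<close>

lemma T_add:
  assumes "t \<ge> 0" "u \<ge> 0" "f \<in> X" shows "T (t + u) f - T t (T u f) \<in> N"
proof (cases "t = 0 \<or> u = 0")
  case True
  then show ?thesis by (auto simp: T_0 N_closed)
next
  case False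
  then have tu: "t > 0" "u > 0" using assms by auto
  have "p (T (t + u) f - T t (T u f)) \<le> e" if e: "e > 0" for e
  proof -
    obtain g c where g: "g \<in> K c" "p (f - g) < e / 2" using K_dense[of f "e/2"] assms e by auto
    have gX: "g \<in> X" using g KD by auto
    have X: "T (t + u) f \<in> X" "T (t + u) g \<in> X" "T t (T u f) \<in> X" "T t (T u g) \<in> X" "T u f \<in> X" "T u g \<in> X"
      using T_X assms gX by auto
    have "p (T (t + u) f - T (t + u) g) \<le> p (f - g)" using T_nonexpansive assms gX by auto
    moreover have "p (T t (T u g) - T t (T u f)) \<le> p (f - g)"
      using T_nonexpansive[OF assms(1) X(6,5)] T_nonexpansive[OF assms(2) gX assms(3)]
        p_minus_commute[OF assms(3) gX] by simp
    ultimately show ?thesis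
      using p_triangle[OF X(1,2,3)] p_triangle[OF X(2,4,3)] T_add_K[OF tu g(1)] g(2) by linarith
  qed
  then have "p (T (t + u) f - T t (T u f)) \<le> 0" by (rule field_le_epsilon[of _ 0, simplified])
  then show ?thesis using T_X assms by (intro NI) auto
qed

section \<open>The generator of the limit semigroup\<close>

lemma J_pow_minus_id:
  assumes "h > 0" "x \<in> D" shows "p ((J h ^^ m) x - x) \<le> real m * (h * p (A x))"
proof (induction m)
  case 0
  show ?case by (simp add: p_0)
next
  case (Suc m)
  note Jm = admissibleD[OF admissible_funpow[OF admissible_J[OF assms(1)], of m]]
  have X: "x \<in> X" "J h x \<in> X" "(J h ^^ m) x \<in> X" "(J h ^^ m) (J h x) \<in> X" using assms Jm(1) by auto
  have "p ((J h ^^ m) (J h x) - (J h ^^ m) x) \<le> h * p (A x)"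
    using Jm(3)[OF X(2,1)] J_minus_id[OF assms] by simp
  then show ?case using p_triangle[OF X(4,3,1)] Suc
    by (simp add: funpow_Suc_right algebra_simps del: funpow.simps)
qed

lemma J_pow_A:
  assumes "h > 0" "x \<in> D"
  shows "(J h ^^ m) x \<in> D" "A ((J h ^^ m) x) - (J h ^^ m) (A x) \<in> N"
proof (induction m)
  case 0
  { case 1 show ?case using assms by simp }
  { case 2 show ?case by (simp add: N_closed) }
next
  case (Suc m)
  note adm = admissible_J[OF assms(1)]
  have X: "(J h ^^ m) (A x) \<in> X" using admissibleD(1)[OF admissible_funpow[OF adm]] assms by auto
  { case 1 show ?case using J_D[OF assms(1)] Suc(1) by simp }
  { case 2
    have "A (J h ((J h ^^ m) x)) - J h (A ((J h ^^ m) x)) \<in> N"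
      using A_J_commute(2)[OF assms(1) Suc(1)] .
    moreover have "J h (A ((J h ^^ m) x)) - J h ((J h ^^ m) (A x)) \<in> N"
      by (rule J_cong[OF assms(1) _ X Suc(2)]) (use Suc(1) in auto)
    ultimately show ?case using N_trans by simp }
qed

text \<open>The left-hand side is \<open>h\<close> times the sum of
  \<open>(J h ^^ k) (A x) - A x\<close> for k from 1 to \<open>m\<close>. Since \<open>A x\<close>
  need not lie in \<open>D\<close>, it is compared with an auxiliary \<open>z\<close> in
  \<open>D\<close>, for which \<open>J_pow_minus_id\<close> applies.\<close>

lemma J_pow_expansion:
  assumes "h > 0" "x \<in> D" "z \<in> D"
  shows "p ((J h ^^ m) x - x - (real m * h) *\<^sub>R A x)
           \<le> real m * h * (2 * p (A x - z) + real m * h * p (A z))"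
proof -
  note adm = admissible_J[OF assms(1)]
  \<comment> \<open>Going from \<open>A x\<close> to \<open>z\<close> and back costs
    \<open>p (A x - z)\<close> twice; the last term bounds the motion of \<open>z\<close>
    itself.\<close>
  define \<delta> where "\<delta> = 2 * p (A x - z) + real m * h * p (A z)"
  have Jk: "p ((J h ^^ k) (A x) - A x) \<le> \<delta>" if "k \<le> m" for k
  proof -
    note k = admissibleD[OF admissible_funpow[OF adm, of k]]
    have X: "A x \<in> X" "z \<in> X" "(J h ^^ k) (A x) \<in> X" "(J h ^^ k) z \<in> X" using k assms by auto
    have "real k * (h * p (A z)) \<le> real m * (h * p (A z))"
      using that assms p_nonneg by (intro mult_right_mono) auto
    then have "p ((J h ^^ k) z - z) \<le> real m * h * p (A z)"
      using J_pow_minus_id[OF assms(1,3), of k] by simp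
    then show ?thesis
      using p_triangle[OF X(3,4,1)] p_triangle[OF X(4,2,1)] k(3)[OF X(1,2)] p_minus_commute[OF X(1,2)]
      by (simp add: \<delta>_def)
  qed
  have "p ((J h ^^ k) x - x - (real k * h) *\<^sub>R A x) \<le> real k * h * \<delta>" if "k \<le> m" for k
    using that
  proof (induction k)
    case 0
    show ?case by (simp add: p_0)
  next
    case (Suc k)
    let ?y = "(J h ^^ k) x" and ?z = "(J h ^^ Suc k) (A x)"
    have D: "?y \<in> D" "J h ?y \<in> D" using J_pow_A[OF assms(1,2), of k] J_D assms(1) by auto
    have X: "x \<in> X" "?y \<in> X" "J h ?y \<in> X" "A (J h ?y) \<in> X" "?z \<in> X" "A x \<in> X" "A ?y \<in> X"
      using D assms admissibleD(1)[OF admissible_funpow[OF adm, of "Suc k"]] by auto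
    have Az: "A (J h ?y) - ?z \<in> N" using J_pow_A(2)[OF assms(1,2), of "Suc k"] by simp
    have "(J h ?y - x - (real (Suc k) * h) *\<^sub>R A x)
        - ((?y - x - (real k * h) *\<^sub>R A x) + h *\<^sub>R (?z - A x))
      = h *\<^sub>R (A (J h ?y) - ?z) + (J h ?y - h *\<^sub>R A (J h ?y) - ?y)"
      by (simp add: algebra_simps)
    also have "\<dots> \<in> N" using Az J_N[OF assms(1) X(2)] by - (assumption | rule N_closed(2-4))+
    finally have "p (J h ?y - x - (real (Suc k) * h) *\<^sub>R A x)
        = p ((?y - x - (real k * h) *\<^sub>R A x) + h *\<^sub>R (?z - A x))"
      by (rule p_cong) (intro X_closed X)+
    also have "\<dots> \<le> p (?y - x - (real k * h) *\<^sub>R A x) + p (h *\<^sub>R (?z - A x))"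
      by (intro p_add X_closed X)
    also have "\<dots> \<le> real k * h * \<delta> + h * \<delta>"
    proof (intro add_mono)
      show "p (h *\<^sub>R (?z - A x)) \<le> h * \<delta>"
        unfolding p_scale[OF X_closed(3)[OF X(5,6)]] using Jk[OF Suc.prems] assms(1) by simp
    qed (use Suc in simp)
    finally show ?case by (simp add: algebra_simps)
  qed
  from this[of m] show ?thesis by (simp add: \<delta>_def)
qed

lemma T_minus_id:
  assumes "t \<ge> 0" "x \<in> D" shows "p (T t x - x) \<le> t * p (A x)"
proof (cases "t = 0")
  case False
  then have t: "t > 0" using assms by simp
  show ?thesis
  proof (rule limit_estimate[where x = "\<lambda>n. E t n x" and y = "\<lambda>_. x" and c = "\<lambda>_. t * p (A x)"])
    show "p (E t n x - x) \<le> t * p (A x)" for n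
      using J_pow_minus_id[of "t / 2 ^ n" x "2 ^ n"] t assms by (simp add: E_def)
  qed (use T_lim t assms E_X T_X p_0 in auto)
qed (simp add: T_0 p_0)

text \<open>With 2^n factors of step t / 2^n the product of number and step is \<open>t\<close> for
  every n, so the bound of \<open>J_pow_expansion\<close> is independent of n and survives the
  limit.\<close>

lemma T_expansion:
  assumes "t > 0" "x \<in> D" "z \<in> D"
  shows "p (T t x - x - t *\<^sub>R A x) \<le> t * (2 * p (A x - z) + t * p (A z))"
proof -
  let ?c = "t * (2 * p (A x - z) + t * p (A z))"
  have "p (T t x - (x + t *\<^sub>R A x)) \<le> ?c"
  proof (rule limit_estimate[where x = "\<lambda>n. E t n x" and y = "\<lambda>_. x + t *\<^sub>R A x" and c = "\<lambda>_. ?c"])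
    show "p (E t n x - (x + t *\<^sub>R A x)) \<le> ?c" for n
      using J_pow_expansion[of "t / 2 ^ n" x z "2 ^ n"] assms by (simp add: E_def diff_diff_add)
  qed (use T_lim assms E_X T_X p_0 in auto)
  then show ?thesis by (simp add: diff_diff_add)
qed

lemma T_continuous:
  assumes "f \<in> X" shows "((\<lambda>t. p (T t f - f)) \<longlongrightarrow> 0) (at_right 0)"
proof (rule tendstoI)
  fix e :: real assume e: "e > 0"
  obtain g where g: "g \<in> D" "p (f - g) < e / 3" using D_dense[of f "e/3"] assms e by auto
  have "((\<lambda>t. t * p (A g)) \<longlongrightarrow> 0 * p (A g)) (at_right 0)" by (intro tendsto_intros)
  then have "eventually (\<lambda>t. t * p (A g) < e / 3) (at_right 0)"
    using e by (intro order_tendstoD(2)) auto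
  moreover have "eventually (\<lambda>t. t > 0) (at_right (0::real))" by (simp add: eventually_at_right_less)
  ultimately show "eventually (\<lambda>t. dist (p (T t f - f)) 0 < e) (at_right 0)"
  proof eventually_elim
    case (elim t)
    have X: "f \<in> X" "g \<in> X" "T t f \<in> X" "T t g \<in> X" using T_X assms g elim by auto
    have "p (T t f - f) < e"
      using T_nonexpansive[OF _ X(1,2), of t] T_minus_id[OF _ g(1), of t] elim g(2)
        p_triangle[OF X(3,4,1)] p_triangle[OF X(4,2,1)] p_minus_commute[OF X(1,2)] by simp
    then show ?case using p_nonneg X by simp
  qed
qed

lemma p_scaled_quotient:
  assumes "t > 0" "f \<in> X" "g \<in> X"
  shows "p ((1 / t) *\<^sub>R (T t f - f) - g) = p (T t f - f - t *\<^sub>R g) / t"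
proof -
  have "(1 / t) *\<^sub>R (T t f - f) - g = (1 / t) *\<^sub>R (T t f - f - t *\<^sub>R g)"
    using assms by (simp add: algebra_simps)
  then show ?thesis using p_scale[of "T t f - f - t *\<^sub>R g" "1 / t"] assms T_X by simp
qed

lemma T_derivative:
  assumes "f \<in> D" shows "((\<lambda>t. p ((1 / t) *\<^sub>R (T t f - f) - A f)) \<longlongrightarrow> 0) (at_right 0)"
proof (rule tendstoI)
  fix e :: real assume e: "e > 0"
  \<comment> \<open>The order of choices matters: \<open>z\<close> is fixed close to
    \<open>A f\<close> first, and only then is \<open>t\<close> made small against
    \<open>p (A z)\<close>.\<close>
  obtain z where z: "z \<in> D" "p (A f - z) < e / 4" using D_dense[of "A f" "e/4"] assms e by auto
  have "((\<lambda>t. t * p (A z)) \<longlongrightarrow> 0 * p (A z)) (at_right 0)" by (intro tendsto_intros)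
  then have "eventually (\<lambda>t. t * p (A z) < e / 2) (at_right 0)"
    using e by (intro order_tendstoD(2)) auto
  moreover have "eventually (\<lambda>t. t > 0) (at_right (0::real))" by (simp add: eventually_at_right_less)
  ultimately show "eventually (\<lambda>t. dist (p ((1 / t) *\<^sub>R (T t f - f) - A f)) 0 < e) (at_right 0)"
  proof eventually_elim
    case (elim t)
    have X: "f \<in> X" "A f \<in> X" "T t f \<in> X" using T_X assms elim by auto
    have "p (T t f - f - t *\<^sub>R A f) / t \<le> 2 * p (A f - z) + t * p (A z)"
      using T_expansion[OF elim(2) assms z(1)] elim(2) by (simp add: field_simps)
    then have "p ((1 / t) *\<^sub>R (T t f - f) - A f) < e"
      unfolding p_scaled_quotient[OF elim(2) X(1,2)] using z(2) elim(1) by simp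
    then show ?case using p_nonneg X by simp
  qed
qed

text \<open>The generator extends \<open>A\<close>; as \<open>I - A\<close> is already onto and the semigroup is contractive, it
  cannot be a proper extension.\<close>

lemma derivative_imp_D:
  assumes "f \<in> X" "g \<in> X" and lim: "((\<lambda>t. p ((1 / t) *\<^sub>R (T t f - f) - g)) \<longlongrightarrow> 0) (at_right 0)"
  shows "f \<in> D" "A f - g \<in> N"
proof -
  define u where "u = J 1 (f - g)"
  define w where "w = f - u"
  have u: "u \<in> D" unfolding u_def using J_D assms by auto
  then have X: "u \<in> X" "A u \<in> X" "w \<in> X" using assms by (auto simp: w_def)
  have Nu: "u - A u - (f - g) \<in> N" using J_N[of 1 "f - g"] assms by (simp add: u_def)
  \<comment> \<open>The derivative of the semigroup at \<open>w\<close> is \<open>g - A u\<close>,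
    that is, \<open>w\<close> itself. Hence \<open>T t w\<close> would grow like
    \<open>(1 + t) w\<close>, which contractivity allows only if \<open>p w = 0\<close>.\<close>
  have gw: "(g - A u) - w \<in> N"
  proof -
    have "(g - A u) - w = u - A u - (f - g)" by (simp add: w_def)
    then show ?thesis using Nu by (simp only:)
  qed
  define r where "r t = p ((1 / t) *\<^sub>R (T t f - f) - g) + p ((1 / t) *\<^sub>R (T t u - u) - A u)" for t
  have r: "(r \<longlongrightarrow> 0) (at_right 0)"
    unfolding r_def using tendsto_add[OF lim T_derivative[OF u]] by simp
  have "eventually (\<lambda>t. p w \<le> r t) (at_right 0)"
  proof (rule eventually_mono[OF eventually_at_right_less])
    fix t :: real assume t: "t > 0"
    have TX: "T t f \<in> X" "T t u \<in> X" "T t w \<in> X" using T_X X assms t by auto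
    have "T t w - (T t f - T t u) \<in> N" using T_linear[of t f u 1 "-1"] t assms X by (simp add: w_def)
    from N_closed(2)[OF this N_closed(4)[OF gw, of "t"]]
    have "(T t w - (w + t *\<^sub>R w)) - ((T t f - f - t *\<^sub>R g) - (T t u - u - t *\<^sub>R A u)) \<in> N"
      by (simp add: algebra_simps w_def)
    then have "p (T t w - (w + t *\<^sub>R w)) = p ((T t f - f - t *\<^sub>R g) - (T t u - u - t *\<^sub>R A u))"
      using TX X assms by (intro p_cong) auto
    also have "\<dots> \<le> p (T t f - f - t *\<^sub>R g) + p (T t u - u - t *\<^sub>R A u)"
      using p_triangle[of "T t f - f - t *\<^sub>R g" 0 "T t u - u - t *\<^sub>R A u"]
        p_minus_commute[of 0 "T t u - u - t *\<^sub>R A u"] TX X assms by simp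
    also have "\<dots> = t * r t"
      using p_scaled_quotient[OF t assms(1,2)] p_scaled_quotient[OF t X(1,2)] t by (simp add: r_def field_simps)
    finally have "p (w + t *\<^sub>R w) \<le> t * r t + p (T t w)"
      using p_triangle_zero[of "w + t *\<^sub>R w" "T t w"] p_minus_commute[of "w + t *\<^sub>R w" "T t w"] TX X by simp
    also have "p (T t w) \<le> p w" using T_contraction t X by auto
    also have "w + t *\<^sub>R w = (1 + t) *\<^sub>R w" by (simp add: algebra_simps)
    finally have "t * p w \<le> t * r t" using p_scale[OF X(3), of "1 + t"] t by (simp add: algebra_simps)
    then show "p w \<le> r t" using t by simp
  qed
  then have "p w \<le> 0" by (rule tendsto_lowerbound[OF r _ trivial_limit_at_right_real])
  then have uw: "u - f \<in> N" using NI[OF X(3)] N_sym by (simp add: w_def)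
  show f: "f \<in> D" using D_cong'(1)[OF u assms(1) uw] .
  have "A f - A u \<in> N" using N_sym[OF D_cong'(2)[OF u assms(1) uw]] .
  moreover have "A u - g \<in> N"
  proof -
    have "A u - g = (u - f) - (u - A u - (f - g))" by simp
    then show ?thesis using N_closed(3)[OF uw Nu] by (simp only:)
  qed
  ultimately show "A f - g \<in> N" by (rule N_trans)
qed

lemma generator_iff:
  assumes "f \<in> X" "g \<in> X"
  shows "((\<lambda>t. p ((1 / t) *\<^sub>R (T t f - f) - g)) \<longlongrightarrow> 0) (at_right 0) \<longleftrightarrow> f \<in> D \<and> p (A f - g) = 0"
proof
  assume "((\<lambda>t. p ((1 / t) *\<^sub>R (T t f - f) - g)) \<longlongrightarrow> 0) (at_right 0)"
  from derivative_imp_D[OF assms this] show "f \<in> D \<and> p (A f - g) = 0" by (simp add: N_def)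
next
  assume *: "f \<in> D \<and> p (A f - g) = 0"
  then have Ag: "A f - g \<in> N" using assms by (simp add: N_def)
  have "p ((1 / t) *\<^sub>R (T t f - f) - g) = p ((1 / t) *\<^sub>R (T t f - f) - A f)" if "t > 0" for t
    using that assms * T_X Ag by (intro p_cong) auto
  then have "eventually (\<lambda>t. p ((1 / t) *\<^sub>R (T t f - f) - A f) = p ((1 / t) *\<^sub>R (T t f - f) - g)) (at_right 0)"
    by (intro eventually_mono[OF eventually_at_right_less]) auto
  from Lim_transform_eventually[OF T_derivative this] *
  show "((\<lambda>t. p ((1 / t) *\<^sub>R (T t f - f) - g)) \<longlongrightarrow> 0) (at_right 0)" by blast
qed

text \<open>The approximations are iterated resolvents of \<open>f\<close>, so stability under
  resolvents and seminorm limits suffices. The premise on resolvents speaks of every solution in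
  \<open>D\<close>, which frees it from the representative that \<open>J\<close> selects. Order and
  mass constraints are transferred to the semigroup in this way.\<close>

lemma T_invariant:
  assumes Q: "Q \<subseteq> X"
    and closed: "\<And>x y. \<lbrakk>\<And>n::nat. x n \<in> Q; y \<in> X; (\<lambda>n. p (x n - y)) \<longlonglongrightarrow> 0\<rbrakk> \<Longrightarrow> y \<in> Q"
    and resolvent: "\<And>h x f. \<lbrakk>h > 0; x \<in> D; f \<in> Q; p (x - h *\<^sub>R A x - f) = 0\<rbrakk> \<Longrightarrow> x \<in> Q"
    and "t \<ge> 0" "f \<in> Q"
  shows "T t f \<in> Q"
proof (cases "t = 0")
  case False
  then have t: "t > 0" using assms by simp
  have f: "f \<in> X" using assms(5) Q by blast
  have J: "J h x \<in> Q" if h: "h > 0" and x: "x \<in> Q" for h x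
  proof -
    have "x \<in> X" using x Q by blast
    from J_D[OF h this] J_N[OF h this] show ?thesis
      using resolvent[OF h _ x] by (simp add: N_def)
  qed
  have "(J h ^^ m) x \<in> Q" if "h > 0" "x \<in> Q" for h x m
    by (induction m) (simp_all add: that J)
  from this[OF _ assms(5)] have "E t n f \<in> Q" for n unfolding E_def using t by simp
  from closed[OF this T_X[OF assms(4) f] T_lim[OF t f]] show ?thesis .
qed (use assms T_0 in auto)

end

section \<open>Passage to spaces of real functions\<close>

instantiation "fun" :: (type, real_vector) real_vector
begin

definition "a *\<^sub>R f = (\<lambda>x. a *\<^sub>R f x)"

instance
  by standard (simp_all add: scaleR_fun_def fun_eq_iff scaleR_add_left scaleR_add_right)

end

lemma dissipative_operator_generates:
  fixes X :: "('s \<Rightarrow> real) set"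
  assumes "dissipative_operator X p D A"
  shows "generates X p D A (dissipative_operator.T X p D A)"
proof -
  interpret dissipative_operator X p D A by fact
  note pointwise = scaleR_fun_def fun_diff_def plus_fun_def
  have "c0_semigroup X p T"
    unfolding c0_semigroup_def
  proof (intro conjI allI impI ballI)
    fix t :: real and f g :: "'s \<Rightarrow> real" and a b :: real
    assume t: "t \<ge> 0" and f: "f \<in> X" and g: "g \<in> X"
    show "p (\<lambda>s. T t (\<lambda>u. a * f u + b * g u) s - (a * T t f s + b * T t g s)) = 0"
      using T_linear[OF t f g, of a b] by (simp add: pointwise N_def)
  next
    fix t :: real assume t: "t \<ge> 0"
    show "\<exists>C. \<forall>f\<in>X. p (T t f) \<le> C * p f"
      using T_contraction[OF t] by (intro exI[of _ 1]) simp
  next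
    fix t u f assume "t \<ge> (0::real)" "u \<ge> (0::real)" "f \<in> X"
    then show "p (\<lambda>s. T (t + u) f s - T t (T u f) s) = 0"
      using T_add[of t u f] by (simp add: fun_diff_def N_def)
  next
    fix f assume "f \<in> X"
    then show "((\<lambda>t. p (\<lambda>s. T t f s - f s)) \<longlongrightarrow> 0) (at_right 0)"
      using T_continuous by (simp add: fun_diff_def)
  qed (use T_X p_0 in \<open>auto simp: T_0 zero_fun_def\<close>)
  moreover have "((\<lambda>t. p (\<lambda>s. (T t f s - f s) / t - g s)) \<longlongrightarrow> 0) (at_right 0) \<longleftrightarrow>
      f \<in> D \<and> p (\<lambda>s. A f s - g s) = 0" if "f \<in> X" "g \<in> X" for f g
    using generator_iff[OF that] by (simp add: pointwise)
  ultimately show ?thesis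
    unfolding generates_def by auto
qed

section \<open>Primitives of integrable functions\<close>

lemma set_integral_AE_eq:
  fixes f g :: "'a \<Rightarrow> 'b::{banach, second_countable_topology}"
  assumes "set_integrable M A f" "set_integrable M A g" "AE x\<in>A in M. f x = g x"
  shows "(LINT x:A|M. f x) = (LINT x:A|M. g x)"
  unfolding set_lebesgue_integral_def
proof (rule integral_cong_AE)
  show "(\<lambda>x. indicat_real A x *\<^sub>R f x) \<in> borel_measurable M" "(\<lambda>x. indicat_real A x *\<^sub>R g x) \<in> borel_measurable M"
    using assms(1,2) by (auto simp: set_integrable_def)
  show "AE x in M. indicat_real A x *\<^sub>R f x = indicat_real A x *\<^sub>R g x"
    using assms(3) by eventually_elim (auto simp: indicator_def)
qed

lemma set_integrable_mult_bounded:
  fixes k s :: "real \<Rightarrow> real"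
  assumes k: "set_integrable lborel A k" and s: "s \<in> borel_measurable borel" and A: "A \<in> sets borel"
    and bound: "\<And>x. x \<in> A \<Longrightarrow> \<bar>s x\<bar> \<le> c"
  shows "set_integrable lborel A (\<lambda>x. k x * s x)"
proof -
  have "set_integrable lborel A (\<lambda>x. c * k x)" using k by simp
  moreover have "(\<lambda>x. (indicator A x *\<^sub>R k x) * s x) \<in> borel_measurable lborel"
    using k s by (intro borel_measurable_times) (auto simp: set_integrable_def dest: borel_measurable_integrable)
  then have "set_borel_measurable lborel A (\<lambda>x. k x * s x)"
    by (simp add: set_borel_measurable_def mult.assoc)
  moreover have "norm (k x * s x) \<le> norm (c * k x)" if "x \<in> A" for x
  proof -
    have "\<bar>k x\<bar> * \<bar>s x\<bar> \<le> \<bar>k x\<bar> * \<bar>c\<bar>" using bound[OF that] by (intro mult_left_mono) auto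
    then show ?thesis by (simp add: abs_mult mult.commute)
  qed
  then have "AE x in lborel. x \<in> A \<longrightarrow> norm (k x * s x) \<le> norm (c * k x)" by simp
  ultimately show ?thesis by (rule set_integrable_bound)
qed

lemma continuous_on_Icc_bound:
  fixes s :: "real \<Rightarrow> real"
  assumes "continuous_on {a..b} s" obtains c where "c \<ge> 0" "\<And>x. x \<in> {a..b} \<Longrightarrow> \<bar>s x\<bar> \<le> c"
proof -
  have "bounded (s ` {a..b})" by (intro compact_imp_bounded compact_continuous_image assms) auto
  then obtain c where "\<forall>x\<in>s ` {a..b}. norm x \<le> c" unfolding bounded_iff by blast
  then have "\<bar>s x\<bar> \<le> max 0 c" if "x \<in> {a..b}" for x using that by force
  then show ?thesis using that[of "max 0 c"] by auto
qed

lemma set_integrable_mult_continuous: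
  fixes k s :: "real \<Rightarrow> real"
  assumes "set_integrable lborel {a<..<b} k" "continuous_on UNIV s"
  shows "set_integrable lborel {a<..<b} (\<lambda>x. k x * s x)"
proof -
  obtain c where "\<And>x. x \<in> {a..b} \<Longrightarrow> \<bar>s x\<bar> \<le> c"
    using continuous_on_Icc_bound[OF continuous_on_subset[OF assms(2)]] by blast
  then show ?thesis
    using assms by (intro set_integrable_mult_bounded[of _ _ _ c]) (auto intro: borel_measurable_continuous_onI)
qed

lemma set_integrable_continuous_Ioo:
  fixes s :: "real \<Rightarrow> real"
  assumes "continuous_on {a..b} s" shows "set_integrable lborel {a<..<b} s"
  using borel_integrable_atLeastAtMost'[OF assms] by (rule set_integrable_subset) auto

text \<open>Absolute continuity on [0, b] with derivative \<open>k\<close>, in integral form. The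
  values of \<open>g\<close> are meaningful at every point, including the endpoints, while
  \<open>k\<close> matters only almost everywhere.\<close>

definition primitive_on :: "real \<Rightarrow> (real \<Rightarrow> real) \<Rightarrow> (real \<Rightarrow> real) \<Rightarrow> bool" where
  "primitive_on b g k \<longleftrightarrow> set_integrable lborel {0<..<b} k \<and>
     (\<forall>x\<in>{0..b}. g x = g 0 + (LBINT y:{0<..<x}. k y))"

lemma primitive_onD:
  assumes "primitive_on b g k"
  shows "set_integrable lborel {0<..<b} k"
    "\<And>x. 0 \<le> x \<Longrightarrow> x \<le> b \<Longrightarrow> g x = g 0 + (LBINT y:{0<..<x}. k y)"
  using assms unfolding primitive_on_def by (blast, meson atLeastAtMost_iff)

lemma set_integrable_Ioo_mono:
  "set_integrable lborel {0<..<b} k \<Longrightarrow> x \<le> b \<Longrightarrow> set_integrable lborel {0<..<x::real} (k :: real \<Rightarrow> real)"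
  by (rule set_integrable_subset) auto

lemma primitive_on_continuous:
  assumes "primitive_on b g k" shows "continuous_on {0..b} g"
proof -
  have k: "set_integrable lborel {0<..<b} k" using primitive_onD[OF assms] by simp
  have "k integrable_on {0..b}"
    using set_borel_integral_eq_integral(1)[OF k] by (simp add: integrable_on_Icc_iff_Ioo)
  then have "continuous_on {0..b} (\<lambda>x. g 0 + integral {0..x} k)"
    by (intro continuous_intros indefinite_integral_continuous_1)
  moreover have "g 0 + integral {0..x} k = g x" if "x \<in> {0..b}" for x
    using primitive_onD(2)[OF assms, of x] that
      set_borel_integral_eq_integral(2)[OF set_integrable_Ioo_mono[OF k, of x]]
    by (simp add: integral_open_interval_real)
  ultimately show ?thesis by (rule continuous_on_eq) simp
qed

lemma primitive_on_linear:
  assumes "primitive_on b f f'" "primitive_on b g g'"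
  shows "primitive_on b (\<lambda>x. \<alpha> * f x + \<beta> * g x) (\<lambda>x. \<alpha> * f' x + \<beta> * g' x)"
  unfolding primitive_on_def
proof (intro conjI ballI)
  note f = primitive_onD[OF assms(1)] and g = primitive_onD[OF assms(2)]
  show "set_integrable lborel {0<..<b} (\<lambda>x. \<alpha> * f' x + \<beta> * g' x)"
    using f(1) g(1) by (intro set_integral_add) auto
  fix x assume x: "x \<in> {0..b}"
  have "set_integrable lborel {0<..<x} f'" "set_integrable lborel {0<..<x} g'"
    using f(1) g(1) x by (auto intro: set_integrable_Ioo_mono)
  then have "(LBINT y:{0<..<x}. \<alpha> * f' y + \<beta> * g' y)
      = \<alpha> * (LBINT y:{0<..<x}. f' y) + \<beta> * (LBINT y:{0<..<x}. g' y)"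
    by (subst set_integral_add) auto
  then show "\<alpha> * f x + \<beta> * g x = \<alpha> * f 0 + \<beta> * g 0 + (LBINT y:{0<..<x}. \<alpha> * f' y + \<beta> * g' y)"
    using f(2)[of x] g(2)[of x] x by (simp add: algebra_simps)
qed

lemma primitive_on_cong:
  assumes "primitive_on b f f'" "\<And>x. x \<in> {0..b} \<Longrightarrow> g x = f x"
    and "set_integrable lborel {0<..<b} g'" "AE x\<in>{0<..<b} in lborel. g' x = f' x"
  shows "primitive_on b g g'"
  unfolding primitive_on_def
proof (intro conjI ballI)
  fix x assume x: "x \<in> {0..b}"
  have "(LBINT y:{0<..<x}. g' y) = (LBINT y:{0<..<x}. f' y)"
  proof (rule set_integral_AE_eq)
    show "set_integrable lborel {0<..<x} g'" "set_integrable lborel {0<..<x} f'"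
      using assms(3) primitive_onD(1)[OF assms(1)] x by (auto intro: set_integrable_Ioo_mono)
    show "AE y\<in>{0<..<x} in lborel. g' y = f' y" using assms(4) by eventually_elim (use x in auto)
  qed
  then show "g x = g 0 + (LBINT y:{0<..<x}. g' y)"
    using primitive_onD(2)[OF assms(1), of x] x assms(2)[of x] assms(2)[of 0] by auto
qed (fact assms)

lemma LINT_deriv:
  assumes "\<And>x. (s has_real_derivative s' x) (at x)" "continuous_on UNIV s'" "a \<le> b"
  shows "(LBINT y:{a<..<b}. s' y) = s b - s a"
proof -
  have c: "continuous_on {a..b} s'" by (rule continuous_on_subset[OF assms(2)]) auto
  have "(LBINT y:{a<..<b}. s' y) = integral {a..b} s'"
    using set_borel_integral_eq_integral(2)[OF set_integrable_continuous_Ioo[OF c]]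
    by (simp add: integral_open_interval_real)
  also have "(s' has_integral s b - s a) {a..b}"
    using assms(1,3) by (intro fundamental_theorem_of_calculus)
      (auto simp: has_real_derivative_iff_has_vector_derivative[symmetric] intro: has_field_derivative_at_within)
  then have "integral {a..b} s' = s b - s a" by blast
  finally show ?thesis .
qed

lemma primitive_on_deriv:
  assumes "\<And>x. (s has_real_derivative s' x) (at x)" "continuous_on UNIV s'"
  shows "primitive_on b s s'"
  unfolding primitive_on_def
proof (intro conjI ballI)
  show "set_integrable lborel {0<..<b} s'"
    by (intro set_integrable_continuous_Ioo continuous_on_subset[OF assms(2)]) auto
  fix x assume "x \<in> {0..b}"
  then show "s x = s 0 + (LBINT y:{0<..<x}. s' y)" using LINT_deriv[OF assms, of 0 x] by simp
qed

text \<open>Both sides are the integral of \<open>k z * s y\<close> over the triangle 0 < z < y < x.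
  This replaces pointwise differentiation in the product rule for primitives.\<close>

lemma Fubini_triangle:
  fixes k s :: "real \<Rightarrow> real"
  assumes k: "set_integrable lborel {0<..<x} k" and s: "set_integrable lborel {0<..<x} s"
  shows "(LBINT y:{0<..<x}. (LBINT z:{0<..<y}. k z) * s y)
       = (LBINT z:{0<..<x}. k z * (LBINT y:{z<..<x}. s y))"
proof -
  define k' where "k' z = indicator {0<..<x} z * k z" for z
  define s' where "s' y = indicator {0<..<x} y * s y" for y
  have k': "integrable lborel k'" and s': "integrable lborel s'"
    using k s by (auto simp: set_integrable_def k'_def[abs_def] s'_def[abs_def])
  have [measurable]: "k' \<in> borel_measurable borel" "s' \<in> borel_measurable borel"
    using k' s' by auto
  define F where "F = (\<lambda>(z, y). if z < y then k' z * s' y else 0)"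
  have Fm: "F \<in> borel_measurable (lborel \<Otimes>\<^sub>M lborel)"
    unfolding F_def by measurable
  have F1 [measurable]: "(\<lambda>y. F (z, y)) \<in> borel_measurable borel" for z
    unfolding F_def prod.case by measurable
  have int2: "integrable lborel (\<lambda>y. F (z, y))" for z
  proof (rule Bochner_Integration.integrable_bound)
    show "integrable lborel (\<lambda>y. k' z * s' y)" using s' by simp
    show "(\<lambda>y. F (z, y)) \<in> borel_measurable lborel" by simp
  qed (auto simp: F_def indicator_def)
  have int: "integrable (lborel \<Otimes>\<^sub>M lborel) F"
  proof (rule lborel_pair.Fubini_integrable[OF Fm])
    \<comment> \<open>\<open>F\<close> is dominated by the product of the two integrable extensions
      by zero, so the inner integrals are dominated by a multiple of \<open>k'\<close>.\<close>
    show "integrable lborel (\<lambda>z. LBINT y. norm (F (z, y)))"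
    proof (rule Bochner_Integration.integrable_bound)
      show "integrable lborel (\<lambda>z. k' z * (LBINT y. norm (s' y)))" using k' by simp
      show "(\<lambda>z. LBINT y. norm (F (z, y))) \<in> borel_measurable lborel"
        using Fm by measurable
      have "(LBINT y. norm (F (z, y))) \<le> (LBINT y. norm (k' z * s' y))" for z
        using int2[of z] s' by (intro integral_mono) (auto simp: F_def indicator_def)
      then have "(LBINT y. norm (F (z, y))) \<le> norm (k' z * (LBINT y. norm (s' y)))" for z
        by (simp add: abs_mult)
      then show "AE z in lborel. norm (LBINT y. norm (F (z, y))) \<le> norm (k' z * (LBINT y. norm (s' y)))"
        by (intro always_eventually allI) simp
    qed
  qed (use int2 in auto)
  have "(LBINT y. LBINT z. F (z, y)) = (LBINT z. LBINT y. F (z, y))"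
    using lborel_pair.Fubini_integral[of "\<lambda>z y. F (z, y)"] int by simp
  moreover have "(LBINT z. F (z, y)) = indicator {0<..<x} y *\<^sub>R ((LBINT z:{0<..<y}. k z) * s y)" for y
  proof -
    have "F (z, y) = (indicator {0<..<y} z *\<^sub>R k z) * (indicator {0<..<x} y * s y)" for z
      by (auto simp: F_def k'_def s'_def indicator_def)
    then show ?thesis by (simp add: set_lebesgue_integral_def)
  qed
  moreover have "(LBINT y. F (z, y)) = indicator {0<..<x} z *\<^sub>R (k z * (LBINT y:{z<..<x}. s y))" for z
  proof -
    have "F (z, y) = (indicator {0<..<x} z * k z) * (indicator {z<..<x} y *\<^sub>R s y)" for y
      by (auto simp: F_def k'_def s'_def indicator_def)
    then show ?thesis by (simp add: set_lebesgue_integral_def)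
  qed
  ultimately show ?thesis by (simp add: set_lebesgue_integral_def)
qed

text \<open>With \<open>g = g 0 + G\<close>, the integral of \<open>G * s'\<close> is rearranged by
  Fubini; its inner integral is \<open>s x - s z\<close>, which yields integration by parts.\<close>

lemma primitive_on_mult:
  assumes g: "primitive_on b g k"
    and s: "\<And>x. (s has_real_derivative s' x) (at x)" "continuous_on UNIV s'"
  shows "primitive_on b (\<lambda>x. g x * s x) (\<lambda>x. k x * s x + g x * s' x)"
  unfolding primitive_on_def
proof (intro conjI ballI)
  note gD = primitive_onD[OF g]
  have sc: "continuous_on UNIV s" using s(1) DERIV_continuous_on by blast
  have ks: "set_integrable lborel {0<..<b} (\<lambda>x. k x * s x)"
    by (intro set_integrable_mult_continuous gD sc)
  have gs: "set_integrable lborel {0<..<b} (\<lambda>x. g x * s' x)"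
    by (intro set_integrable_continuous_Ioo continuous_intros primitive_on_continuous[OF g]
        continuous_on_subset[OF s(2)]) auto
  show "set_integrable lborel {0<..<b} (\<lambda>x. k x * s x + g x * s' x)" using ks gs by auto
  fix x assume x: "x \<in> {0..b}"
  have kx: "set_integrable lborel {0<..<x} k" using gD x by (auto intro: set_integrable_Ioo_mono)
  have sx: "set_integrable lborel {0<..<x} s'"
    by (intro set_integrable_continuous_Ioo continuous_on_subset[OF s(2)]) auto
  have ksx: "set_integrable lborel {0<..<x} (\<lambda>x. k x * s x)"
    by (intro set_integrable_mult_continuous kx sc)
  have gsx: "set_integrable lborel {0<..<x} (\<lambda>x. g x * s' x)"
    using gs x by (auto intro: set_integrable_Ioo_mono)
  define G where "G y = (LBINT z:{0<..<y}. k z)" for y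
  have gG: "g y * s' y = g 0 * s' y + G y * s' y" if "y \<in> {0<..<x}" for y
    using gD(2)[of y] that x by (simp add: G_def distrib_right[symmetric])
  then have eq: "(LBINT y:{0<..<x}. g y * s' y) = (LBINT y:{0<..<x}. g 0 * s' y + G y * s' y)"
    by (intro set_lebesgue_integral_cong) auto
  have Gs: "set_integrable lborel {0<..<x} (\<lambda>y. G y * s' y)"
  proof -
    have "set_integrable lborel {0<..<x} (\<lambda>y. g y * s' y - g 0 * s' y)"
      using gsx sx by auto
    moreover have "g y * s' y - g 0 * s' y = G y * s' y" if "y \<in> {0<..<x}" for y
      using gG[OF that] by simp
    ultimately show ?thesis by (subst (asm) set_integrable_cong[OF refl refl]) auto
  qed
  have "(LBINT y:{0<..<x}. G y * s' y) = (LBINT z:{0<..<x}. k z * (LBINT y:{z<..<x}. s' y))"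
    unfolding G_def by (rule Fubini_triangle[OF kx sx])
  also have "\<dots> = (LBINT z:{0<..<x}. k z * s x - k z * s z)"
    by (intro set_lebesgue_integral_cong) (simp_all add: LINT_deriv[OF s] right_diff_distrib)
  also have "\<dots> = G x * s x - (LBINT z:{0<..<x}. k z * s z)"
    using kx ksx by (subst set_integral_diff(2)) (simp_all add: G_def)
  finally have 1: "(LBINT y:{0<..<x}. G y * s' y) = G x * s x - (LBINT z:{0<..<x}. k z * s z)" .
  have "(LBINT y:{0<..<x}. k y * s y + g y * s' y)
      = (LBINT y:{0<..<x}. k y * s y) + (g 0 * (LBINT y:{0<..<x}. s' y) + (LBINT y:{0<..<x}. G y * s' y))"
    using ksx gsx sx Gs by (simp add: set_integral_add(2) eq)
  also have "\<dots> = g 0 * (s x - s 0) + G x * s x"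
    using 1 LINT_deriv[OF s, of 0 x] x by simp
  finally have L: "(LBINT y:{0<..<x}. k y * s y + g y * s' y) = g 0 * (s x - s 0) + G x * s x" .
  have "g x = g 0 + G x" unfolding G_def by (rule gD(2)) (use x in auto)
  then have "g x * s x = g 0 * s x + G x * s x" by (simp only: distrib_right)
  then show "g x * s x = g 0 * s 0 + (LBINT y:{0<..<x}. k y * s y + g y * s' y)"
    unfolding L right_diff_distrib by linarith
qed

section \<open>Polynomial approximation\<close>

lemma set_L1_dominated_convergence:
  fixes u :: "nat \<Rightarrow> 'a \<Rightarrow> real"
  assumes w: "set_integrable M A w" and f: "set_integrable M A f" and u: "\<And>n. set_integrable M A (u n)"
    and lim: "AE x\<in>A in M. (\<lambda>n. u n x) \<longlonglongrightarrow> f x"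
    and bound: "\<And>n x. x \<in> A \<Longrightarrow> \<bar>u n x\<bar> \<le> w x"
  shows "(\<lambda>n. LINT x:A|M. \<bar>u n x - f x\<bar>) \<longlonglongrightarrow> 0"
proof -
  have "(\<lambda>n. LINT x|M. indicator A x *\<^sub>R \<bar>u n x - f x\<bar>) \<longlonglongrightarrow> (LINT x|M. 0)"
  proof (rule integral_dominated_convergence)
    show "integrable M (\<lambda>x. indicator A x *\<^sub>R (w x + \<bar>f x\<bar>))"
      using set_integral_add(1)[OF w set_integrable_abs[OF f]] by (simp add: set_integrable_def)
    show "(\<lambda>x. indicator A x *\<^sub>R \<bar>u n x - f x\<bar>) \<in> borel_measurable M" for n
      using set_integrable_abs[OF set_integral_diff(1)[OF u f]] unfolding set_integrable_def
      by (rule borel_measurable_integrable)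
    show "AE x in M. (\<lambda>n. indicat_real A x *\<^sub>R \<bar>u n x - f x\<bar>) \<longlonglongrightarrow> 0"
      using lim
    proof eventually_elim
      case (elim x)
      then show ?case
        by (cases "x \<in> A") (auto simp: indicator_def intro!: tendsto_rabs_zero LIM_zero)
    qed
    show "AE x in M. norm (indicat_real A x *\<^sub>R \<bar>u n x - f x\<bar>) \<le> indicat_real A x *\<^sub>R (w x + \<bar>f x\<bar>)" for n
    proof (rule AE_I2)
      fix x show "norm (indicat_real A x *\<^sub>R \<bar>u n x - f x\<bar>) \<le> indicat_real A x *\<^sub>R (w x + \<bar>f x\<bar>)"
        using bound[of x n] by (cases "x \<in> A") auto
    qed
  qed simp
  then show ?thesis by (simp add: set_lebesgue_integral_def)
qed

lemma set_LINT_abs_le: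
  fixes f :: "'a \<Rightarrow> real"
  shows "\<bar>LINT x:A|M. f x\<bar> \<le> (LINT x:A|M. \<bar>f x\<bar>)"
  using integral_abs_bound[of M "\<lambda>x. indicator A x * f x"]
  by (simp add: set_lebesgue_integral_def abs_mult)

lemma set_LINT_L1_limit:
  fixes u :: "nat \<Rightarrow> 'a \<Rightarrow> real"
  assumes f: "set_integrable M A f" and u: "\<And>n. set_integrable M A (u n)"
    and lim: "(\<lambda>n. LINT x:A|M. \<bar>u n x - f x\<bar>) \<longlonglongrightarrow> 0"
  shows "(\<lambda>n. LINT x:A|M. u n x) \<longlonglongrightarrow> (LINT x:A|M. f x)"
proof (rule LIM_zero_cancel, rule Lim_null_comparison[OF _ lim])
  show "\<forall>\<^sub>F n in sequentially. norm ((LINT x:A|M. u n x) - (LINT x:A|M. f x)) \<le> (LINT x:A|M. \<bar>u n x - f x\<bar>)"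
    using set_LINT_abs_le[of M A "\<lambda>x. u n x - f x" for n] set_integral_diff(2)[OF u f]
    by (intro always_eventually allI) simp
qed

lemma real_polynomial_function_continuous:
  "real_polynomial_function (q :: real \<Rightarrow> real) \<Longrightarrow> continuous_on S q"
  by (simp add: continuous_on_polymonial_function real_polynomial_function_eq)

text \<open>A measurable function is an almost everywhere limit of continuous ones. These are
  clipped to [-M, M] and then approximated by the Weierstrass theorem within 1 / (n + 1); this last
  error accounts for the bound \<open>M + 1\<close>.\<close>

lemma bounded_polynomial_approximation:
  fixes f :: "real \<Rightarrow> real"
  assumes f: "f \<in> borel_measurable borel" and M: "\<And>x. \<bar>f x\<bar> \<le> M"
  obtains q where "\<And>n::nat. real_polynomial_function (q n)"
    "\<And>n x. x \<in> {0..b} \<Longrightarrow> \<bar>q n x\<bar> \<le> M + 1"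
    "AE x\<in>{0<..<b} in lborel. (\<lambda>n. q n x) \<longlonglongrightarrow> f x"
proof -
  have "f \<in> borel_measurable lebesgue" using f by (intro measurable_completion) simp
  then have "f measurable_on UNIV" by (rule lebesgue_measurable_imp_measurable_on_real) simp
  then obtain N g where N: "negligible N" and g: "\<And>n::nat. continuous_on UNIV (g n)"
    and lim: "\<And>x. x \<notin> N \<Longrightarrow> (\<lambda>n. g n x) \<longlonglongrightarrow> f x"
    unfolding measurable_on_def by auto
  define c where "c n x = max (- M) (min M (g n x))" for n x
  have "\<exists>q. real_polynomial_function q \<and> (\<forall>x\<in>{0..b}. \<bar>c n x - q x\<bar> < 1 / real (Suc n))" for n
  proof -
    have "continuous_on {0..b} (c n)"
      unfolding c_def by (intro continuous_intros continuous_on_subset[OF g]) auto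
    from Stone_Weierstrass_real_polynomial_function[OF _ this, of "1 / real (Suc n)"]
    obtain q where "real_polynomial_function q" "\<And>x. x \<in> {0..b} \<Longrightarrow> \<bar>c n x - q x\<bar> < 1 / real (Suc n)"
      by auto
    then show ?thesis by blast
  qed
  then obtain q where q: "\<And>n. real_polynomial_function (q n)"
    "\<And>n x. x \<in> {0..b} \<Longrightarrow> \<bar>c n x - q n x\<bar> < 1 / real (Suc n)" by metis
  have M0: "M \<ge> 0" using M[of 0] by linarith
  have bound: "\<bar>q n x\<bar> \<le> M + 1" if "x \<in> {0..b}" for n x
  proof -
    have "1 / real (Suc n) \<le> 1" by simp
    moreover have "\<bar>c n x\<bar> \<le> M" using M0 by (auto simp: c_def)
    ultimately show ?thesis using q(2)[OF that, of n] by linarith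
  qed
  have "AE x in lebesgue. x \<notin> N" using N by (intro AE_not_in) (simp add: negligible_iff_null_sets)
  then have AE_N: "AE x in lborel. x \<notin> N" by (simp add: AE_completion_iff)
  have "(\<lambda>n. q n x) \<longlonglongrightarrow> f x" if "x \<notin> N" "x \<in> {0<..<b}" for x
  proof -
    have "(\<lambda>n. c n x) \<longlonglongrightarrow> max (- M) (min M (f x))"
      unfolding c_def by (intro tendsto_intros lim that)
    also have "max (- M) (min M (f x)) = f x" using M[of x] by auto
    finally have "(\<lambda>n. c n x) \<longlonglongrightarrow> f x" .
    moreover have "(\<lambda>n. c n x - q n x) \<longlonglongrightarrow> 0"
      using q(2)[of x] that
      by (intro Lim_null_comparison[OF _ lim_inverse_n'[THEN LIMSEQ_Suc]] always_eventually)
        (auto simp: less_imp_le)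
    ultimately have "(\<lambda>n. c n x - (c n x - q n x)) \<longlonglongrightarrow> f x - 0" by (rule tendsto_diff)
    then show ?thesis by simp
  qed
  then have "AE x\<in>{0<..<b} in lborel. (\<lambda>n. q n x) \<longlonglongrightarrow> f x"
    using AE_N by auto
  with q(1) bound show ?thesis using that by blast
qed

text \<open>Bounded polynomials converging almost everywhere to the sign of \<open>k\<close> turn
  the hypothesis into the vanishing of the integral of \<open>\<bar>k\<bar>\<close>.\<close>

lemma orthogonal_to_polynomials_imp_zero:
  fixes k :: "real \<Rightarrow> real"
  assumes k: "set_integrable lborel {0<..<b} k"
    and zero: "\<And>q. real_polynomial_function q \<Longrightarrow> (LBINT x:{0<..<b}. k x * q x) = 0"
  shows "AE x\<in>{0<..<b} in lborel. k x = 0"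
proof -
  define k' where "k' x = indicator {0<..<b} x * k x" for x
  have k': "integrable lborel k'" using k by (simp add: set_integrable_def k'_def[abs_def])
  have m: "(\<lambda>x. sgn (k' x)) \<in> borel_measurable borel" using borel_measurable_integrable[OF k'] by simp
  obtain q where q: "\<And>n::nat. real_polynomial_function (q n)"
    "\<And>n x. x \<in> {0..b} \<Longrightarrow> \<bar>q n x\<bar> \<le> 1 + 1"
    "AE x\<in>{0<..<b} in lborel. (\<lambda>n. q n x) \<longlonglongrightarrow> sgn (k' x)"
    by (rule bounded_polynomial_approximation[OF m, of 1 b]) (auto simp: abs_sgn_eq)
  have int: "set_integrable lborel {0<..<b} (\<lambda>x. k x * sgn (k' x))"
    using m by (intro set_integrable_mult_bounded[OF k, of _ 1]) (auto simp: sgn_if)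
  have "(\<lambda>n. LBINT x:{0<..<b}. \<bar>k x * q n x - k x * sgn (k' x)\<bar>) \<longlonglongrightarrow> 0"
  proof (rule set_L1_dominated_convergence)
    show "set_integrable lborel {0<..<b} (\<lambda>x. 2 * \<bar>k x\<bar>)" using set_integrable_abs[OF k] by simp
    show "set_integrable lborel {0<..<b} (\<lambda>x. k x * q n x)" for n
      by (intro set_integrable_mult_continuous k real_polynomial_function_continuous q)
    show "AE x\<in>{0<..<b} in lborel. (\<lambda>n. k x * q n x) \<longlonglongrightarrow> k x * sgn (k' x)"
      using q(3) by eventually_elim (auto intro: tendsto_intros)
    show "\<bar>k x * q n x\<bar> \<le> 2 * \<bar>k x\<bar>" if "x \<in> {0<..<b}" for n x
      using mult_right_mono[OF q(2)[of x n], of "\<bar>k x\<bar>"] that by (simp add: abs_mult mult.commute)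
  qed (fact int)
  then have "(\<lambda>n. LBINT x:{0<..<b}. k x * q n x) \<longlonglongrightarrow> (LBINT x:{0<..<b}. k x * sgn (k' x))"
    by (intro set_LINT_L1_limit int set_integrable_mult_continuous k real_polynomial_function_continuous q)
  then have "(LBINT x:{0<..<b}. k x * sgn (k' x)) = 0"
    using zero[OF q(1)] by (simp add: LIMSEQ_const_iff)
  moreover have "indicator {0<..<b} x *\<^sub>R (k x * sgn (k' x)) = norm (k' x)" for x
    by (auto simp: k'_def indicator_def abs_sgn)
  ultimately have "(LBINT x. norm (k' x)) = 0" by (simp add: set_lebesgue_integral_def)
  then have "AE x in lborel. norm (k' x) = 0"
    by (subst (asm) integral_nonneg_eq_0_iff_AE) (use k' in auto)
  then show ?thesis by eventually_elim (auto simp: k'_def)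
qed

text \<open>The function is truncated at height n, which makes the bounded approximation available;
  dominated convergence controls both errors.\<close>

lemma L1_polynomial_dense:
  fixes k :: "real \<Rightarrow> real"
  assumes k: "set_integrable lborel {0<..<b} k" and e: "e > 0"
  obtains q where "real_polynomial_function q" "(LBINT x:{0<..<b}. \<bar>k x - q x\<bar>) < e"
proof -
  define k' where "k' x = indicator {0<..<b} x * k x" for x
  have k': "integrable lborel k'" using k by (simp add: set_integrable_def k'_def[abs_def])
  define c where "c n x = max (- real n) (min (real n) (k' x))" for n x
  have cm: "c n \<in> borel_measurable borel" for n
    unfolding c_def using borel_measurable_integrable[OF k'] by simp
  have cb: "\<bar>c n x\<bar> \<le> real n" for n x by (auto simp: c_def)
  have cint: "set_integrable lborel {0<..<b} (c n)" for n
    using set_integrable_mult_bounded[of "{0<..<b}" "\<lambda>_. 1" "c n" "real n"] cm cb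
      set_integrable_continuous_Ioo[of 0 b "\<lambda>_. 1"] by auto
  have "(\<lambda>n. LBINT x:{0<..<b}. \<bar>c n x - k x\<bar>) \<longlonglongrightarrow> 0"
  proof (rule set_L1_dominated_convergence[OF set_integrable_abs[OF k] k cint])
    have "(\<lambda>n. c n x) \<longlonglongrightarrow> k x" if "x \<in> {0<..<b}" for x
    proof (rule tendsto_eventually)
      obtain n0 where n0: "\<bar>k' x\<bar> \<le> real n0" using real_arch_simple by blast
      have "c n x = k x" if "n \<ge> n0" for n
        using n0 that \<open>x \<in> {0<..<b}\<close> by (auto simp: c_def k'_def indicator_def)
      then show "\<forall>\<^sub>F n in sequentially. c n x = k x" by (rule eventually_sequentiallyI)
    qed
    then show "AE x\<in>{0<..<b} in lborel. (\<lambda>n. c n x) \<longlonglongrightarrow> k x" by simp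
    show "\<bar>c n x\<bar> \<le> \<bar>k x\<bar>" if "x \<in> {0<..<b}" for n x
      using that by (auto simp: c_def k'_def)
  qed
  then have "\<forall>\<^sub>F n in sequentially. (LBINT x:{0<..<b}. \<bar>c n x - k x\<bar>) < e / 2"
    using e by (intro order_tendstoD(2)) auto
  then obtain n where n: "(LBINT x:{0<..<b}. \<bar>c n x - k x\<bar>) < e / 2"
    by (auto simp: eventually_sequentially)
  obtain q where q: "\<And>j::nat. real_polynomial_function (q j)"
    "\<And>j x. x \<in> {0..b} \<Longrightarrow> \<bar>q j x\<bar> \<le> real n + 1"
    "AE x\<in>{0<..<b} in lborel. (\<lambda>j. q j x) \<longlonglongrightarrow> c n x"
    by (rule bounded_polynomial_approximation[OF cm[of n] cb, of b]) blast
  have qint: "set_integrable lborel {0<..<b} (q j)" for j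
    by (intro set_integrable_continuous_Ioo real_polynomial_function_continuous q)
  have "(\<lambda>j. LBINT x:{0<..<b}. \<bar>q j x - c n x\<bar>) \<longlonglongrightarrow> 0"
    by (rule set_L1_dominated_convergence[OF _ cint qint q(3), of "\<lambda>_. real n + 1"])
      (use q(2) set_integrable_continuous_Ioo[of 0 b "\<lambda>_. real n + 1"] in auto)
  then have "\<forall>\<^sub>F j in sequentially. (LBINT x:{0<..<b}. \<bar>q j x - c n x\<bar>) < e / 2"
    using e by (intro order_tendstoD(2)) auto
  then obtain j where j: "(LBINT x:{0<..<b}. \<bar>q j x - c n x\<bar>) < e / 2"
    by (auto simp: eventually_sequentially)
  have i: "set_integrable lborel {0<..<b} (\<lambda>x. \<bar>q j x - c n x\<bar>)" "set_integrable lborel {0<..<b} (\<lambda>x. \<bar>c n x - k x\<bar>)"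
    "set_integrable lborel {0<..<b} (\<lambda>x. \<bar>k x - q j x\<bar>)"
    by (intro set_integrable_abs set_integral_diff qint cint k)+
  have "(LBINT x:{0<..<b}. \<bar>k x - q j x\<bar>)
      \<le> (LBINT x:{0<..<b}. \<bar>q j x - c n x\<bar> + \<bar>c n x - k x\<bar>)"
    by (intro set_integral_mono i set_integral_add) linarith
  also have "\<dots> < e" using n j i by (subst set_integral_add) auto
  finally show ?thesis using that q(1) by blast
qed

lemma set_L1_triangle:
  fixes f g h :: "'a \<Rightarrow> real"
  assumes "set_integrable M A f" "set_integrable M A g" "set_integrable M A h"
  shows "(LINT x:A|M. \<bar>f x - h x\<bar>) \<le> (LINT x:A|M. \<bar>f x - g x\<bar>) + (LINT x:A|M. \<bar>g x - h x\<bar>)"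
proof -
  have i: "set_integrable M A (\<lambda>x. \<bar>f x - g x\<bar>)" "set_integrable M A (\<lambda>x. \<bar>g x - h x\<bar>)"
    "set_integrable M A (\<lambda>x. \<bar>f x - h x\<bar>)"
    by (intro set_integrable_abs set_integral_diff assms)+
  have "(LINT x:A|M. \<bar>f x - h x\<bar>) \<le> (LINT x:A|M. \<bar>f x - g x\<bar> + \<bar>g x - h x\<bar>)"
    by (intro set_integral_mono i set_integral_add) linarith
  also have "\<dots> = (LINT x:A|M. \<bar>f x - g x\<bar>) + (LINT x:A|M. \<bar>g x - h x\<bar>)"
    using i by simp
  finally show ?thesis .
qed

text \<open>Functions that vanish together with their derivative at both ends satisfy every
  homogeneous linear boundary condition. This is the source of the density of the domain.\<close>

lemma L1_dense_flat_ends: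
  fixes k :: "real \<Rightarrow> real"
  assumes b: "b > 0" and k: "set_integrable lborel {0<..<b} k" and e: "e > 0"
  obtains q q' q'' where
    "primitive_on b q q'" "primitive_on b q' q''" "q 0 = 0" "q b = 0" "q' 0 = 0" "q' b = 0"
    "(LBINT x:{0<..<b}. \<bar>k x - q x\<bar>) < e"
proof -
  obtain r where r: "real_polynomial_function r" "(LBINT x:{0<..<b}. \<bar>k x - r x\<bar>) < e / 2"
    using L1_polynomial_dense[OF k, of "e/2"] e by auto
  \<comment> \<open>A polynomial cutoff with values in [0, 1], zero at both ends and tending to 1 in
    the open interval. Its square is used below so that the first derivative vanishes at the ends
    too.\<close>
  define z where "z m x = 1 - (2 * x / b - 1) ^ (2 * m)" for m :: nat and x
  have zp: "real_polynomial_function (z m)" for m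
    unfolding z_def by (intro real_polynomial_function_diff real_polynomial_function_power
        real_polynomial_function_divide real_polynomial_function.intros) (simp add: bounded_linear_mult_right)
  have zb: "0 \<le> z m x" "z m x \<le> 1" if "x \<in> {0..b}" for m x
  proof -
    have "\<bar>2 * x / b - 1\<bar> \<le> 1" using that b by (auto simp: abs_le_iff field_simps)
    then have "(2 * x / b - 1)\<^sup>2 \<le> 1" by (simp only: abs_square_le_1)
    then have "((2 * x / b - 1)\<^sup>2) ^ m \<le> 1" by (rule power_le_one[OF zero_le_power2])
    moreover have "((2 * x / b - 1)\<^sup>2) ^ m \<ge> 0" by simp
    ultimately show "0 \<le> z m x" "z m x \<le> 1" unfolding z_def power_mult by linarith+
  qed
  define q where "q m x = r x * (z m x)\<^sup>2" for m x
  have qp: "real_polynomial_function (q m)" for m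
    unfolding q_def by (intro real_polynomial_function.intros(4) real_polynomial_function_power r zp)
  have int: "set_integrable lborel {0<..<b} p" if "real_polynomial_function p" for p
    by (intro set_integrable_continuous_Ioo real_polynomial_function_continuous that)
  have "(\<lambda>m. LBINT x:{0<..<b}. \<bar>q m x - r x\<bar>) \<longlonglongrightarrow> 0"
  proof (rule set_L1_dominated_convergence[OF set_integrable_abs[OF int[OF r(1)]] int[OF r(1)] int[OF qp]])
    have "(\<lambda>m. q m x) \<longlonglongrightarrow> r x" if "x \<in> {0<..<b}" for x
    proof -
      have "\<bar>2 * x / b - 1\<bar> < 1" using that b by (auto simp: abs_less_iff field_simps)
      then have "(2 * x / b - 1)\<^sup>2 < 1" by (simp only: abs_square_less_1)
      then have "(\<lambda>m. ((2 * x / b - 1)\<^sup>2) ^ m) \<longlonglongrightarrow> 0" by (rule LIMSEQ_realpow_zero[OF zero_le_power2])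
      from tendsto_diff[OF tendsto_const this] have "(\<lambda>m. z m x) \<longlonglongrightarrow> 1 - 0"
        unfolding z_def power_mult .
      then have "(\<lambda>m. q m x) \<longlonglongrightarrow> r x * (1 - 0)\<^sup>2" unfolding q_def by (intro tendsto_intros)
      then show ?thesis by simp
    qed
    then show "AE x\<in>{0<..<b} in lborel. (\<lambda>m. q m x) \<longlonglongrightarrow> r x" by simp
    show "\<bar>q m x\<bar> \<le> \<bar>r x\<bar>" if "x \<in> {0<..<b}" for m x
    proof -
      have "(z m x)\<^sup>2 \<le> 1" using zb[of x m] that by (intro power_le_one) auto
      then show ?thesis by (simp add: q_def abs_mult mult_left_le)
    qed
  qed
  then have "\<forall>\<^sub>F m in sequentially. (LBINT x:{0<..<b}. \<bar>q m x - r x\<bar>) < e / 2"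
    using e by (intro order_tendstoD(2)) auto
  then have "\<forall>\<^sub>F m in sequentially. (LBINT x:{0<..<b}. \<bar>q m x - r x\<bar>) < e / 2 \<and> m > 0"
    using eventually_gt_at_top[of 0] by eventually_elim auto
  then obtain m where m: "(LBINT x:{0<..<b}. \<bar>q m x - r x\<bar>) < e / 2" "m > 0"
    by (auto simp: eventually_sequentially)
  obtain z' r' q' q'' where z': "\<And>x. (z m has_real_derivative z' x) (at x)"
    and r': "\<And>x. (r has_real_derivative r' x) (at x)"
    and q': "real_polynomial_function q'" "\<And>x. (q m has_real_derivative q' x) (at x)"
    and q'': "real_polynomial_function q''" "\<And>x. (q' has_real_derivative q'' x) (at x)"
    using has_real_derivative_polynomial_function[OF zp[of m]] has_real_derivative_polynomial_function[OF r(1)]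
      has_real_derivative_polynomial_function[OF qp[of m]] has_real_derivative_polynomial_function by metis
  \<comment> \<open>The product rule exhibits the factor \<open>z m x\<close> in the
    derivative.\<close>
  have "(q m has_real_derivative (r' x * (z m x)\<^sup>2 + r x * (2 * z m x * z' x))) (at x)" for x
    unfolding q_def by (auto intro!: derivative_eq_intros z' r')
  then have q'_eq: "q' x = r' x * (z m x)\<^sup>2 + r x * (2 * z m x * z' x)" for x
    using DERIV_unique q'(2) by blast
  have "z m 0 = 0" "z m b = 0" using b m(2) by (auto simp: z_def power_mult)
  then have "q m 0 = 0" "q m b = 0" "q' 0 = 0" "q' b = 0" by (auto simp: q_def q'_eq)
  moreover have "primitive_on b (q m) q'" "primitive_on b q' q''"
    by (intro primitive_on_deriv q' q'' real_polynomial_function_continuous)+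
  moreover have "(LBINT x:{0<..<b}. \<bar>r x - q m x\<bar>) = (LBINT x:{0<..<b}. \<bar>q m x - r x\<bar>)"
    by (simp add: abs_minus_commute)
  then have "(LBINT x:{0<..<b}. \<bar>k x - q m x\<bar>) < e"
    using set_L1_triangle[OF k int[OF r(1)] int[OF qp], of m] r(2) m(1) by linarith
  ultimately show ?thesis using that by blast
qed

section \<open>Weak derivatives\<close>

definition weak_deriv_on :: "real \<Rightarrow> (real \<Rightarrow> real) \<Rightarrow> (real \<Rightarrow> real) \<Rightarrow> bool" where
  "weak_deriv_on b f f' \<longleftrightarrow> (\<forall>\<psi>. test_function b \<psi> \<longrightarrow>
     (LBINT x:{0<..<b}. f x * deriv \<psi> x) = - (LBINT x:{0<..<b}. f' x * \<psi> x))"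

lemma test_functionD:
  assumes "test_function b \<psi>"
  shows "(\<psi> has_real_derivative deriv \<psi> x) (at x)" "continuous_on UNIV (deriv \<psi>)" "continuous_on UNIV \<psi>"
    "\<psi> 0 = 0" "\<psi> b = 0"
proof -
  obtain D where D: "\<And>x. (\<psi> has_real_derivative D x) (at x)" "continuous_on UNIV D"
    using assms unfolding test_function_def C1_differentiable_on_def
    by (auto simp: has_real_derivative_iff_has_vector_derivative)
  then have "deriv \<psi> = D" by (auto intro: DERIV_imp_deriv)
  with D show "(\<psi> has_real_derivative deriv \<psi> x) (at x)" "continuous_on UNIV (deriv \<psi>)" by auto
  show "continuous_on UNIV \<psi>" using D(1) DERIV_continuous_on by blast
  obtain u v where "0 < u" "v < b" "\<forall>x. x \<notin> {u..v} \<longrightarrow> \<psi> x = 0"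
    using assms unfolding test_function_def by auto
  then show "\<psi> 0 = 0" "\<psi> b = 0" by auto
qed

lemma primitive_on_LINT: "primitive_on b g k \<Longrightarrow> 0 \<le> b \<Longrightarrow> (LBINT x:{0<..<b}. k x) = g b - g 0"
  using primitive_onD(2)[of b g k b] by simp

lemma primitive_on_imp_weak_deriv_on:
  assumes b: "b \<ge> 0" and g: "primitive_on b g k" and f: "set_integrable lborel {0<..<b} f"
    and fg: "AE x\<in>{0<..<b} in lborel. f x = g x"
  shows "weak_deriv_on b f k"
  unfolding weak_deriv_on_def
proof (intro allI impI)
  fix \<psi> assume "test_function b \<psi>"
  note \<psi> = test_functionD[OF this]
  have k: "set_integrable lborel {0<..<b} k" using primitive_onD(1)[OF g] .
  have gi: "set_integrable lborel {0<..<b} g"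
    by (intro set_integrable_continuous_Ioo primitive_on_continuous[OF g])
  have i: "set_integrable lborel {0<..<b} (\<lambda>x. k x * \<psi> x)" "set_integrable lborel {0<..<b} (\<lambda>x. g x * deriv \<psi> x)"
    "set_integrable lborel {0<..<b} (\<lambda>x. f x * deriv \<psi> x)"
    by (intro set_integrable_mult_continuous k f gi \<psi>)+
  have "(LBINT x:{0<..<b}. k x * \<psi> x + g x * deriv \<psi> x) = 0"
    using primitive_on_LINT[OF primitive_on_mult[OF g \<psi>(1,2)] b] \<psi>(4,5) by simp
  then have "(LBINT x:{0<..<b}. k x * \<psi> x) + (LBINT x:{0<..<b}. g x * deriv \<psi> x) = 0"
    using i by (simp add: set_integral_add(2))
  moreover have "(LBINT x:{0<..<b}. f x * deriv \<psi> x) = (LBINT x:{0<..<b}. g x * deriv \<psi> x)"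
    by (rule set_integral_AE_eq[OF i(3,2)]) (use fg in eventually_elim, auto)
  ultimately show "(LBINT x:{0<..<b}. f x * deriv \<psi> x) = - (LBINT x:{0<..<b}. k x * \<psi> x)"
    by simp
qed

text \<open>An antiderivative is constant to the left of \<open>u\<close> and to the right of
  \<open>v\<close>, and the vanishing integral makes the two constants equal; subtracting their
  common value gives compact support.\<close>

lemma test_function_antiderivative:
  fixes \<zeta> :: "real \<Rightarrow> real"
  assumes c: "continuous_on UNIV \<zeta>" and uv: "0 < u" "u < v" "v < b"
    and supp: "\<And>x. x \<notin> {u..v} \<Longrightarrow> \<zeta> x = 0" and zero: "(LBINT x:{0<..<b}. \<zeta> x) = 0"
  obtains \<psi> where "test_function b \<psi>" "deriv \<psi> = \<zeta>"
proof -
  have "\<exists>F. \<forall>x. (F has_vector_derivative \<zeta> x) (at x)"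
    using einterval_antiderivative[of "-\<infinity>" "\<infinity>" \<zeta>] c by (auto simp: continuous_on_eq_continuous_at)
  then obtain F where F: "\<And>x. (F has_real_derivative \<zeta> x) (at x)"
    by (auto simp: has_real_derivative_iff_has_vector_derivative)
  have flat: "F x = F y" if "x \<le> y" "\<And>z. x < z \<Longrightarrow> z < y \<Longrightarrow> \<zeta> z = 0" for x y
  proof -
    have "(LBINT z:{x<..<y}. \<zeta> z) = (LBINT z:{x<..<y}. 0)"
      using that by (intro set_lebesgue_integral_cong) auto
    then show ?thesis using LINT_deriv[OF F c that(1)] by simp
  qed
  have left: "F x = F u" if "x \<le> u" for x by (rule flat) (use that supp in auto)
  have right: "F x = F v" if "v \<le> x" for x using flat[of v x] that supp by force
  have "F b = F 0" using LINT_deriv[OF F c, of 0 b] zero uv by simp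
  then have vu: "F v = F u" using left[of 0] right[of b] uv by simp
  define \<psi> where "\<psi> x = F x - F u" for x
  have D: "(\<psi> has_real_derivative \<zeta> x) (at x)" for x
    unfolding \<psi>_def using F by (auto intro!: derivative_eq_intros)
  have "\<psi> x = 0" if "x \<notin> {u..v}" for x
    using that left[of x] right[of x] vu by (auto simp: \<psi>_def)
  moreover have "\<psi> C1_differentiable_on UNIV"
    unfolding C1_differentiable_on_def using D c by (auto simp: has_real_derivative_iff_has_vector_derivative)
  ultimately have "test_function b \<psi>" unfolding test_function_def using uv by blast
  moreover have "deriv \<psi> = \<zeta>" using D by (auto intro: DERIV_imp_deriv)
  ultimately show ?thesis using that by blast
qed

text \<open>The lemma of du Bois-Reymond. The test functions are antiderivatives of \<open>q \<rho>\<^sub>n - c \<rho>\<^sub>m\<close> with \<open>q\<close> a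
  polynomial and \<open>\<rho>\<^sub>n\<close> trapezoids increasing to \<open>1\<close>, the constant \<open>c\<close> making the integral vanish.\<close>

lemma weak_deriv_on_zero_imp_const:
  assumes b: "b > 0" and w: "set_integrable lborel {0<..<b} w"
    and zero: "weak_deriv_on b w (\<lambda>_. 0)"
  obtains c where "AE x\<in>{0<..<b} in lborel. w x = c"
proof -
  define \<rho> where "\<rho> n x = max 0 (min 1 (real n * min x (b - x) - 1))" for n :: nat and x
  have \<rho>c: "continuous_on S (\<rho> n)" for n S unfolding \<rho>_def by (intro continuous_intros)
  have \<rho>b: "0 \<le> \<rho> n x" "\<rho> n x \<le> 1" for n x by (auto simp: \<rho>_def)
  have \<rho>i: "set_integrable lborel {0<..<b} (\<rho> n)" for n by (intro set_integrable_continuous_Ioo \<rho>c)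
  have \<rho>lim: "(\<lambda>n. \<rho> n x) \<longlonglongrightarrow> 1" if "x \<in> {0<..<b}" for x
  proof (rule tendsto_eventually)
    have m: "min x (b - x) > 0" using that by auto
    obtain n0 :: nat where n0: "2 / min x (b - x) \<le> real n0" using real_arch_simple by blast
    have "\<rho> n x = 1" if "n \<ge> n0" for n
    proof -
      have "2 / min x (b - x) \<le> real n" using n0 that by (meson of_nat_mono order_trans)
      then have "2 \<le> real n * min x (b - x)" using m by (simp only: divide_le_eq) 
      then show ?thesis by (simp add: \<rho>_def)
    qed
    then show "\<forall>\<^sub>F n in sequentially. \<rho> n x = 1" by (rule eventually_sequentiallyI)
  qed
  have supp: "\<rho> n x = 0" if "x \<notin> {1 / real m .. b - 1 / real m}" "n \<le> m" "m > 0" for n m x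
  proof -
    have "min x (b - x) \<le> 1 / real m" using that(1) by auto
    then have "real m * min x (b - x) \<le> 1" using that(3) by (simp add: field_simps)
    moreover have "real n * min x (b - x) \<le> max 0 (real m * min x (b - x))"
    proof (cases "min x (b - x) \<ge> 0")
      case True
      then show ?thesis using that(2) by (intro max.coboundedI2 mult_right_mono) auto
    next
      case False
      then have "real n * min x (b - x) \<le> 0" by (intro mult_nonneg_nonpos) auto
      then show ?thesis by simp
    qed
    ultimately have "real n * min x (b - x) \<le> 1" by linarith
    then show ?thesis unfolding \<rho>_def by linarith
  qed
  have lim: "(\<lambda>n. LBINT x:{0<..<b}. k x * \<rho> n x) \<longlonglongrightarrow> (LBINT x:{0<..<b}. k x)"
    if k: "set_integrable lborel {0<..<b} k" for k
  proof (rule set_LINT_L1_limit[OF k])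
    show i: "set_integrable lborel {0<..<b} (\<lambda>x. k x * \<rho> n x)" for n
      by (intro set_integrable_mult_continuous k \<rho>c)
    show "(\<lambda>n. LBINT x:{0<..<b}. \<bar>k x * \<rho> n x - k x\<bar>) \<longlonglongrightarrow> 0"
    proof (rule set_L1_dominated_convergence[OF set_integrable_abs[OF k] k i])
      have "(\<lambda>n. k x * \<rho> n x) \<longlonglongrightarrow> k x * 1" if "x \<in> {0<..<b}" for x
        by (intro tendsto_intros \<rho>lim that)
      then show "AE x\<in>{0<..<b} in lborel. (\<lambda>n. k x * \<rho> n x) \<longlonglongrightarrow> k x" by simp
      show "\<bar>k x * \<rho> n x\<bar> \<le> \<bar>k x\<bar>" for n x
        using \<rho>b[of n x] by (simp add: abs_mult mult_left_le)
    qed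
  qed
  have one: "set_integrable lborel {0<..<b} (\<lambda>_. 1::real)"
    by (rule set_integrable_continuous_Ioo) (rule continuous_on_const)
  have "(LBINT x:{0<..<b}. 1::real) = b" using b by (simp add: set_integral_const)
  then have "\<forall>\<^sub>F n in sequentially. (LBINT x:{0<..<b}. \<rho> n x) > 0"
    using order_tendstoD(1)[OF lim[OF one], of 0] b by simp
  moreover obtain n1 :: nat where n1: "2 / b < real n1" using reals_Archimedean2 by blast
  ultimately obtain m where I0: "(LBINT x:{0<..<b}. \<rho> m x) > 0" and m: "m \<ge> n1"
    unfolding eventually_sequentially by (metis linear)
  define I where "I = (LBINT x:{0<..<b}. \<rho> m x)"
  have I: "I > 0" using I0 by (simp add: I_def)
  \<comment> \<open>The only possible value: if \<open>w\<close> equals a constant almost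
    everywhere, its integral against \<open>\<rho> m\<close> is that constant times
    \<open>I\<close>.\<close>
  define c where "c = (LBINT x:{0<..<b}. w x * \<rho> m x) / I"
  have "(LBINT x:{0<..<b}. (w x - c) * q x) = 0" if q: "real_polynomial_function q" for q
  proof -
    have qc: "continuous_on S q" for S using real_polynomial_function_continuous[OF q] .
    have qi: "set_integrable lborel {0<..<b} q" by (intro set_integrable_continuous_Ioo qc)
    have wq: "set_integrable lborel {0<..<b} (\<lambda>x. w x * q x)" by (intro set_integrable_mult_continuous w qc)
    have "(LBINT x:{0<..<b}. (w x * q x) * \<rho> n x) = c * (LBINT x:{0<..<b}. q x * \<rho> n x)" for n
    proof -
      define Q where "Q = (LBINT x:{0<..<b}. q x * \<rho> n x)"
      define \<zeta> where "\<zeta> x = q x * \<rho> n x - (Q / I) * \<rho> m x" for x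
      \<comment> \<open>One interval contains the supports of both trapezoids. It is nondegenerate
        because \<open>m \<ge> n1\<close> forces \<open>2 / b < N\<close>.\<close>
      define N where "N = max n m"
      have N: "n \<le> N" "m \<le> N" "2 / b < real N" using m n1 by (auto simp: N_def)
      then have N0: "real N > 0" using b by (meson divide_pos_pos less_trans zero_less_numeral)
      have uv: "0 < 1 / real N" "1 / real N < b - 1 / real N" "b - 1 / real N < b"
        using N(3) N0 b by (auto simp: field_simps)
      have i: "set_integrable lborel {0<..<b} (\<lambda>x. q x * \<rho> n x)" "set_integrable lborel {0<..<b} (\<lambda>x. (w x * q x) * \<rho> n x)"
        "set_integrable lborel {0<..<b} (\<lambda>x. w x * \<rho> m x)"
        by (intro set_integrable_mult_continuous qi wq w \<rho>c)+
      have "(LBINT x:{0<..<b}. \<zeta> x) = Q - (Q / I) * I"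
        unfolding \<zeta>_def using i \<rho>i by (subst set_integral_diff(2)) (auto simp: Q_def I_def)
      then have "(LBINT x:{0<..<b}. \<zeta> x) = 0" using I by simp
      moreover have "continuous_on UNIV \<zeta>" unfolding \<zeta>_def by (intro continuous_intros qc \<rho>c)
      moreover have "\<zeta> x = 0" if "x \<notin> {1 / real N .. b - 1 / real N}" for x
        using supp[OF that N(1)] supp[OF that N(2)] N0 by (simp add: \<zeta>_def)
      ultimately obtain \<psi> where "test_function b \<psi>" "deriv \<psi> = \<zeta>"
        using test_function_antiderivative[of \<zeta>] uv by blast
      then have "(LBINT x:{0<..<b}. w x * \<zeta> x) = 0" using zero by (auto simp: weak_deriv_on_def)
      moreover have "w x * \<zeta> x = (w x * q x) * \<rho> n x - (Q / I) * (w x * \<rho> m x)" for x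
        by (simp add: \<zeta>_def algebra_simps)
      ultimately have "(LBINT x:{0<..<b}. (w x * q x) * \<rho> n x) - (Q / I) * (LBINT x:{0<..<b}. w x * \<rho> m x) = 0"
        using i by (simp add: set_integral_diff(2))
      then show ?thesis using I by (simp add: c_def Q_def)
    qed
    then have "(\<lambda>n. c * (LBINT x:{0<..<b}. q x * \<rho> n x)) \<longlonglongrightarrow> (LBINT x:{0<..<b}. w x * q x)"
      using lim[OF wq] by simp
    moreover have "(\<lambda>n. c * (LBINT x:{0<..<b}. q x * \<rho> n x)) \<longlonglongrightarrow> c * (LBINT x:{0<..<b}. q x)"
      by (intro tendsto_intros lim qi)
    ultimately have "(LBINT x:{0<..<b}. w x * q x) = c * (LBINT x:{0<..<b}. q x)"
      using LIMSEQ_unique by blast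
    then show ?thesis using wq qi by (simp add: left_diff_distrib set_integral_diff(2))
  qed
  then have "AE x\<in>{0<..<b} in lborel. w x - c = 0"
    by (intro orthogonal_to_polynomials_imp_zero set_integral_diff(1) w set_integrable_continuous_Ioo continuous_intros)
  then show ?thesis using that[of c] by simp
qed

text \<open>The integral of \<open>k\<close> from 0 has weak derivative \<open>k\<close>, so it
  differs from \<open>f\<close> by a constant almost everywhere, and this constant is absorbed into
  \<open>g\<close>.\<close>

lemma weak_deriv_on_imp_primitive_on:
  assumes b: "b > 0" and f: "set_integrable lborel {0<..<b} f" and k: "set_integrable lborel {0<..<b} k"
    and weak: "weak_deriv_on b f k"
  obtains g where "primitive_on b g k" "AE x\<in>{0<..<b} in lborel. f x = g x"
proof -
  define g where "g x = (LBINT y:{0<..<x}. k y)" for x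
  have "g 0 = 0" by (simp add: g_def set_lebesgue_integral_def)
  then have g: "primitive_on b g k" using k by (simp add: primitive_on_def g_def)
  have gi: "set_integrable lborel {0<..<b} g"
    by (intro set_integrable_continuous_Ioo primitive_on_continuous[OF g])
  have gw: "weak_deriv_on b g k" using primitive_on_imp_weak_deriv_on[OF _ g gi] b by simp
  have fg: "set_integrable lborel {0<..<b} (\<lambda>x. f x - g x)" by (intro set_integral_diff f gi)
  have "weak_deriv_on b (\<lambda>x. f x - g x) (\<lambda>_. 0)"
    unfolding weak_deriv_on_def
  proof (intro allI impI)
    fix \<psi> assume \<psi>: "test_function b \<psi>"
    note \<psi>' = test_functionD[OF \<psi>]
    have i: "set_integrable lborel {0<..<b} (\<lambda>x. f x * deriv \<psi> x)" "set_integrable lborel {0<..<b} (\<lambda>x. g x * deriv \<psi> x)"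
      by (intro set_integrable_mult_continuous f gi \<psi>')+
    have "(LBINT x:{0<..<b}. f x * deriv \<psi> x) = (LBINT x:{0<..<b}. g x * deriv \<psi> x)"
      using weak gw \<psi> by (simp add: weak_deriv_on_def)
    then show "(LBINT x:{0<..<b}. (f x - g x) * deriv \<psi> x) = - (LBINT x:{0<..<b}. 0 * \<psi> x)"
      using i by (simp add: left_diff_distrib set_integral_diff(2))
  qed
  from weak_deriv_on_zero_imp_const[OF b fg this] obtain c where c: "AE x\<in>{0<..<b} in lborel. f x - g x = c" .
  have "primitive_on b (\<lambda>_. c) (\<lambda>_. 0)" by (intro primitive_on_deriv) auto
  from primitive_on_linear[OF g this, of 1 1] have "primitive_on b (\<lambda>x. g x + c) k" by simp
  moreover have "AE x\<in>{0<..<b} in lborel. f x = g x + c" using c by eventually_elim auto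
  ultimately show ?thesis using that by blast
qed

text \<open>A nonnegative continuous function with integral zero vanishes on the closed interval.
  Reaching the endpoints is what gives meaning to boundary values of classes.\<close>

lemma continuous_AE_eq_imp_eq:
  fixes f g :: "real \<Rightarrow> real"
  assumes b: "b > 0" and f: "continuous_on {0..b} f" and g: "continuous_on {0..b} g"
    and eq: "AE x\<in>{0<..<b} in lborel. f x = g x" and x: "x \<in> {0..b}"
  shows "f x = g x"
proof -
  have "continuous_on {0..b} (\<lambda>x. \<bar>f x - g x\<bar>)" by (intro continuous_intros f g)
  moreover have "((\<lambda>x. \<bar>f x - g x\<bar>) has_integral 0) {0..b}"
  proof -
    have c: "continuous_on {0..b} (\<lambda>x. \<bar>f x - g x\<bar>)" by (intro continuous_intros f g)
    have i: "set_integrable lborel {0<..<b} (\<lambda>x. \<bar>f x - g x\<bar>)" by (intro set_integrable_continuous_Ioo c)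
    have "(LBINT x:{0<..<b}. \<bar>f x - g x\<bar>) = (LBINT x:{0<..<b}. 0)"
      by (rule set_integral_AE_eq[OF i]) (use eq in \<open>auto simp: set_integrable_def\<close>)
    then have "integral {0..b} (\<lambda>x. \<bar>f x - g x\<bar>) = 0"
      using set_borel_integral_eq_integral(2)[OF i] by (simp add: integral_open_interval_real)
    then show ?thesis using integrable_continuous_real[OF c] by (metis has_integral_integral)
  qed
  ultimately have "\<bar>f x - g x\<bar> = 0"
    using has_integral_0_cbox_imp_0[of 0 b "\<lambda>x. \<bar>f x - g x\<bar>" x] x b by auto
  then show ?thesis by simp
qed

text \<open>The zero function is a primitive of \<open>k - k'\<close>; by the product rule
  \<open>k - k'\<close> is orthogonal to every polynomial.\<close>

lemma primitive_on_unique: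
  assumes b: "b > 0" and "primitive_on b g k" "primitive_on b g k'"
  shows "AE x\<in>{0<..<b} in lborel. k x = k' x"
proof -
  have P: "primitive_on b (\<lambda>_. 0) (\<lambda>x. k x - k' x)"
    using primitive_on_linear[OF assms(2,3), of 1 "-1"] by simp
  have "(LBINT x:{0<..<b}. (k x - k' x) * q x) = 0" if q: "real_polynomial_function q" for q
  proof -
    obtain q' where q': "real_polynomial_function q'" "\<And>x. (q has_real_derivative q' x) (at x)"
      using q has_real_derivative_polynomial_function by metis
    show ?thesis
      using primitive_on_LINT[OF primitive_on_mult[OF P q'(2) real_polynomial_function_continuous[OF q'(1)]]] b
      by simp
  qed
  then have "AE x\<in>{0<..<b} in lborel. k x - k' x = 0"
    using primitive_onD(1)[OF P] by (intro orthogonal_to_polynomials_imp_zero)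
  then show ?thesis by simp
qed

section \<open>The resolvent equation on an edge\<close>

text \<open>Sum the rows over the set where \<open>w\<close> is negative. Columns in this set keep a
  positive sum, since only nonpositive entries are dropped, and each is multiplied by a negative
  number; the other columns contribute at most zero. A nonempty set would make the total
  negative.\<close>

lemma M_matrix_nonneg:
  fixes M :: "'k::finite \<Rightarrow> 'k \<Rightarrow> real"
  assumes off: "\<And>m n. m \<noteq> n \<Longrightarrow> M m n \<le> 0" and col: "\<And>n. (\<Sum>m\<in>UNIV. M m n) > 0"
    and Mw: "\<And>m. (\<Sum>n\<in>UNIV. M m n * w n) \<ge> 0"
  shows "w m \<ge> 0"
proof (rule ccontr)
  assume "\<not> w m \<ge> 0"
  define I where "I = {m. w m < 0}"
  have m: "m \<in> I" using \<open>\<not> w m \<ge> 0\<close> by (simp add: I_def)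
  have colI: "(\<Sum>m\<in>I. M m n) > 0" if "n \<in> I" for n
  proof -
    have "(\<Sum>m\<in>UNIV. M m n) = (\<Sum>m\<in>I. M m n) + (\<Sum>m\<in>-I. M m n)"
      by (subst sum.union_disjoint[symmetric]) (auto intro: sum.cong)
    moreover have "(\<Sum>m\<in>-I. M m n) \<le> 0" using that by (intro sum_nonpos off) auto
    ultimately show ?thesis using col[of n] by linarith
  qed
  have "0 \<le> (\<Sum>m\<in>I. \<Sum>n\<in>UNIV. M m n * w n)" by (intro sum_nonneg Mw)
  also have "\<dots> = (\<Sum>n\<in>UNIV. w n * (\<Sum>m\<in>I. M m n))"
    by (subst sum.swap) (simp add: sum_distrib_left mult.commute)
  also have "\<dots> = (\<Sum>n\<in>I. w n * (\<Sum>m\<in>I. M m n)) + (\<Sum>n\<in>-I. w n * (\<Sum>m\<in>I. M m n))"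
    by (subst sum.union_disjoint[symmetric]) (auto intro: sum.cong)
  also have "(\<Sum>n\<in>-I. w n * (\<Sum>m\<in>I. M m n)) \<le> 0"
    by (intro sum_nonpos mult_nonneg_nonpos off) (auto simp: I_def)
  also have "(\<Sum>n\<in>I. w n * (\<Sum>m\<in>I. M m n)) < (\<Sum>n\<in>I. 0)"
    using m colI by (intro sum_strict_mono mult_neg_pos) (auto simp: I_def)
  finally show False by simp
qed

text \<open>Positivity applied to a kernel vector and to its negative gives injectivity, hence
  surjectivity in finite dimension.\<close>

lemma M_matrix_solvable:
  fixes M :: "'k::finite \<Rightarrow> 'k \<Rightarrow> real"
  assumes off: "\<And>m n. m \<noteq> n \<Longrightarrow> M m n \<le> 0" and col: "\<And>n. (\<Sum>m\<in>UNIV. M m n) > 0"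
  obtains w where "\<And>m. (\<Sum>n\<in>UNIV. M m n * w n) = s m"
proof -
  define L where "L = (\<lambda>w :: real^'k. (\<chi> m. \<Sum>n\<in>UNIV. M m n * w $ n) :: real^'k)"
  have lin: "linear L"
    by (rule linearI) (auto simp: L_def vec_eq_iff algebra_simps sum.distrib sum_distrib_left)
  have "w = 0" if "L w = 0" for w
  proof -
    have "(\<Sum>n\<in>UNIV. M m n * w $ n) = 0" for m using that by (auto simp: L_def vec_eq_iff)
    then have "w $ m \<ge> 0" "- (w $ m) \<ge> 0" for m
      using M_matrix_nonneg[where M = M and w = "\<lambda>n. w $ n", OF off col]
        M_matrix_nonneg[where M = M and w = "\<lambda>n. - (w $ n)", OF off col] by (auto simp: sum_negf)
    then have "w $ m = 0" for m by (metis antisym neg_0_le_iff_le)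
    then show ?thesis by (simp add: vec_eq_iff)
  qed
  then have "inj L" using linear_injective_0[OF lin] by blast
  then have "surj L" using linear_injective_imp_surjective[OF lin] by simp
  then obtain w where w: "L w = (\<chi> m. s m)" unfolding surj_def by metis
  have "(\<Sum>n\<in>UNIV. M m n * w $ n) = s m" for m
  proof -
    have "L w $ m = s m" unfolding w by simp
    then show ?thesis by (simp add: L_def)
  qed
  then show ?thesis using that by blast
qed

lemma choice3:
  assumes "\<And>i. \<exists>x y z. P i x y z"
  obtains f g h where "\<And>i. P i (f i) (g i) (h i)"
  using assms by metis

lemma set_LINT_mono_Ioo:
  fixes k :: "real \<Rightarrow> real"
  assumes "set_integrable lborel {0<..<b} k" "AE x\<in>{0<..<b} in lborel. k x \<ge> 0" "x \<le> b"
  shows "0 \<le> (LBINT y:{0<..<x}. k y)" "(LBINT y:{0<..<x}. k y) \<le> (LBINT y:{0<..<b}. k y)"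
proof -
  show "0 \<le> (LBINT y:{0<..<x}. k y)"
    unfolding set_lebesgue_integral_def
  proof (rule integral_nonneg_AE)
    show "AE y in lborel. 0 \<le> indicat_real {0<..<x} y *\<^sub>R k y"
      using assms(2) by eventually_elim (use assms(3) in \<open>auto simp: indicator_def\<close>)
  qed
  show "(LBINT y:{0<..<x}. k y) \<le> (LBINT y:{0<..<b}. k y)"
    unfolding set_lebesgue_integral_def
  proof (rule integral_mono_AE)
    show "integrable lborel (\<lambda>y. indicat_real {0<..<x} y *\<^sub>R k y)" "integrable lborel (\<lambda>y. indicat_real {0<..<b} y *\<^sub>R k y)"
      using assms(1) set_integrable_Ioo_mono[OF assms(1,3)] by (auto simp: set_integrable_def)
    show "AE y in lborel. indicat_real {0<..<x} y *\<^sub>R k y \<le> indicat_real {0<..<b} y *\<^sub>R k y"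
      using assms(2) by eventually_elim (use assms(3) in \<open>auto simp: indicator_def\<close>)
  qed
qed

section \<open>Hyperbolic solution formula on one edge\<close>

context
  fixes b \<omega> :: real and f :: "real \<Rightarrow> real"
  assumes b: "b > 0" and \<omega>: "\<omega> > 0" and f: "set_integrable lborel {0<..<b} f"
begin

definition left_moment where "left_moment x = (LBINT y:{0<..<x}. f y * sinh (\<omega> * y))"

text \<open>This is the integral over (x, b). It is written with base point 0 so that it fits the
  form of \<open>primitive_on\<close>.\<close>

definition right_moment where
  "right_moment x = (LBINT y:{0<..<b}. f y * sinh (\<omega> * (b - y))) - (LBINT y:{0<..<x}. f y * sinh (\<omega> * (b - y)))"

lemma hyperbolic_derivs:
  "((\<lambda>x. sinh (\<omega> * x)) has_real_derivative \<omega> * cosh (\<omega> * x)) (at x)"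
  "((\<lambda>x. cosh (\<omega> * x)) has_real_derivative \<omega> * sinh (\<omega> * x)) (at x)"
  "((\<lambda>x. sinh (\<omega> * (b - x))) has_real_derivative - \<omega> * cosh (\<omega> * (b - x))) (at x)"
  "((\<lambda>x. cosh (\<omega> * (b - x))) has_real_derivative - \<omega> * sinh (\<omega> * (b - x))) (at x)"
  by (auto intro!: derivative_eq_intros)

lemma hyperbolic_continuous:
  "continuous_on UNIV (\<lambda>x. \<omega> * cosh (\<omega> * x))" "continuous_on UNIV (\<lambda>x. \<omega> * sinh (\<omega> * x))"
  "continuous_on UNIV (\<lambda>x. - \<omega> * cosh (\<omega> * (b - x)))" "continuous_on UNIV (\<lambda>x. - \<omega> * sinh (\<omega> * (b - x)))"
  "continuous_on UNIV (\<lambda>x. sinh (\<omega> * x))" "continuous_on UNIV (\<lambda>x. sinh (\<omega> * (b - x)))"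
  by (intro continuous_intros)+

lemma moment_integrable:
  "set_integrable lborel {0<..<b} (\<lambda>y. f y * sinh (\<omega> * y))"
  "set_integrable lborel {0<..<b} (\<lambda>y. f y * sinh (\<omega> * (b - y)))"
  by (intro set_integrable_mult_continuous f hyperbolic_continuous)+

lemma sinh_b: "sinh (\<omega> * b) > 0"
  using b \<omega> by simp

lemma moment_0: "left_moment 0 = 0" "right_moment b = 0"
  by (simp_all add: left_moment_def right_moment_def set_lebesgue_integral_def)

text \<open>Up to the factor \<omega> this is the Wronskian of the solutions
  \<open>sinh (\<omega> x)\<close> and \<open>sinh (\<omega> (b - x))\<close>.\<close>

lemma sinh_split: "cosh (\<omega> * x) * sinh (\<omega> * (b - x)) + cosh (\<omega> * (b - x)) * sinh (\<omega> * x) = sinh (\<omega> * b)"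
  using sinh_add[of "\<omega> * x" "\<omega> * (b - x)"] by (simp add: algebra_simps)

text \<open>The multipliers \<open>sinh (\<omega> x)\<close> and \<open>sinh (\<omega> (b - x))\<close> solve the homogeneous equation.\<close>

lemma edge_first_integrals:
  assumes g: "primitive_on b g g1" and g1: "primitive_on b g1 g2"
    and eq: "AE x\<in>{0<..<b} in lborel. g2 x = \<omega>\<^sup>2 * (g x - f x)" and x: "x \<in> {0..b}"
  shows "g1 x * sinh (\<omega> * x) - \<omega> * g x * cosh (\<omega> * x) = - \<omega> * g 0 - \<omega>\<^sup>2 * left_moment x"
    and "g1 x * sinh (\<omega> * (b - x)) + \<omega> * g x * cosh (\<omega> * (b - x)) = \<omega> * g b + \<omega>\<^sup>2 * right_moment x"
proof -
  have xb: "0 \<le> x" "x \<le> b" using x by auto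
  note L = moment_integrable
  have Lx: "set_integrable lborel {0<..<x} (\<lambda>y. f y * sinh (\<omega> * y))" "set_integrable lborel {0<..<x} (\<lambda>y. f y * sinh (\<omega> * (b - y)))"
    using L[THEN set_integrable_Ioo_mono] xb by auto
  define v where "v x = g1 x * sinh (\<omega> * x) - \<omega> * g x * cosh (\<omega> * x)" for x
  have "primitive_on b v (\<lambda>x. - \<omega>\<^sup>2 * (f x * sinh (\<omega> * x)))"
  proof (rule primitive_on_cong[OF primitive_on_linear[OF
        primitive_on_mult[OF g1 hyperbolic_derivs(1) hyperbolic_continuous(1)]
        primitive_on_mult[OF g hyperbolic_derivs(2) hyperbolic_continuous(2)], of 1 "- \<omega>"]])
    show "AE x\<in>{0<..<b} in lborel. - \<omega>\<^sup>2 * (f x * sinh (\<omega> * x))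
        = 1 * (g2 x * sinh (\<omega> * x) + g1 x * (\<omega> * cosh (\<omega> * x)))
          + - \<omega> * (g1 x * cosh (\<omega> * x) + g x * (\<omega> * sinh (\<omega> * x)))"
      (is "AE x\<in>_ in _. ?lhs x = ?rhs x")
      using eq
    proof (eventually_elim, intro impI)
      fix x assume "x \<in> {0<..<b} \<longrightarrow> g2 x = \<omega>\<^sup>2 * (g x - f x)" "x \<in> {0<..<b}"
      then have e: "g2 x = \<omega>\<^sup>2 * (g x - f x)" by blast
      show "?lhs x = ?rhs x" unfolding e by (simp add: algebra_simps power2_eq_square)
    qed
  qed (simp add: v_def, intro set_integrable_mult_right L)
  from primitive_onD(2)[OF this xb] have "v x = v 0 + (LBINT y:{0<..<x}. - \<omega>\<^sup>2 * (f y * sinh (\<omega> * y)))" .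
  then show "g1 x * sinh (\<omega> * x) - \<omega> * g x * cosh (\<omega> * x) = - \<omega> * g 0 - \<omega>\<^sup>2 * left_moment x"
    unfolding set_integral_mult_right v_def left_moment_def[symmetric] by simp
  define z where "z x = g1 x * sinh (\<omega> * (b - x)) + \<omega> * g x * cosh (\<omega> * (b - x))" for x
  have "primitive_on b z (\<lambda>x. - \<omega>\<^sup>2 * (f x * sinh (\<omega> * (b - x))))"
  proof (rule primitive_on_cong[OF primitive_on_linear[OF
        primitive_on_mult[OF g1 hyperbolic_derivs(3) hyperbolic_continuous(3)]
        primitive_on_mult[OF g hyperbolic_derivs(4) hyperbolic_continuous(4)], of 1 "\<omega>"]])
    show "AE x\<in>{0<..<b} in lborel. - \<omega>\<^sup>2 * (f x * sinh (\<omega> * (b - x)))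
        = 1 * (g2 x * sinh (\<omega> * (b - x)) + g1 x * (- \<omega> * cosh (\<omega> * (b - x))))
          + \<omega> * (g1 x * cosh (\<omega> * (b - x)) + g x * (- \<omega> * sinh (\<omega> * (b - x))))"
      (is "AE x\<in>_ in _. ?lhs x = ?rhs x")
      using eq
    proof (eventually_elim, intro impI)
      fix x assume "x \<in> {0<..<b} \<longrightarrow> g2 x = \<omega>\<^sup>2 * (g x - f x)" "x \<in> {0<..<b}"
      then have e: "g2 x = \<omega>\<^sup>2 * (g x - f x)" by blast
      show "?lhs x = ?rhs x" unfolding e by (simp add: algebra_simps power2_eq_square)
    qed
  qed (simp add: z_def, intro set_integrable_mult_right L)
  from primitive_onD(2)[OF this xb] primitive_onD(2)[OF this less_imp_le[OF b] order_refl]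
  have "z x = z 0 + (LBINT y:{0<..<x}. - \<omega>\<^sup>2 * (f y * sinh (\<omega> * (b - y))))"
    "z b = z 0 + (LBINT y:{0<..<b}. - \<omega>\<^sup>2 * (f y * sinh (\<omega> * (b - y))))" .
  then have "z x = z b + \<omega>\<^sup>2 * right_moment x"
    unfolding set_integral_mult_right by (simp add: right_moment_def algebra_simps)
  moreover have "z b = \<omega> * g b" by (simp add: z_def)
  ultimately show "g1 x * sinh (\<omega> * (b - x)) + \<omega> * g x * cosh (\<omega> * (b - x)) = \<omega> * g b + \<omega>\<^sup>2 * right_moment x"
    by (simp add: z_def)
qed

text \<open>Eliminating \<open>g1\<close> between the two first integrals gives the solution in
  terms of its endpoint values, with nonnegative kernels. At each end one first integral alone gives
  the derivative: the last two formulas are the Dirichlet-to-Neumann map of the edge.\<close>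

lemma edge_representation:
  assumes g: "primitive_on b g g1" and g1: "primitive_on b g1 g2"
    and eq: "AE x\<in>{0<..<b} in lborel. g2 x = \<omega>\<^sup>2 * (g x - f x)"
  shows "x \<in> {0..b} \<Longrightarrow> g x * sinh (\<omega> * b)
      = sinh (\<omega> * (b - x)) * (g 0 + \<omega> * left_moment x) + sinh (\<omega> * x) * (g b + \<omega> * right_moment x)"
    and "g1 0 * sinh (\<omega> * b) = \<omega> * g b + \<omega>\<^sup>2 * right_moment 0 - \<omega> * g 0 * cosh (\<omega> * b)"
    and "- g1 b * sinh (\<omega> * b) = \<omega> * g 0 + \<omega>\<^sup>2 * left_moment b - \<omega> * g b * cosh (\<omega> * b)"
proof -
  note FI = edge_first_integrals[OF assms]
  show "g1 0 * sinh (\<omega> * b) = \<omega> * g b + \<omega>\<^sup>2 * right_moment 0 - \<omega> * g 0 * cosh (\<omega> * b)"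
    using FI(2)[of 0] b by simp
  show "- g1 b * sinh (\<omega> * b) = \<omega> * g 0 + \<omega>\<^sup>2 * left_moment b - \<omega> * g b * cosh (\<omega> * b)"
    using FI(1)[of b] b by simp
  assume x: "x \<in> {0..b}"
  let ?S = "sinh (\<omega> * (b - x))" and ?s = "sinh (\<omega> * x)"
  have "\<omega> * (g x * sinh (\<omega> * b))
      = (g1 x * ?S + \<omega> * g x * cosh (\<omega> * (b - x))) * ?s - (g1 x * ?s - \<omega> * g x * cosh (\<omega> * x)) * ?S"
    unfolding sinh_split[of x, symmetric] by (simp add: algebra_simps)
  also have "\<dots> = (\<omega> * g b + \<omega>\<^sup>2 * right_moment x) * ?s - (- \<omega> * g 0 - \<omega>\<^sup>2 * left_moment x) * ?S"
    unfolding FI[OF x] ..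
  also have "\<dots> = \<omega> * (?S * (g 0 + \<omega> * left_moment x) + ?s * (g b + \<omega> * right_moment x))"
    by (simp add: algebra_simps power2_eq_square)
  finally show "g x * sinh (\<omega> * b) = ?S * (g 0 + \<omega> * left_moment x) + ?s * (g b + \<omega> * right_moment x)"
    using \<omega> by simp
qed

lemma moments_nonneg:
  assumes "AE x\<in>{0<..<b} in lborel. f x \<ge> 0" "x \<in> {0..b}"
  shows "left_moment x \<ge> 0" "right_moment x \<ge> 0"
proof -
  have 1: "AE x\<in>{0<..<b} in lborel. f x * sinh (\<omega> * x) \<ge> 0"
    using assms(1) by eventually_elim (use \<omega> in \<open>auto intro!: mult_nonneg_nonneg\<close>)
  have 2: "AE x\<in>{0<..<b} in lborel. f x * sinh (\<omega> * (b - x)) \<ge> 0"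
    using assms(1) by eventually_elim (use \<omega> in \<open>auto intro!: mult_nonneg_nonneg\<close>)
  show "left_moment x \<ge> 0" "right_moment x \<ge> 0"
    using set_LINT_mono_Ioo(1)[OF moment_integrable(1) 1, of x] set_LINT_mono_Ioo(2)[OF moment_integrable(2) 2, of x] assms(2)
    by (auto simp: left_moment_def right_moment_def)
qed

lemma edge_nonneg:
  assumes g: "primitive_on b g g1" and g1: "primitive_on b g1 g2"
    and eq: "AE x\<in>{0<..<b} in lborel. g2 x = \<omega>\<^sup>2 * (g x - f x)"
    and nonneg: "AE x\<in>{0<..<b} in lborel. f x \<ge> 0" "g 0 \<ge> 0" "g b \<ge> 0" and x: "x \<in> {0..b}"
  shows "g x \<ge> 0"
proof -
  have "g x * sinh (\<omega> * b) \<ge> 0"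
    unfolding edge_representation(1)[OF g g1 eq x]
    using moments_nonneg[OF nonneg(1) x] nonneg(2,3) \<omega> x
    by (intro add_nonneg_nonneg mult_nonneg_nonneg) auto
  then show ?thesis using sinh_b by (simp add: zero_le_mult_iff)
qed

text \<open>Variation of constants for the basis \<open>sinh (\<omega> (b - x))\<close>,
  \<open>sinh (\<omega> x)\<close>. The coefficients \<open>P\<close> and \<open>Q\<close> are such
  that the terms with their derivatives cancel in the first derivative of \<open>g\<close>.\<close>

lemma edge_solution:
  obtains g g1 g2 where "primitive_on b g g1" "primitive_on b g1 g2"
    "AE x\<in>{0<..<b} in lborel. g2 x = \<omega>\<^sup>2 * (g x - f x)" "g 0 = \<alpha>" "g b = \<beta>"
proof -
  note L = moment_integrable
  define P where "P x = \<alpha> + \<omega> * left_moment x" for x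
  define Q where "Q x = \<beta> + \<omega> * right_moment x" for x
  let ?sh = "sinh (\<omega> * b)"
  define g where "g x = (1 / ?sh) * (P x * sinh (\<omega> * (b - x))) + (1 / ?sh) * (Q x * sinh (\<omega> * x))" for x
  define g1 where "g1 x = - (\<omega> / ?sh) * (P x * cosh (\<omega> * (b - x))) + (\<omega> / ?sh) * (Q x * cosh (\<omega> * x))" for x
  have P: "primitive_on b P (\<lambda>y. \<omega> * (f y * sinh (\<omega> * y)))"
  proof -
    have "P x = P 0 + (LBINT y:{0<..<x}. \<omega> * (f y * sinh (\<omega> * y)))" for x
      unfolding set_integral_mult_right by (simp add: P_def moment_0) (simp add: left_moment_def)
    moreover have "set_integrable lborel {0<..<b} (\<lambda>y. \<omega> * (f y * sinh (\<omega> * y)))"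
      by (intro set_integrable_mult_right L)
    ultimately show ?thesis unfolding primitive_on_def by blast
  qed
  have Q: "primitive_on b Q (\<lambda>y. - \<omega> * (f y * sinh (\<omega> * (b - y))))"
  proof -
    have "Q x = Q 0 + (LBINT y:{0<..<x}. - \<omega> * (f y * sinh (\<omega> * (b - y))))" for x
      unfolding set_integral_mult_right
      by (simp add: Q_def right_moment_def algebra_simps) (simp add: set_lebesgue_integral_def)
    moreover have "set_integrable lborel {0<..<b} (\<lambda>y. - \<omega> * (f y * sinh (\<omega> * (b - y))))"
      by (intro set_integrable_mult_right L)
    ultimately show ?thesis unfolding primitive_on_def by blast
  qed
  have Pc: "continuous_on {0..b} P" and Qc: "continuous_on {0..b} Q"
    using primitive_on_continuous P Q by auto
  have g: "primitive_on b g g1"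
  proof (rule primitive_on_cong[OF primitive_on_linear[OF
        primitive_on_mult[OF P hyperbolic_derivs(3) hyperbolic_continuous(3)]
        primitive_on_mult[OF Q hyperbolic_derivs(1) hyperbolic_continuous(1)], of "1 / ?sh" "1 / ?sh"]])
    show "set_integrable lborel {0<..<b} g1"
      unfolding g1_def by (intro set_integrable_continuous_Ioo continuous_intros Pc Qc)
  qed (auto simp: g_def g1_def add_divide_distrib algebra_simps intro!: always_eventually)
  define g2 where "g2 x = \<omega>\<^sup>2 * (g x - f x)" for x
  have g1: "primitive_on b g1 g2"
  proof (rule primitive_on_cong[OF primitive_on_linear[OF
        primitive_on_mult[OF P hyperbolic_derivs(4) hyperbolic_continuous(4)]
        primitive_on_mult[OF Q hyperbolic_derivs(2) hyperbolic_continuous(2)], of "- (\<omega> / ?sh)" "\<omega> / ?sh"]])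
    have "set_integrable lborel {0<..<b} (\<lambda>x. g x - f x)"
      by (intro set_integral_diff(1) f set_integrable_continuous_Ioo primitive_on_continuous[OF g])
    then show "set_integrable lborel {0<..<b} g2" unfolding g2_def by simp
    have "g2 x = - (\<omega> / ?sh) * (\<omega> * (f x * sinh (\<omega> * x)) * cosh (\<omega> * (b - x)) + P x * (- \<omega> * sinh (\<omega> * (b - x))))
        + \<omega> / ?sh * (- \<omega> * (f x * sinh (\<omega> * (b - x))) * cosh (\<omega> * x) + Q x * (\<omega> * sinh (\<omega> * x)))" for x
    proof -
      \<comment> \<open>In the second derivative the terms with the derivatives of \<open>P\<close>
        and \<open>Q\<close> add up to a multiple of the Wronskian, which cancels the denominator
        and leaves \<open>- \<omega>\<^sup>2 * f x\<close>.\<close>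
      have "f x = f x * (cosh (\<omega> * x) * sinh (\<omega> * (b - x)) + cosh (\<omega> * (b - x)) * sinh (\<omega> * x)) / ?sh"
        unfolding sinh_split using b \<omega> by simp
      then have "g2 x = \<omega>\<^sup>2 * (g x - f x * (cosh (\<omega> * x) * sinh (\<omega> * (b - x)) + cosh (\<omega> * (b - x)) * sinh (\<omega> * x)) / ?sh)"
        unfolding g2_def by simp
      then show ?thesis
        unfolding g_def by (simp add: algebra_simps power2_eq_square add_divide_distrib)
    qed
    then show "AE x\<in>{0<..<b} in lborel. g2 x
        = - (\<omega> / ?sh) * (\<omega> * (f x * sinh (\<omega> * x)) * cosh (\<omega> * (b - x)) + P x * (- \<omega> * sinh (\<omega> * (b - x))))
        + \<omega> / ?sh * (- \<omega> * (f x * sinh (\<omega> * (b - x))) * cosh (\<omega> * x) + Q x * (\<omega> * sinh (\<omega> * x)))"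
      by blast
  qed (auto simp: g1_def)
  have "g 0 = \<alpha>" "g b = \<beta>" using sinh_b moment_0 by (auto simp: g_def P_def Q_def)
  then show ?thesis using that[OF g g1] by (auto simp: g2_def)
qed

end

section \<open>Functions with two integrable weak derivatives\<close>

text \<open>\<open>g\<close> and \<open>g'\<close> are the continuous representatives, so boundary
  values become plain evaluations in place of the choice operators in \<open>point_value\<close> and
  \<open>weak_deriv\<close>. Only \<open>g''\<close> is determined merely almost everywhere.\<close>

definition W21_representative ::
  "('e \<Rightarrow> real) \<Rightarrow> ('e \<times> real \<Rightarrow> real) \<Rightarrow> ('e \<times> real \<Rightarrow> real) \<Rightarrow> ('e \<times> real \<Rightarrow> real) \<Rightarrow> ('e \<times> real \<Rightarrow> real) \<Rightarrow> bool"
  where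
  "W21_representative d u g g' g'' \<longleftrightarrow> (\<forall>i. primitive_on (d i) (\<lambda>x. g (i, x)) (\<lambda>x. g' (i, x)) \<and>
     primitive_on (d i) (\<lambda>x. g' (i, x)) (\<lambda>x. g'' (i, x)) \<and> (AE x\<in>{0<..<d i} in lborel. u (i, x) = g (i, x)))"

lemma W21_representative_parts:
  assumes "W21_representative d u g g' g''"
  shows "primitive_on (d i) (\<lambda>x. g (i, x)) (\<lambda>x. g' (i, x))"
    "primitive_on (d i) (\<lambda>x. g' (i, x)) (\<lambda>x. g'' (i, x))"
    "AE x\<in>{0<..<d i} in lborel. u (i, x) = g (i, x)"
  using assms by (simp_all add: W21_representative_def)

lemma has_weak_deriv_iff:
  "has_weak_deriv d f f' \<longleftrightarrow> (\<forall>i. weak_deriv_on (d i) (\<lambda>x. f (i, x)) (\<lambda>x. f' (i, x)))"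
  by (auto simp: has_weak_deriv_def weak_deriv_on_def)

lemma L1_spaceD: "u \<in> L1_space d \<Longrightarrow> set_integrable lborel {0<..<d i} (\<lambda>x. u (i, x))"
  by (simp add: L1_space_def)

text \<open>Any function picked by the choice in \<open>weak_deriv\<close> is the derivative of a
  primitive that agrees with \<open>g\<close> almost everywhere, hence everywhere by continuity;
  uniqueness of derivatives of primitives finishes.\<close>

lemma weak_deriv_AE_eq:
  assumes d: "\<And>i. d i > 0" and u: "u \<in> L1_space d"
    and g: "\<And>i. primitive_on (d i) (\<lambda>x. g (i, x)) (\<lambda>x. g' (i, x))"
    and ug: "\<And>i. AE x\<in>{0<..<d i} in lborel. u (i, x) = g (i, x)"
  shows "weak_deriv d u \<in> L1_space d" "AE x\<in>{0<..<d i} in lborel. weak_deriv d u (i, x) = g' (i, x)"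
proof -
  have g'L: "g' \<in> L1_space d" using primitive_onD(1)[OF g] by (simp add: L1_space_def)
  have "has_weak_deriv d u g'"
    unfolding has_weak_deriv_iff
    using primitive_on_imp_weak_deriv_on[OF less_imp_le[OF d] g L1_spaceD[OF u] ug] by blast
  with g'L have "\<exists>v. v \<in> L1_space d \<and> has_weak_deriv d u v" by blast
  from someI_ex[OF this]
  have v: "weak_deriv d u \<in> L1_space d" "has_weak_deriv d u (weak_deriv d u)"
    unfolding weak_deriv_def by auto
  show "weak_deriv d u \<in> L1_space d" by (fact v)
  have "weak_deriv_on (d i) (\<lambda>x. u (i, x)) (\<lambda>x. weak_deriv d u (i, x))"
    using v(2) by (simp add: has_weak_deriv_iff)
  from weak_deriv_on_imp_primitive_on[OF d L1_spaceD[OF u] L1_spaceD[OF v(1)] this]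
  obtain h where h: "primitive_on (d i) h (\<lambda>x. weak_deriv d u (i, x))" "AE x\<in>{0<..<d i} in lborel. u (i, x) = h x" .
  have "AE x\<in>{0<..<d i} in lborel. g (i, x) = h x"
    using ug[of i] h(2) by eventually_elim auto
  then have "g (i, x) = h x" if "x \<in> {0..d i}" for x
    using continuous_AE_eq_imp_eq[OF d primitive_on_continuous[OF g] primitive_on_continuous[OF h(1)] _ that] by simp
  then have "primitive_on (d i) (\<lambda>x. g (i, x)) (\<lambda>x. weak_deriv d u (i, x))"
    by (intro primitive_on_cong[OF h(1)] L1_spaceD[OF v(1)]) auto
  from primitive_on_unique[OF d this g]
  show "AE x\<in>{0<..<d i} in lborel. weak_deriv d u (i, x) = g' (i, x)" .
qed

lemma point_value_eq:
  assumes d: "\<And>i. d i > 0" and g: "continuous_on {0..d i} (\<lambda>x. g (i, x))"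
    and ug: "AE x\<in>{0<..<d i} in lborel. u (i, x) = g (i, x)" and x: "x \<in> {0..d i}"
  shows "point_value d u (i, x) = g (i, x)"
  unfolding point_value_def prod.case
proof (rule the_equality)
  show "\<exists>h. continuous_on {0..d i} h \<and> (AE y\<in>{0<..<d i} in lborel. u (i, y) = h y) \<and> h x = g (i, x)"
    using g ug by blast
  fix c assume "\<exists>h. continuous_on {0..d i} h \<and> (AE y\<in>{0<..<d i} in lborel. u (i, y) = h y) \<and> h x = c"
  then obtain h where h: "continuous_on {0..d i} h" "AE y\<in>{0<..<d i} in lborel. u (i, y) = h y" "h x = c" by blast
  have "AE x\<in>{0<..<d i} in lborel. h x = g (i, x)" using ug h(2) by eventually_elim auto
  from continuous_AE_eq_imp_eq[OF d h(1) g this x] show "c = g (i, x)" using h(3) by simp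
qed

lemma W21_representativeD:
  assumes d: "\<And>i. d i > 0" and u: "u \<in> L1_space d" and rep: "W21_representative d u g g' g''"
  shows "x \<in> {0..d i} \<Longrightarrow> point_value d u (i, x) = g (i, x)"
    "x \<in> {0..d i} \<Longrightarrow> point_value d (weak_deriv d u) (i, x) = g' (i, x)"
    "weak_deriv d (weak_deriv d u) \<in> L1_space d"
    "AE x\<in>{0<..<d i} in lborel. weak_deriv d (weak_deriv d u) (i, x) = g'' (i, x)"
proof -
  note g = W21_representative_parts[OF rep]
  note w1 = weak_deriv_AE_eq[OF d u g(1,3)]
  note w2 = weak_deriv_AE_eq[OF d w1(1) g(2) w1(2)]
  show "x \<in> {0..d i} \<Longrightarrow> point_value d u (i, x) = g (i, x)"
    by (rule point_value_eq[OF d primitive_on_continuous[OF g(1)] g(3)])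
  show "x \<in> {0..d i} \<Longrightarrow> point_value d (weak_deriv d u) (i, x) = g' (i, x)"
    by (rule point_value_eq[OF d primitive_on_continuous[OF g(2)] w1(2)])
  show "weak_deriv d (weak_deriv d u) \<in> L1_space d" by (fact w2)
  show "AE x\<in>{0<..<d i} in lborel. weak_deriv d (weak_deriv d u) (i, x) = g'' (i, x)" by (fact w2)
qed

lemma W21_space_iff:
  assumes d: "\<And>i. d i > 0"
  shows "u \<in> W21_space d \<longleftrightarrow> u \<in> L1_space d \<and> (\<exists>g g' g''. W21_representative d u g g' g'')"
proof (intro iffI conjI)
  assume "u \<in> W21_space d"
  then obtain v w where u: "u \<in> L1_space d" and v: "v \<in> L1_space d" and w: "w \<in> L1_space d"
    and weak: "has_weak_deriv d u v" "has_weak_deriv d v w"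
    unfolding W21_space_def by blast
  show "u \<in> L1_space d" by (fact u)
  have "\<exists>h. primitive_on (d i) h (\<lambda>x. w (i, x)) \<and> (AE x\<in>{0<..<d i} in lborel. v (i, x) = h x)" for i
    using weak_deriv_on_imp_primitive_on[OF d L1_spaceD[OF v] L1_spaceD[OF w]] weak(2)
    unfolding has_weak_deriv_iff by metis
  then obtain h where h: "\<And>i. primitive_on (d i) (h i) (\<lambda>x. w (i, x))" "\<And>i. AE x\<in>{0<..<d i} in lborel. v (i, x) = h i x"
    by metis
  have "\<exists>g. primitive_on (d i) g (\<lambda>x. v (i, x)) \<and> (AE x\<in>{0<..<d i} in lborel. u (i, x) = g x)" for i
    using weak_deriv_on_imp_primitive_on[OF d L1_spaceD[OF u] L1_spaceD[OF v]] weak(1)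
    unfolding has_weak_deriv_iff by metis
  then obtain g where g: "\<And>i. primitive_on (d i) (g i) (\<lambda>x. v (i, x))" "\<And>i. AE x\<in>{0<..<d i} in lborel. u (i, x) = g i x"
    by metis
  \<comment> \<open>The weak derivative \<open>v\<close> is exchanged for its continuous
    representative, so that both levels share the same first derivative.\<close>
  have "primitive_on (d i) (g i) (h i)" for i
  proof (rule primitive_on_cong[OF g(1)])
    show "set_integrable lborel {0<..<d i} (h i)"
      by (intro set_integrable_continuous_Ioo primitive_on_continuous[OF h(1)])
    show "AE x\<in>{0<..<d i} in lborel. h i x = v (i, x)" using h(2)[of i] by eventually_elim auto
  qed simp
  then have "W21_representative d u (\<lambda>(i, x). g i x) (\<lambda>(i, x). h i x) w"
    using g(2) h(1) by (simp add: W21_representative_def)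
  then show "\<exists>g g' g''. W21_representative d u g g' g''" by blast
next
  assume "u \<in> L1_space d \<and> (\<exists>g g' g''. W21_representative d u g g' g'')"
  then obtain g g' g'' where u: "u \<in> L1_space d" and rep: "W21_representative d u g g' g''" by blast
  note g = W21_representative_parts[OF rep]
  have L: "g' \<in> L1_space d" "g'' \<in> L1_space d"
    using primitive_onD(1)[OF g(1)] primitive_onD(1)[OF g(2)] by (auto simp: L1_space_def)
  have "has_weak_deriv d u g'" "has_weak_deriv d g' g''"
    unfolding has_weak_deriv_iff
    using primitive_on_imp_weak_deriv_on[OF less_imp_le[OF d] g(1) L1_spaceD[OF u] g(3)]
      primitive_on_imp_weak_deriv_on[OF less_imp_le[OF d] g(2) L1_spaceD[OF L(1)]] by auto
  then show "u \<in> W21_space d" unfolding W21_space_def using u L by blast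
qed

text \<open>The endpoint \<open>L\<^sub>i\<close> is encoded as \<open>(i, False)\<close> and \<open>R\<^sub>i\<close> as \<open>(i, True)\<close>.\<close>

definition endpoint :: "('e \<Rightarrow> real) \<Rightarrow> 'e \<times> bool \<Rightarrow> 'e \<times> real" where
  "endpoint d = (\<lambda>(i, s). (i, if s then d i else 0))"

definition endpoint_vertex :: "('e \<Rightarrow> real \<Rightarrow> real^3) \<Rightarrow> 'e \<times> bool \<Rightarrow> real^3" where
  "endpoint_vertex \<gamma> = (\<lambda>(i, s). if s then right_vertex \<gamma> i else left_vertex \<gamma> i)"

text \<open>The sign that turns the derivative along the edge into the one pointing from the
  endpoint into the edge; it gives both ends the same boundary condition.\<close>

definition inward :: "bool \<Rightarrow> real" where
  "inward s = (if s then - 1 else 1)"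

definition exit_rate :: "('e \<Rightarrow> real) \<Rightarrow> ('e \<Rightarrow> real) \<Rightarrow> 'e \<times> bool \<Rightarrow> real" where
  "exit_rate l r = (\<lambda>(i, s). if s then r i else l i)"

text \<open>\<open>jump_rate \<gamma> lc rc m n\<close> is \<open>l\<^sub>i\<^sub>j\<close> or \<open>r\<^sub>i\<^sub>j\<close>, where \<open>m\<close> is an endpoint of \<open>E\<^sub>i\<close> and \<open>n\<close> is the endpoint of
  \<open>E\<^sub>j\<close> at the same vertex.\<close>

definition jump_rate ::
  "('e \<Rightarrow> real \<Rightarrow> real^3) \<Rightarrow> ('e \<Rightarrow> 'e \<Rightarrow> real) \<Rightarrow> ('e \<Rightarrow> 'e \<Rightarrow> real) \<Rightarrow> 'e \<times> bool \<Rightarrow> 'e \<times> bool \<Rightarrow> real" where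
  "jump_rate \<gamma> lc rc m n = (if fst m \<noteq> fst n \<and> endpoint_vertex \<gamma> m = endpoint_vertex \<gamma> n
     then (if snd m then rc else lc) (fst m) (fst n) else 0)"

lemma endpoint_pair: "endpoint d (i, False) = (i, 0)" "endpoint d (i, True) = (i, d i)"
  by (simp_all add: endpoint_def)

lemma all_endpoints: "(\<forall>n. P n) \<longleftrightarrow> (\<forall>i. P (i, False) \<and> P (i, True))"
  by (metis (full_types) surj_pair)

lemma sum_endpoints:
  "(\<Sum>m\<in>UNIV. F (m :: 'e::finite \<times> bool)) = (\<Sum>i\<in>UNIV. F (i, False) + F (i, True))"
proof -
  have "(\<Sum>m\<in>UNIV. F m) = (\<Sum>i\<in>UNIV. \<Sum>s\<in>UNIV. F (i, s))"
    by (simp add: sum.cartesian_product flip: UNIV_Times_UNIV)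
  then show ?thesis by (simp add: UNIV_bool add.commute)
qed

text \<open>In \<open>A_dom\<close> the condition at an endpoint involves the rates out of it, here
  the rates into it: the sum runs over the first argument of \<open>jump_rate\<close>. The factor
  \<open>\<sigma> i\<close> cancels the division in the functionals.\<close>

lemma F_eq_jump_rates:
  fixes \<sigma> :: "'e::finite \<Rightarrow> real"
  assumes \<sigma>: "\<And>i. \<sigma> i > 0"
  shows "\<sigma> i * F_left \<gamma> d \<sigma> l lc rc i u = l i * (\<sigma> i * point_value d u (i, 0))
      - (\<Sum>m\<in>UNIV. jump_rate \<gamma> lc rc m (i, False) * (\<sigma> (fst m) * point_value d u (endpoint d m)))"
    and "\<sigma> i * F_right \<gamma> d \<sigma> r lc rc i u = (\<Sum>m\<in>UNIV. jump_rate \<gamma> lc rc m (i, True) * (\<sigma> (fst m) * point_value d u (endpoint d m)))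
      - r i * (\<sigma> i * point_value d u (i, d i))"
proof -
  have filt: "(\<Sum>j | P j. F j) = (\<Sum>j\<in>UNIV. if P j then F j else 0)" for P :: "'e \<Rightarrow> bool" and F :: "'e \<Rightarrow> real"
    by (simp add: sum.If_cases)
  have *: "(\<Sum>m\<in>UNIV. jump_rate \<gamma> lc rc m (i, s) * (\<sigma> (fst m) * point_value d u (endpoint d m)))
    = (\<Sum>j | j \<noteq> i \<and> left_vertex \<gamma> j = endpoint_vertex \<gamma> (i, s). \<sigma> j * lc j i * point_value d u (j, 0))
      + (\<Sum>j | j \<noteq> i \<and> right_vertex \<gamma> j = endpoint_vertex \<gamma> (i, s). \<sigma> j * rc j i * point_value d u (j, d j))" for s
    unfolding sum_endpoints filt sum.distrib
    by (intro arg_cong2[where f = "(+)"] sum.cong)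
      (auto simp: jump_rate_def endpoint_vertex_def endpoint_def)
  have [simp]: "\<sigma> i \<noteq> 0" using \<sigma>[of i] by simp
  show "\<sigma> i * F_left \<gamma> d \<sigma> l lc rc i u = l i * (\<sigma> i * point_value d u (i, 0))
      - (\<Sum>m\<in>UNIV. jump_rate \<gamma> lc rc m (i, False) * (\<sigma> (fst m) * point_value d u (endpoint d m)))"
    unfolding * F_left_def by (simp add: endpoint_vertex_def)
  show "\<sigma> i * F_right \<gamma> d \<sigma> r lc rc i u = (\<Sum>m\<in>UNIV. jump_rate \<gamma> lc rc m (i, True) * (\<sigma> (fst m) * point_value d u (endpoint d m)))
      - r i * (\<sigma> i * point_value d u (i, d i))"
    unfolding * F_right_def by (simp add: endpoint_vertex_def)
qed

text \<open>Flux balance in the unknowns \<sigma> g at the endpoints: the flux at \<open>n\<close>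
  equals the loss from \<open>n\<close> minus the gain from the other endpoints at its
  vertex.\<close>

definition boundary_conditions where
  "boundary_conditions \<gamma> d \<sigma> l r lc rc k g g' \<longleftrightarrow> (\<forall>n.
     k * \<sigma> (fst n) * (inward (snd n) * g' (endpoint d n)) =
       exit_rate l r n * (\<sigma> (fst n) * g (endpoint d n))
       - (\<Sum>m\<in>UNIV. jump_rate \<gamma> lc rc m n * (\<sigma> (fst m) * g (endpoint d m))))"

text \<open>Removes all choice operators from the domain. The equivalence of the boundary conditions
  is proved for every representative, so one may be picked freely.\<close>

lemma A_star_dom_iff:
  fixes \<sigma> :: "'e::finite \<Rightarrow> real"
  assumes d: "\<And>i. d i > 0" and \<sigma>: "\<And>i. \<sigma> i > 0"
  shows "u \<in> A_star_dom \<gamma> d \<sigma> l r lc rc k \<longleftrightarrow> u \<in> L1_space d \<and>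
    (\<exists>g g' g''. W21_representative d u g g' g'' \<and> boundary_conditions \<gamma> d \<sigma> l r lc rc k g g')"
proof -
  have "(\<forall>i. k * point_value d (weak_deriv d u) (i, 0) = F_left \<gamma> d \<sigma> l lc rc i u \<and>
      k * point_value d (weak_deriv d u) (i, d i) = F_right \<gamma> d \<sigma> r lc rc i u)
    \<longleftrightarrow> boundary_conditions \<gamma> d \<sigma> l r lc rc k g g'"
    if u: "u \<in> L1_space d" and g: "W21_representative d u g g' g''" for g g' g''
  proof -
    note W = W21_representativeD(1,2)[OF d u g]
    have ep: "point_value d u (endpoint d m) = g (endpoint d m)" for m
      using W(1) less_imp_le[OF d] by (cases m) (auto simp: endpoint_def)
    have eq: "k * x = F \<longleftrightarrow> k * \<sigma> i * x = \<sigma> i * F" for x F i using \<sigma>[of i] by (auto simp: algebra_simps)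
    have v: "point_value d (weak_deriv d u) (i, 0) = g' (i, 0)" "point_value d (weak_deriv d u) (i, d i) = g' (i, d i)"
      "point_value d u (i, 0) = g (i, 0)" "point_value d u (i, d i) = g (i, d i)" for i
      using W less_imp_le[OF d] by auto
    have "boundary_conditions \<gamma> d \<sigma> l r lc rc k g g' \<longleftrightarrow>
      (\<forall>i. k * \<sigma> i * g' (i, 0) = l i * (\<sigma> i * g (i, 0))
          - (\<Sum>m\<in>UNIV. jump_rate \<gamma> lc rc m (i, False) * (\<sigma> (fst m) * g (endpoint d m)))
        \<and> k * \<sigma> i * - g' (i, d i) = r i * (\<sigma> i * g (i, d i))
          - (\<Sum>m\<in>UNIV. jump_rate \<gamma> lc rc m (i, True) * (\<sigma> (fst m) * g (endpoint d m))))"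
      unfolding boundary_conditions_def all_endpoints by (simp add: inward_def exit_rate_def endpoint_pair)
    also have "\<dots> \<longleftrightarrow> (\<forall>i. k * \<sigma> i * g' (i, 0) = \<sigma> i * F_left \<gamma> d \<sigma> l lc rc i u \<and>
        k * \<sigma> i * g' (i, d i) = \<sigma> i * F_right \<gamma> d \<sigma> r lc rc i u)"
      using F_eq_jump_rates(1)[where \<sigma> = \<sigma> and \<gamma> = \<gamma> and d = d and l = l and lc = lc and rc = rc and u = u, OF \<sigma>, unfolded ep v]
        F_eq_jump_rates(2)[where \<sigma> = \<sigma> and \<gamma> = \<gamma> and d = d and r = r and lc = lc and rc = rc and u = u, OF \<sigma>, unfolded ep v]
      by (intro iff_allI conj_cong refl) (simp, simp, rule iffI, linarith, linarith)
    finally show ?thesis unfolding v using eq by auto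
  qed
  then show ?thesis
    unfolding A_star_dom_def using W21_space_iff[where d = d and u = u, OF d] by blast
qed

section \<open>The space of integrable functions on the graph\<close>

definition AE_eq :: "('e \<Rightarrow> real) \<Rightarrow> ('e \<times> real \<Rightarrow> real) \<Rightarrow> ('e \<times> real \<Rightarrow> real) \<Rightarrow> bool" where
  "AE_eq d f g \<longleftrightarrow> (\<forall>i. AE x\<in>{0<..<d i} in lborel. f (i, x) = g (i, x))"

lemma L1_space_linear:
  assumes "f \<in> L1_space d" "g \<in> L1_space d"
  shows "(\<lambda>s. a * f s + b * g s) \<in> L1_space d"
  unfolding L1_space_def mem_Collect_eq
  by (intro allI set_integral_add(1) set_integrable_mult_right L1_spaceD assms)

lemma L1_space_diff: "f \<in> L1_space d \<Longrightarrow> g \<in> L1_space d \<Longrightarrow> (\<lambda>s. f s - g s) \<in> L1_space d"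
  using L1_space_linear[of f d g 1 "-1"] by simp

lemma subspace_L1_space: "subspace (L1_space d :: ('e \<times> real \<Rightarrow> real) set)"
proof (rule subspaceI)
  show "0 \<in> L1_space d" by (simp add: L1_space_def zero_fun_def set_integrable_def)
  show "f + g \<in> L1_space d" if "f \<in> L1_space d" "g \<in> L1_space d" for f g :: "'e \<times> real \<Rightarrow> real"
    using L1_space_linear[OF that, of 1 1] by (simp add: plus_fun_def)
  show "c *\<^sub>R f \<in> L1_space d" if "f \<in> L1_space d" for f :: "'e \<times> real \<Rightarrow> real" and c
    using L1_space_linear[OF that that, of c 0] by (simp add: scaleR_fun_def)
qed

lemma L1_space_abs: "f \<in> L1_space d \<Longrightarrow> (\<lambda>s. \<bar>f s\<bar>) \<in> L1_space d"
  by (simp add: L1_space_def set_integrable_abs)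

lemma L1_norm_eq_S_integral: "L1_norm d f = S_integral d (\<lambda>s. \<bar>f s\<bar>)"
  by (simp add: L1_norm_def S_integral_def)

lemma S_integral_linear:
  assumes "f \<in> L1_space d" "g \<in> L1_space d"
  shows "S_integral d (\<lambda>s. a * f s + b * g s) = a * S_integral d f + b * S_integral d g"
proof -
  have "(LBINT x:{0<..<d i}. a * f (i, x) + b * g (i, x))
      = a * (LBINT x:{0<..<d i}. f (i, x)) + b * (LBINT x:{0<..<d i}. g (i, x))" for i
    using set_integral_add(2)[OF set_integrable_mult_right set_integrable_mult_right] L1_spaceD[OF assms(1)] L1_spaceD[OF assms(2)]
    by simp
  then show ?thesis by (simp add: S_integral_def sum.distrib sum_distrib_left)
qed

lemma S_integral_mono:
  assumes "f \<in> L1_space d" "g \<in> L1_space d" "\<And>i. AE x\<in>{0<..<d i} in lborel. f (i, x) \<le> g (i, x)"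
  shows "S_integral d f \<le> S_integral d g"
  unfolding S_integral_def
  using assms by (intro sum_mono set_integral_mono_AE L1_spaceD) auto

lemma S_integral_cong:
  assumes "f \<in> L1_space d" "g \<in> L1_space d" "AE_eq d f g"
  shows "S_integral d f = S_integral d g"
  unfolding S_integral_def
  using assms by (intro sum.cong set_integral_AE_eq L1_spaceD) (auto simp: AE_eq_def)

lemma L1_norm_zero_iff:
  assumes "f \<in> L1_space d" shows "L1_norm d f = 0 \<longleftrightarrow> AE_eq d f (\<lambda>_. 0)"
proof -
  have i: "integrable lborel (\<lambda>x. indicator {0<..<d i} x * f (i, x))" for i
    using L1_spaceD[OF assms, of i] by (simp add: set_integrable_def)
  have eq: "(LBINT x:{0<..<d i}. \<bar>f (i, x)\<bar>) = (LBINT x. norm (indicator {0<..<d i} x * f (i, x)))" for i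
    by (simp add: set_lebesgue_integral_def abs_mult)
  have "(LBINT x. norm (indicator {0<..<d i} x * f (i, x))) = 0
      \<longleftrightarrow> (AE x\<in>{0<..<d i} in lborel. f (i, x) = 0)" for i
  proof -
    have "(LBINT x. norm (indicator {0<..<d i} x * f (i, x))) = 0
        \<longleftrightarrow> (AE x in lborel. norm (indicator {0<..<d i} x * f (i, x)) = 0)"
      by (rule integral_nonneg_eq_0_iff_AE) (use i[of i] in auto)
    also have "\<dots> \<longleftrightarrow> (AE x\<in>{0<..<d i} in lborel. f (i, x) = 0)"
      by (intro AE_cong) (auto simp: indicator_def)
    finally show ?thesis .
  qed
  then show ?thesis
    unfolding L1_norm_def AE_eq_def eq by (subst sum_nonneg_eq_0_iff) auto
qed

lemma L1_norm_diff_zero_iff: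
  "f \<in> L1_space d \<Longrightarrow> g \<in> L1_space d \<Longrightarrow> L1_norm d (\<lambda>s. f s - g s) = 0 \<longleftrightarrow> AE_eq d f g"
  using L1_norm_zero_iff[OF L1_space_diff] by (simp add: AE_eq_def)

lemma L1_norm_nonneg: "L1_norm d f \<ge> 0"
  unfolding L1_norm_def set_lebesgue_integral_def by (intro sum_nonneg integral_nonneg_AE) auto

lemma L1_norm_triangle:
  assumes "f \<in> L1_space d" "g \<in> L1_space d"
  shows "L1_norm d (\<lambda>s. f s + g s) \<le> L1_norm d f + L1_norm d g"
proof -
  have "L1_norm d (\<lambda>s. f s + g s) \<le> S_integral d (\<lambda>s. 1 * \<bar>f s\<bar> + 1 * \<bar>g s\<bar>)"
    unfolding L1_norm_eq_S_integral
    using L1_space_linear[OF L1_space_abs L1_space_abs, OF assms, of 1 1] L1_space_abs[OF L1_space_linear[OF assms, of 1 1]]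
    by (intro S_integral_mono) (auto simp: abs_triangle_ineq)
  also have "\<dots> = L1_norm d f + L1_norm d g"
    by (subst S_integral_linear) (auto simp: L1_norm_eq_S_integral L1_space_abs assms)
  finally show ?thesis .
qed

lemma L1_norm_scale: "L1_norm d (\<lambda>s. a * f s) = \<bar>a\<bar> * L1_norm d f"
  by (simp add: L1_norm_def abs_mult sum_distrib_left)

text \<open>The Riesz-Fischer argument: a subsequence is Cauchy almost everywhere, and its pointwise
  limit is identified as the limit in mean by Fatou.\<close>

lemma L1_Ioo_complete:
  fixes f :: "nat \<Rightarrow> real \<Rightarrow> real"
  assumes f: "\<And>n. set_integrable lborel A (f n)" and A: "A \<in> sets borel"
    and Cauchy: "\<And>e. e > 0 \<Longrightarrow> \<exists>N. \<forall>m\<ge>N. \<forall>n\<ge>N. (LBINT x:A. \<bar>f m x - f n x\<bar>) < e"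
  obtains g where "set_integrable lborel A g" "(\<lambda>n. LBINT x:A. \<bar>f n x - g x\<bar>) \<longlonglongrightarrow> 0"
proof -
  define s where "s n x = indicator A x * f n x" for n x
  have s: "integrable lborel (s n)" for n using f[of n] by (simp add: set_integrable_def s_def[abs_def])
  have s_diff: "(LBINT x. norm (s m x - s n x)) = (LBINT x:A. \<bar>f m x - f n x\<bar>)" for m n
    by (simp add: set_lebesgue_integral_def s_def abs_mult flip: right_diff_distrib)
  have C: "\<exists>N. \<forall>i\<ge>N. \<forall>j\<ge>N. (LBINT x. norm (s i x - s j x)) < e" if "e > 0" for e
    unfolding s_diff by (rule Cauchy[OF that])
  from cauchy_L1_AE_cauchy_subseq[of lborel s, OF s C]
  obtain r where r: "strict_mono r" "AE x in lborel. Cauchy (\<lambda>i. s (r i) x)" by blast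
  have sm [measurable]: "s n \<in> borel_measurable borel" for n using borel_measurable_integrable[OF s] by simp
  define g where "g x = lim (\<lambda>i. s (r i) x)" for x
  have g [measurable]: "g \<in> borel_measurable borel" unfolding g_def by measurable
  have lim: "AE x in lborel. (\<lambda>i. s (r i) x) \<longlonglongrightarrow> g x"
    using r(2) by eventually_elim (simp add: g_def Cauchy_convergent convergent_LIMSEQ_iff flip: convergent_LIMSEQ_iff)
  have bound: "\<exists>N. \<forall>n\<ge>N. integrable lborel (\<lambda>x. s n x - g x) \<and> (LBINT x. norm (s n x - g x)) \<le> e" if e: "e > 0" for e
  proof -
    obtain N where N: "\<And>m n. m \<ge> N \<Longrightarrow> n \<ge> N \<Longrightarrow> (LBINT x. norm (s m x - s n x)) < e" using C[OF e] by blast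
    have "(\<integral>\<^sup>+x. norm (s n x - g x) \<partial>lborel) \<le> ennreal e" if n: "n \<ge> N" for n
    proof -
      \<comment> \<open>The index \<open>n\<close> stays fixed while the subsequence runs to
        infinity, so the Cauchy bound passes to the distance from \<open>g\<close>.\<close>
      have "(\<integral>\<^sup>+x. norm (s n x - g x) \<partial>lborel) = (\<integral>\<^sup>+x. liminf (\<lambda>i. ennreal (norm (s n x - s (r i) x))) \<partial>lborel)"
      proof (rule nn_integral_cong_AE)
        show "AE x in lborel. ennreal (norm (s n x - g x)) = liminf (\<lambda>i. ennreal (norm (s n x - s (r i) x)))"
          using lim
        proof eventually_elim
          case (elim x)
          have "(\<lambda>i. ennreal (norm (s n x - s (r i) x))) \<longlonglongrightarrow> ennreal (norm (s n x - g x))"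
            by (intro tendsto_intros elim)
          from lim_imp_Liminf[OF _ this] show ?case by simp
        qed
      qed
      also have "\<dots> \<le> liminf (\<lambda>i. \<integral>\<^sup>+x. norm (s n x - s (r i) x) \<partial>lborel)"
        by (rule nn_integral_liminf) measurable
      also have "\<dots> \<le> ennreal e"
      proof (rule Liminf_le)
        show "\<forall>\<^sub>F i in sequentially. (\<integral>\<^sup>+x. norm (s n x - s (r i) x) \<partial>lborel) \<le> ennreal e"
          using eventually_ge_at_top[of N]
        proof eventually_elim
          case (elim i)
          then have "r i \<ge> N" using seq_suble[OF r(1), of i] by simp
          then have "(LBINT x. norm (s n x - s (r i) x)) \<le> e" using N[OF n] by (simp add: less_imp_le)
          then show ?case
            by (subst nn_integral_eq_integral) (auto intro!: integrable_norm Bochner_Integration.integrable_diff s ennreal_leI)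
        qed
      qed simp
      finally show ?thesis .
    qed
    note le = this
    show ?thesis
    proof (intro exI[of _ N] allI impI)
      fix n assume n: "n \<ge> N"
      have int: "integrable lborel (\<lambda>x. s n x - g x)"
        using le[OF n] by (intro integrableI_bounded) (auto intro: le_less_trans)
      then have "ennreal (LBINT x. norm (s n x - g x)) \<le> ennreal e"
        using le[OF n] by (subst (asm) nn_integral_eq_integral) auto
      with int show "integrable lborel (\<lambda>x. s n x - g x) \<and> (LBINT x. norm (s n x - g x)) \<le> e"
        using e by (simp add: ennreal_le_iff)
    qed
  qed
  obtain n where "integrable lborel (\<lambda>x. s n x - g x)" using bound[of 1] by auto
  from Bochner_Integration.integrable_diff[OF s[of n] this] have gi: "integrable lborel g" by simp
  have gA: "set_integrable lborel A g"
    using integrable_mult_indicator[OF _ gi, of A] A by (simp add: set_integrable_def)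
  have "(\<lambda>n. LBINT x. norm (s n x - g x)) \<longlonglongrightarrow> 0"
  proof (rule LIMSEQ_I)
    fix e :: real assume e: "e > 0"
    then obtain N where N: "\<And>n. n \<ge> N \<Longrightarrow> (LBINT x. norm (s n x - g x)) \<le> e / 2"
      using bound[of "e/2"] by auto
    have "norm ((LBINT x. norm (s n x - g x)) - 0) < e" if "n \<ge> N" for n
    proof -
      have "0 \<le> (LBINT x. norm (s n x - g x))" by (intro integral_nonneg_AE) simp
      then show ?thesis using N[OF that] e unfolding diff_0_right real_norm_def by linarith
    qed
    then show "\<exists>N. \<forall>n\<ge>N. norm ((LBINT x. norm (s n x - g x)) - 0) < e" by blast
  qed
  moreover have "\<forall>\<^sub>F n in sequentially. norm (LBINT x:A. \<bar>f n x - g x\<bar>) \<le> (LBINT x. norm (s n x - g x))"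
  proof (intro always_eventually allI)
    fix n
    have "0 \<le> (LBINT x:A. \<bar>f n x - g x\<bar>)"
      unfolding set_lebesgue_integral_def by (intro integral_nonneg_AE) simp
    moreover have "(LBINT x:A. \<bar>f n x - g x\<bar>) \<le> (LBINT x. norm (s n x - g x))"
      unfolding set_lebesgue_integral_def
    proof (rule integral_mono)
      show "integrable lborel (\<lambda>x. indicat_real A x *\<^sub>R \<bar>f n x - g x\<bar>)"
        using set_integrable_abs[OF set_integral_diff(1)[OF f gA]] unfolding set_integrable_def .
      show "integrable lborel (\<lambda>x. norm (s n x - g x))"
        by (intro integrable_norm Bochner_Integration.integrable_diff s gi)
    qed (simp add: s_def indicator_def)
    ultimately show "norm (LBINT x:A. \<bar>f n x - g x\<bar>) \<le> (LBINT x. norm (s n x - g x))"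
      by simp
  qed
  ultimately have "(\<lambda>n. LBINT x:A. \<bar>f n x - g x\<bar>) \<longlonglongrightarrow> 0"
    by (rule Lim_null_comparison[rotated])
  then show ?thesis using that gA by blast
qed

lemma L1_space_complete:
  fixes d :: "'e::finite \<Rightarrow> real"
  assumes f: "\<And>n. f n \<in> L1_space d"
    and Cauchy: "\<And>e. e > 0 \<Longrightarrow> \<exists>N. \<forall>m\<ge>N. \<forall>n\<ge>N. L1_norm d (\<lambda>s. f m s - f n s) < e"
  shows "\<exists>g\<in>L1_space d. (\<lambda>n. L1_norm d (\<lambda>s. f n s - g s)) \<longlonglongrightarrow> 0"
proof -
  have "\<exists>g. set_integrable lborel {0<..<d i} g \<and> (\<lambda>n. LBINT x:{0<..<d i}. \<bar>f n (i, x) - g x\<bar>) \<longlonglongrightarrow> 0" for i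
  proof -
    have le: "(LBINT x:{0<..<d i}. \<bar>f m (i, x) - f n (i, x)\<bar>) \<le> L1_norm d (\<lambda>s. f m s - f n s)" for m n
      unfolding L1_norm_def
      by (rule member_le_sum) (auto intro!: integral_nonneg_AE simp: set_lebesgue_integral_def)
    have "\<exists>N. \<forall>m\<ge>N. \<forall>n\<ge>N. (LBINT x:{0<..<d i}. \<bar>f m (i, x) - f n (i, x)\<bar>) < e" if "e > 0" for e
      using Cauchy[OF that] le le_less_trans by meson
    from L1_Ioo_complete[where f = "\<lambda>n x. f n (i, x)", OF L1_spaceD[OF f] _ this]
    show ?thesis by auto
  qed
  then have "\<exists>g. \<forall>i. set_integrable lborel {0<..<d i} (g i) \<and>
      (\<lambda>n. LBINT x:{0<..<d i}. \<bar>f n (i, x) - g i x\<bar>) \<longlonglongrightarrow> 0"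
    by (intro choice allI)
  then obtain g where g: "\<And>i. set_integrable lborel {0<..<d i} (g i)"
    "\<And>i. (\<lambda>n. LBINT x:{0<..<d i}. \<bar>f n (i, x) - g i x\<bar>) \<longlonglongrightarrow> 0" by blast
  define G where "G = (\<lambda>(i, x). g i x)"
  have "(\<lambda>n. L1_norm d (\<lambda>s. f n s - G s)) \<longlonglongrightarrow> (\<Sum>i::'e\<in>UNIV. 0)"
    unfolding L1_norm_def G_def prod.case by (intro tendsto_sum g)
  then have "(\<lambda>n. L1_norm d (\<lambda>s. f n s - G s)) \<longlonglongrightarrow> 0" by (simp only: sum.neutral_const)
  moreover have "G \<in> L1_space d" using g(1) by (simp add: L1_space_def G_def)
  ultimately show ?thesis by blast
qed

lemma S_integral_L1_limit:
  assumes f: "\<And>n::nat. f n \<in> L1_space d" and g: "g \<in> L1_space d"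
    and lim: "(\<lambda>n. L1_norm d (\<lambda>s. f n s - g s)) \<longlonglongrightarrow> 0"
  shows "(\<lambda>n. S_integral d (f n)) \<longlonglongrightarrow> S_integral d g"
proof (rule LIM_zero_cancel, rule Lim_null_comparison[OF _ lim])
  have "\<bar>S_integral d (f n) - S_integral d g\<bar> \<le> L1_norm d (\<lambda>s. f n s - g s)" for n
  proof -
    have "S_integral d (f n) - S_integral d g = S_integral d (\<lambda>s. f n s - g s)"
      using S_integral_linear[OF f[of n] g, where a = 1 and b = "-1"] by simp
    also have "\<bar>\<dots>\<bar> \<le> L1_norm d (\<lambda>s. f n s - g s)"
      unfolding S_integral_def L1_norm_def by (intro order_trans[OF sum_abs] sum_mono set_LINT_abs_le)
    finally show ?thesis .
  qed
  then show "\<forall>\<^sub>F n in sequentially. norm (S_integral d (f n) - S_integral d g) \<le> L1_norm d (\<lambda>s. f n s - g s)"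
    by simp
qed

text \<open>\<open>\<bar>g\<bar> - g\<close> is twice the negative part of \<open>g\<close>, and
  where \<open>f n\<close> is nonnegative it is at most
  \<open>2 * \<bar>f n - g\<bar>\<close>.\<close>

lemma AE_nonneg_L1_limit:
  assumes f: "\<And>n::nat. f n \<in> L1_space d" "\<And>n. AE_nonneg d (f n)" and g: "g \<in> L1_space d"
    and lim: "(\<lambda>n. L1_norm d (\<lambda>s. f n s - g s)) \<longlonglongrightarrow> 0"
  shows "AE_nonneg d g"
proof -
  have m: "(\<lambda>s. (\<bar>g s\<bar> - g s)) \<in> L1_space d" using L1_space_diff[OF L1_space_abs[OF g] g] .
  have "L1_norm d (\<lambda>s. \<bar>g s\<bar> - g s) \<le> 2 * L1_norm d (\<lambda>s. f n s - g s)" for n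
  proof -
    have fg: "(\<lambda>s. \<bar>f n s - g s\<bar>) \<in> L1_space d" by (intro L1_space_abs L1_space_diff f g)
    have "L1_norm d (\<lambda>s. \<bar>g s\<bar> - g s) \<le> S_integral d (\<lambda>s. 2 * \<bar>f n s - g s\<bar> + 0 * \<bar>f n s - g s\<bar>)"
      unfolding L1_norm_eq_S_integral
    proof (rule S_integral_mono)
      show "(\<lambda>s. \<bar>\<bar>g s\<bar> - g s\<bar>) \<in> L1_space d" by (intro L1_space_abs m)
      show "(\<lambda>s. 2 * \<bar>f n s - g s\<bar> + 0 * \<bar>f n s - g s\<bar>) \<in> L1_space d" by (intro L1_space_linear fg)
      show "AE x\<in>{0<..<d i} in lborel. \<bar>\<bar>g (i, x)\<bar> - g (i, x)\<bar> \<le> 2 * \<bar>f n (i, x) - g (i, x)\<bar> + 0 * \<bar>f n (i, x) - g (i, x)\<bar>" for i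
        using f(2)[of n, unfolded AE_nonneg_def, rule_format, of i] by eventually_elim (auto split: abs_split)
    qed
    also have "\<dots> = 2 * L1_norm d (\<lambda>s. f n s - g s)"
      by (subst S_integral_linear[OF fg fg]) (simp add: L1_norm_eq_S_integral)
    finally show ?thesis .
  qed
  then have "L1_norm d (\<lambda>s. \<bar>g s\<bar> - g s) \<le> 2 * 0"
    by (intro LIMSEQ_le_const[OF tendsto_mult_left[OF lim]]) auto
  then have "L1_norm d (\<lambda>s. \<bar>g s\<bar> - g s) = 0" using L1_norm_nonneg[of d] by (simp add: antisym)
  then have "AE_eq d (\<lambda>s. \<bar>g s\<bar> - g s) (\<lambda>_. 0)" using L1_norm_zero_iff[OF m] by simp
  show ?thesis
    unfolding AE_nonneg_def
  proof
    fix i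
    have "AE x\<in>{0<..<d i} in lborel. \<bar>g (i, x)\<bar> - g (i, x) = 0"
      using \<open>AE_eq d (\<lambda>s. \<bar>g s\<bar> - g s) (\<lambda>_. 0)\<close> by (auto simp: AE_eq_def)
    then show "AE x\<in>{0<..<d i} in lborel. 0 \<le> g (i, x)" by eventually_elim auto
  qed
qed

section \<open>The semigroup on the graph\<close>

text \<open>\<open>k\<close> stands for the value \<kappa> n at one fixed index.\<close>

locale diffusion_network =
  fixes \<gamma> :: "'e::finite \<Rightarrow> real \<Rightarrow> real^3" and d \<sigma> l r :: "'e \<Rightarrow> real" and lc rc :: "'e \<Rightarrow> 'e \<Rightarrow> real"
    and k :: real
  assumes d: "d i > 0" and ends: "left_vertex \<gamma> i \<noteq> right_vertex \<gamma> i"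
    and \<sigma>: "\<sigma> i > 0" and k: "k > 0"
    and l: "l i \<ge> 0" and r: "r i \<ge> 0"
    and lc: "i \<noteq> j \<Longrightarrow> lc i j \<ge> 0" and rc: "i \<noteq> j \<Longrightarrow> rc i j \<ge> 0"
    and lc_sum: "(\<Sum>j\<in>-{i}. lc i j) \<le> l i" and rc_sum: "(\<Sum>j\<in>-{i}. rc i j) \<le> r i"
begin

abbreviation "jump \<equiv> jump_rate \<gamma> lc rc"
abbreviation "exit \<equiv> exit_rate l r"
abbreviation "D \<equiv> A_star_dom \<gamma> d \<sigma> l r lc rc k"
abbreviation "A \<equiv> A_star_op d \<sigma> k"
abbreviation "X \<equiv> L1_space d"
abbreviation "BC \<equiv> boundary_conditions \<gamma> d \<sigma> l r lc rc k"

section \<open>Rates, domain and total mass\<close>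

lemma jump_nonneg: "jump m n \<ge> 0"
  using lc rc by (auto simp: jump_rate_def)

text \<open>The two ends of an edge are different vertices, so each edge contributes at most one
  endpoint at the given vertex. The right-hand side is the sum in the boundary conditions of
  \<open>A_dom\<close> evaluated at the constant function 1.\<close>

lemma jump_row_sum:
  "(\<Sum>n\<in>UNIV. jump m n)
     = (\<Sum>j\<in>-{fst m}. (if snd m then rc else lc) (fst m) j * vertex_value \<gamma> d (\<lambda>_. 1) (endpoint_vertex \<gamma> m) j)"
proof -
  have "(\<Sum>n\<in>UNIV. jump m n) = (\<Sum>j\<in>UNIV. jump m (j, False) + jump m (j, True))" by (rule sum_endpoints)
  also have "\<dots> = (\<Sum>j\<in>-{fst m}. jump m (j, False) + jump m (j, True))"
    by (rule sum.mono_neutral_right) (auto simp: jump_rate_def)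
  also have "\<dots> = (\<Sum>j\<in>-{fst m}. (if snd m then rc else lc) (fst m) j * vertex_value \<gamma> d (\<lambda>_. 1) (endpoint_vertex \<gamma> m) j)"
  proof (rule sum.cong)
    fix j assume "j \<in> - {fst m}"
    then have "fst m \<noteq> j" by auto
    then show "jump m (j, False) + jump m (j, True)
        = (if snd m then rc else lc) (fst m) j * vertex_value \<gamma> d (\<lambda>_. 1) (endpoint_vertex \<gamma> m) j"
      using ends[of j] by (cases m) (auto simp: jump_rate_def vertex_value_def endpoint_vertex_def)
  qed simp
  finally show ?thesis .
qed

lemma jump_sum_le: "(\<Sum>n\<in>UNIV. jump m n) \<le> exit m"
proof -
  have "(\<Sum>n\<in>UNIV. jump m n) \<le> (\<Sum>j\<in>-{fst m}. (if snd m then rc else lc) (fst m) j)"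
    unfolding jump_row_sum using lc rc by (intro sum_mono) (auto simp: vertex_value_def)
  also have "\<dots> \<le> exit m" using lc_sum rc_sum by (cases m) (auto simp: exit_rate_def)
  finally show ?thesis .
qed

lemma A_L1:
  assumes u: "u \<in> X" and rep: "W21_representative d u g g' g''"
  shows "A u \<in> X" "AE x\<in>{0<..<d i} in lborel. A u (i, x) = k * \<sigma> i * g'' (i, x)"
proof -
  note w = W21_representativeD(3,4)[OF d u rep]
  show "A u \<in> X"
    using L1_spaceD[OF w(1)] by (auto simp: L1_space_def A_star_op_def)
  show "AE x\<in>{0<..<d i} in lborel. A u (i, x) = k * \<sigma> i * g'' (i, x)"
    using w(2)[of i] by eventually_elim (simp add: A_star_op_def)
qed

lemma D_iff: "u \<in> D \<longleftrightarrow> u \<in> X \<and> (\<exists>g g' g''. W21_representative d u g g' g'' \<and> BC g g')"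
  by (rule A_star_dom_iff) (fact d \<sigma>)+

lemma D_E:
  assumes "u \<in> D"
  obtains g g' g'' where "u \<in> X" "W21_representative d u g g' g''" "BC g g'"
  using assms D_iff by blast

lemma D_X: "u \<in> D \<Longrightarrow> u \<in> X" "u \<in> D \<Longrightarrow> A u \<in> X"
  using A_L1(1) by (auto elim: D_E)

lemma D_linear:
  assumes "u \<in> D" "v \<in> D"
  shows "(\<lambda>s. a * u s + b * v s) \<in> D" "AE_eq d (A (\<lambda>s. a * u s + b * v s)) (\<lambda>s. a * A u s + b * A v s)"
proof -
  obtain g g' g'' where u: "u \<in> X" "W21_representative d u g g' g''" "BC g g'" using D_E[OF assms(1)] .
  obtain h h' h'' where v: "v \<in> X" "W21_representative d v h h' h''" "BC h h'" using D_E[OF assms(2)] .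
  let ?L = "\<lambda>f g s. a * f s + b * g s"
  have uv: "?L u v \<in> X" using L1_space_linear u v by blast
  have AEL: "AE x\<in>{0<..<d i} in lborel. ?L u v (i, x) = ?L g h (i, x)" for i
  proof -
    have "AE x\<in>{0<..<d i} in lborel. u (i, x) = g (i, x)" "AE x\<in>{0<..<d i} in lborel. v (i, x) = h (i, x)"
      using u(2) v(2) by (auto simp: W21_representative_def)
    then show ?thesis by eventually_elim auto
  qed
  have rep: "W21_representative d (?L u v) (?L g h) (?L g' h') (?L g'' h'')"
    using u(2) v(2) primitive_on_linear AEL unfolding W21_representative_def by fast
  have "BC (?L g h) (?L g' h')"
    unfolding boundary_conditions_def
  proof
    fix n
    have "(\<Sum>m\<in>UNIV. jump m n * (\<sigma> (fst m) * ?L g h (endpoint d m)))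
      = a * (\<Sum>m\<in>UNIV. jump m n * (\<sigma> (fst m) * g (endpoint d m)))
        + b * (\<Sum>m\<in>UNIV. jump m n * (\<sigma> (fst m) * h (endpoint d m)))"
      by (simp add: sum_distrib_left sum.distrib algebra_simps)
    moreover have "k * \<sigma> (fst n) * (inward (snd n) * ?L g' h' (endpoint d n))
      = a * (k * \<sigma> (fst n) * (inward (snd n) * g' (endpoint d n)))
        + b * (k * \<sigma> (fst n) * (inward (snd n) * h' (endpoint d n)))"
      by (simp add: algebra_simps)
    ultimately show "k * \<sigma> (fst n) * (inward (snd n) * ?L g' h' (endpoint d n))
      = exit n * (\<sigma> (fst n) * ?L g h (endpoint d n))
        - (\<Sum>m\<in>UNIV. jump m n * (\<sigma> (fst m) * ?L g h (endpoint d m)))"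
      unfolding u(3)[unfolded boundary_conditions_def, rule_format, of n]
        v(3)[unfolded boundary_conditions_def, rule_format, of n]
      by (simp add: algebra_simps)
  qed
  then show "?L u v \<in> D" using D_iff uv rep by blast
  show "AE_eq d (A (?L u v)) (?L (A u) (A v))"
    unfolding AE_eq_def
  proof
    fix i
    from A_L1(2)[OF uv rep, of i] A_L1(2)[OF u(1,2), of i] A_L1(2)[OF v(1,2), of i]
    show "AE x\<in>{0<..<d i} in lborel. A (?L u v) (i, x) = a * A u (i, x) + b * A v (i, x)"
      by eventually_elim (auto simp: algebra_simps)
  qed
qed

lemma D_diff:
  assumes "u \<in> D" "v \<in> D"
  shows "(\<lambda>s. u s - v s) \<in> D" "AE_eq d (A (\<lambda>s. u s - v s)) (\<lambda>s. A u s - A v s)"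
  using D_linear[OF assms, of 1 "-1"] by simp_all

lemma D_cong:
  assumes "u \<in> D" "v \<in> X" "AE_eq d u v"
  shows "v \<in> D" "AE_eq d (A u) (A v)"
proof -
  obtain g g' g'' where u: "u \<in> X" "W21_representative d u g g' g''" "BC g g'" using D_E[OF assms(1)] .
  have "AE x\<in>{0<..<d i} in lborel. v (i, x) = g (i, x)" for i
  proof -
    have "AE x\<in>{0<..<d i} in lborel. u (i, x) = g (i, x)" "AE x\<in>{0<..<d i} in lborel. u (i, x) = v (i, x)"
      using u(2) assms(3) by (auto simp: W21_representative_def AE_eq_def)
    then show ?thesis by eventually_elim auto
  qed
  then have rep: "W21_representative d v g g' g''" using u(2) by (simp add: W21_representative_def)
  show "v \<in> D" using D_iff rep u(3) assms(2) by blast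
  show "AE_eq d (A u) (A v)"
    unfolding AE_eq_def
  proof
    fix i
    from A_L1(2)[OF u(1,2), of i] A_L1(2)[OF assms(2) rep, of i]
    show "AE x\<in>{0<..<d i} in lborel. A u (i, x) = A v (i, x)" by eventually_elim auto
  qed
qed

text \<open>Integration over an edge leaves minus its two inward fluxes. The boundary conditions
  replace them by rates, and exchanging the double sum collects at each endpoint the rates that
  leave it.\<close>

lemma S_integral_A:
  assumes u: "u \<in> X" and rep: "W21_representative d u g g' g''" and bc: "BC g g'"
  shows "S_integral d (A u) = - (\<Sum>m\<in>UNIV. (exit m - (\<Sum>n\<in>UNIV. jump m n)) * (\<sigma> (fst m) * g (endpoint d m)))"
proof -
  let ?W = "\<lambda>m. \<sigma> (fst m) * g (endpoint d m)"
  have g'': "primitive_on (d i) (\<lambda>x. g' (i, x)) (\<lambda>x. g'' (i, x))" for i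
    using rep by (simp add: W21_representative_def)
  have "(LBINT x:{0<..<d i}. A u (i, x)) = k * \<sigma> i * (g' (i, d i) - g' (i, 0))" for i
  proof -
    have "(LBINT x:{0<..<d i}. A u (i, x)) = (LBINT x:{0<..<d i}. k * \<sigma> i * g'' (i, x))"
      by (intro set_integral_AE_eq[OF L1_spaceD[OF A_L1(1)[OF u rep]] _ A_L1(2)[OF u rep]]
          set_integrable_mult_right primitive_onD(1)[OF g''])
    also have "\<dots> = k * \<sigma> i * (g' (i, d i) - g' (i, 0))"
      unfolding set_integral_mult_right primitive_on_LINT[OF g'' less_imp_le[OF d]] ..
    finally show ?thesis .
  qed
  then have "S_integral d (A u) = - (\<Sum>n\<in>UNIV. k * \<sigma> (fst n) * (inward (snd n) * g' (endpoint d n)))"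
    unfolding S_integral_def sum_endpoints sum_negf[symmetric]
    by (intro sum.cong) (auto simp: inward_def endpoint_pair algebra_simps)
  also have "\<dots> = - (\<Sum>n\<in>UNIV. exit n * ?W n - (\<Sum>m\<in>UNIV. jump m n * ?W m))"
    by (simp only: bc[unfolded boundary_conditions_def, rule_format])
  also have "(\<Sum>n\<in>UNIV. exit n * ?W n - (\<Sum>m\<in>UNIV. jump m n * ?W m))
      = (\<Sum>n\<in>UNIV. exit n * ?W n) - (\<Sum>m\<in>UNIV. \<Sum>n\<in>UNIV. jump m n * ?W m)"
    unfolding sum_subtractf by (subst (2) sum.swap) (rule refl)
  also have "\<dots> = (\<Sum>m\<in>UNIV. (exit m - (\<Sum>n\<in>UNIV. jump m n)) * ?W m)"
    by (simp add: sum_subtractf[symmetric] left_diff_distrib sum_distrib_right)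
  finally show ?thesis .
qed

section \<open>The resolvent equation on the network\<close>

context
  fixes h :: real and f :: "'e \<times> real \<Rightarrow> real"
  assumes h: "h > 0" and f: "f \<in> X"
begin

text \<open>The frequency for which \<open>u - h * k * \<sigma> i * u'' = f\<close> becomes
  \<open>u'' = (freq i)\<^sup>2 * (u - f)\<close>.\<close>

definition freq where "freq i = sqrt (1 / (h * k * \<sigma> i))"

lemma freq: "freq i > 0" "(freq i)\<^sup>2 = 1 / (h * k * \<sigma> i)" "h * k * \<sigma> i * (freq i)\<^sup>2 = 1"
  using h k \<sigma>[of i] by (simp_all add: freq_def less_imp_le)

text \<open>The share of the inward flux at \<open>n\<close> that is due to \<open>f\<close>, read
  off from the Dirichlet-to-Neumann formulas.\<close>

definition source where
  "source n = (let i = fst n in k * \<sigma> i * (freq i)\<^sup>2 / sinh (freq i * d i) *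
     (if snd n then left_moment (freq i) (\<lambda>x. f (i, x)) (d i) else right_moment (d i) (freq i) (\<lambda>x. f (i, x)) 0))"

definition opposite_coeff where "opposite_coeff i = k * freq i / sinh (freq i * d i)"

text \<open>Row \<open>n\<close> is the boundary condition at \<open>n\<close> after elimination of
  the derivative. The unknowns are \<sigma> g at the endpoints, so column \<open>m\<close> contains
  the rates \<open>jump m n\<close> with \<open>m\<close> fixed.\<close>

definition M where
  "M n m = (if m = n then opposite_coeff (fst n) * cosh (freq (fst n) * d (fst n)) + exit n else 0)
     - (if m = (fst n, \<not> snd n) then opposite_coeff (fst n) else 0) - jump m n"

lemma edge: "d i > 0" "freq i > 0" "set_integrable lborel {0<..<d i} (\<lambda>x. f (i, x))"
  using d freq f by (auto intro: L1_spaceD)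

lemma opposite_coeff_pos: "opposite_coeff i > 0"
  using k edge(1,2)[of i] by (simp add: opposite_coeff_def)

lemma M_off: "m \<noteq> n \<Longrightarrow> M m n \<le> 0"
  using jump_nonneg[of n m] opposite_coeff_pos[of "fst m"]
  by (cases "n = (fst m, \<not> snd m)") (simp_all add: M_def)

text \<open>The rates contribute \<open>exit m\<close> minus the row sum of \<open>jump\<close>,
  which may be zero; strictness comes from \<open>cosh > 1\<close> at a positive argument.\<close>

lemma M_col: "(\<Sum>n\<in>UNIV. M n m) > 0"
proof -
  let ?i = "fst m"
  have flip: "m = (fst n, \<not> snd n) \<longleftrightarrow> n = (fst m, \<not> snd m)" for n by (cases m; cases n) auto
  have "(\<Sum>n\<in>UNIV. M n m) = (\<Sum>n\<in>UNIV. (if m = n then opposite_coeff (fst n) * cosh (freq (fst n) * d (fst n)) + exit n else 0))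
      - (\<Sum>n\<in>UNIV. if n = (fst m, \<not> snd m) then opposite_coeff (fst n) else 0) - (\<Sum>n\<in>UNIV. jump m n)"
    unfolding M_def sum_subtractf flip ..
  also have "\<dots> = opposite_coeff ?i * cosh (freq ?i * d ?i) + exit m - opposite_coeff ?i - (\<Sum>n\<in>UNIV. jump m n)"
    by simp
  also have "\<dots> > 0"
  proof -
    have "1 < cosh (freq ?i * d ?i)"
      using cosh_real_strict_mono[of 0 "freq ?i * d ?i"] edge(1,2)[of ?i] by simp
    then have "opposite_coeff ?i * 1 < opposite_coeff ?i * cosh (freq ?i * d ?i)"
      using opposite_coeff_pos by (intro mult_strict_left_mono) auto
    then show ?thesis using jump_sum_le[of m] by simp
  qed
  finally show ?thesis .
qed

lemma M_apply:
  "(\<Sum>m\<in>UNIV. M n m * w m) = (opposite_coeff (fst n) * cosh (freq (fst n) * d (fst n)) + exit n) * w n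
     - opposite_coeff (fst n) * w (fst n, \<not> snd n) - (\<Sum>m\<in>UNIV. jump m n * w m)"
proof -
  have "(\<Sum>m\<in>UNIV. M n m * w m)
      = (\<Sum>m\<in>UNIV. if m = n then (opposite_coeff (fst n) * cosh (freq (fst n) * d (fst n)) + exit n) * w m else 0)
        - (\<Sum>m\<in>UNIV. if m = (fst n, \<not> snd n) then opposite_coeff (fst n) * w m else 0) - (\<Sum>m\<in>UNIV. jump m n * w m)"
    unfolding M_def sum_subtractf[symmetric] by (intro sum.cong) (auto simp: algebra_simps)
  then show ?thesis by simp
qed

text \<open>On an edge the inward derivative is affine in the two endpoint values, so for solutions
  of the differential equation the boundary conditions are a finite linear system.\<close>

lemma boundary_conditions_iff:
  assumes g: "\<And>i. primitive_on (d i) (\<lambda>x. g (i, x)) (\<lambda>x. g' (i, x))"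
    and g': "\<And>i. primitive_on (d i) (\<lambda>x. g' (i, x)) (\<lambda>x. g'' (i, x))"
    and eq: "\<And>i. AE x\<in>{0<..<d i} in lborel. g'' (i, x) = (freq i)\<^sup>2 * (g (i, x) - f (i, x))"
  shows "BC g g' \<longleftrightarrow> (\<forall>n. (\<Sum>m\<in>UNIV. M n m * (\<sigma> (fst m) * g (endpoint d m))) = source n)"
proof -
  have "k * \<sigma> (fst n) * (inward (snd n) * g' (endpoint d n))
      = source n + opposite_coeff (fst n) * (\<sigma> (fst n) * g (endpoint d (fst n, \<not> snd n)))
        - opposite_coeff (fst n) * cosh (freq (fst n) * d (fst n)) * (\<sigma> (fst n) * g (endpoint d n))" for n
  proof -
    obtain i s where n: "n = (i, s)" by (cases n)
    let ?sh = "sinh (freq i * d i)"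
    note R = edge_representation(2,3)[OF edge g g' eq, of i]
    have dir: "inward s * g' (endpoint d (i, s)) = (freq i * g (endpoint d (i, \<not> s))
        + (freq i)\<^sup>2 * (if s then left_moment (freq i) (\<lambda>x. f (i, x)) (d i) else right_moment (d i) (freq i) (\<lambda>x. f (i, x)) 0)
        - freq i * g (endpoint d (i, s)) * cosh (freq i * d i)) / ?sh"
      using R edge(1,2)[of i] by (cases s) (simp_all add: inward_def endpoint_pair eq_divide_eq)
    show ?thesis
      unfolding n fst_conv snd_conv dir source_def opposite_coeff_def Let_def
      by (simp add: diff_divide_distrib add_divide_distrib algebra_simps)
  qed
  then show ?thesis
    unfolding boundary_conditions_def M_apply fst_conv distrib_right
    by (intro iff_allI) (simp only:, rule iffI, linarith, linarith)
qed

lemma resolvent_equation_iff: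
  assumes u: "u \<in> X" and rep: "W21_representative d u g g' g''"
  shows "AE_eq d (\<lambda>s. u s - h * A u s) f \<longleftrightarrow>
    (\<forall>i. AE x\<in>{0<..<d i} in lborel. g'' (i, x) = (freq i)\<^sup>2 * (g (i, x) - f (i, x)))"
  unfolding AE_eq_def
proof (intro iff_allI)
  fix i
  have hk: "h * k * \<sigma> i > 0" using h k \<sigma> by simp
  have "AE x\<in>{0<..<d i} in lborel. u (i, x) = g (i, x)" using rep by (simp add: W21_representative_def)
  then have *: "AE x\<in>{0<..<d i} in lborel. (u (i, x) - h * A u (i, x) = f (i, x)) \<longleftrightarrow>
      (g'' (i, x) = (freq i)\<^sup>2 * (g (i, x) - f (i, x)))"
    using A_L1(2)[OF u rep, of i]
  proof (eventually_elim, intro impI)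
    fix x assume "x \<in> {0<..<d i} \<longrightarrow> u (i, x) = g (i, x)" "x \<in> {0<..<d i} \<longrightarrow> A u (i, x) = k * \<sigma> i * g'' (i, x)"
      "x \<in> {0<..<d i}"
    then have *: "u (i, x) = g (i, x)" "A u (i, x) = k * \<sigma> i * g'' (i, x)" by auto
    define c where "c = h * k * \<sigma> i"
    have "h * (k * \<sigma> i * g'' (i, x)) = c * g'' (i, x)" by (simp add: c_def)
    then show "(u (i, x) - h * A u (i, x) = f (i, x)) \<longleftrightarrow> (g'' (i, x) = (freq i)\<^sup>2 * (g (i, x) - f (i, x)))"
      unfolding * freq(2) c_def[symmetric] using hk[folded c_def] by (auto simp: field_simps)
  qed
  show "(AE x\<in>{0<..<d i} in lborel. u (i, x) - h * A u (i, x) = f (i, x)) \<longleftrightarrow>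
      (AE x\<in>{0<..<d i} in lborel. g'' (i, x) = (freq i)\<^sup>2 * (g (i, x) - f (i, x)))"
  proof
    assume "AE x\<in>{0<..<d i} in lborel. u (i, x) - h * A u (i, x) = f (i, x)"
    with * show "AE x\<in>{0<..<d i} in lborel. g'' (i, x) = (freq i)\<^sup>2 * (g (i, x) - f (i, x))" by eventually_elim auto
  next
    assume "AE x\<in>{0<..<d i} in lborel. g'' (i, x) = (freq i)\<^sup>2 * (g (i, x) - f (i, x))"
    with * show "AE x\<in>{0<..<d i} in lborel. u (i, x) - h * A u (i, x) = f (i, x)" by eventually_elim auto
  qed
qed

text \<open>The linear system is solved before any function is known; its solution, divided by
  \<sigma>, supplies Dirichlet data for independent problems on the edges.\<close>

lemma resolvent_exists: "\<exists>u\<in>D. AE_eq d (\<lambda>s. u s - h * A u s) f"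
proof -
  obtain w where w: "\<And>n. (\<Sum>m\<in>UNIV. M n m * w m) = source n" using M_matrix_solvable[of M source] M_off M_col by blast
  let ?P = "\<lambda>i g g' g''. primitive_on (d i) g g' \<and> primitive_on (d i) g' g'' \<and>
      (AE x\<in>{0<..<d i} in lborel. g'' x = (freq i)\<^sup>2 * (g x - f (i, x))) \<and>
      g 0 = w (i, False) / \<sigma> i \<and> g (d i) = w (i, True) / \<sigma> i"
  have "\<exists>g g' g''. ?P i g g' g''" for i
    by (rule edge_solution[OF edge[of i], where \<alpha> = "w (i, False) / \<sigma> i" and \<beta> = "w (i, True) / \<sigma> i"]) blast
  then obtain g1 g1' g1'' where G: "\<And>i. ?P i (g1 i) (g1' i) (g1'' i)" by (rule choice3[of ?P]) (rule that)
  define g where "g = (\<lambda>(i, x). g1 i x)"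
  define g' where "g' = (\<lambda>(i, x). g1' i x)"
  define g'' where "g'' = (\<lambda>(i, x). g1'' i x)"
  have gX: "g \<in> X"
    using set_integrable_continuous_Ioo[OF primitive_on_continuous] G unfolding L1_space_def g_def by fastforce
  have rep: "W21_representative d g g g' g''"
    using G by (simp add: W21_representative_def g_def g'_def g''_def)
  have "\<sigma> (fst m) * g (endpoint d m) = w m" for m
    using G[of "fst m"] \<sigma>[of "fst m"] by (cases m; cases "snd m") (auto simp: g_def endpoint_def)
  then have "BC g g'"
    using w by (subst boundary_conditions_iff[where g'' = g'']) (use G in \<open>auto simp: g_def g'_def g''_def\<close>)
  then have "g \<in> D" using D_iff gX rep by blast
  moreover have "AE_eq d (\<lambda>s. g s - h * A g s) f"
    using G unfolding resolvent_equation_iff[OF gX rep] by (simp add: g_def g''_def)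
  ultimately show ?thesis by blast
qed

lemma resolvent_nonneg:
  assumes u: "u \<in> D" and eq: "AE_eq d (\<lambda>s. u s - h * A u s) f" and nonneg: "AE_nonneg d f"
  shows "AE_nonneg d u" "S_integral d u \<le> S_integral d f"
    "(\<And>m. exit m = (\<Sum>n\<in>UNIV. jump m n)) \<Longrightarrow> S_integral d u = S_integral d f"
proof -
  obtain g g' g'' where uX: "u \<in> X" and rep: "W21_representative d u g g' g''" and bc: "BC g g'" using D_E[OF u] .
  note g = W21_representative_parts[OF rep]
  have ode: "AE x\<in>{0<..<d i} in lborel. g'' (i, x) = (freq i)\<^sup>2 * (g (i, x) - f (i, x))" for i
    using eq resolvent_equation_iff[OF uX rep] by blast
  have f0: "AE x\<in>{0<..<d i} in lborel. f (i, x) \<ge> 0" for i using nonneg by (simp add: AE_nonneg_def)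
  have source: "source n \<ge> 0" for n
  proof -
    have "left_moment (freq i) (\<lambda>x. f (i, x)) (d i) \<ge> 0" "right_moment (d i) (freq i) (\<lambda>x. f (i, x)) 0 \<ge> 0" for i
      using moments_nonneg[OF edge f0] d[of i] by auto
    then show ?thesis
      using k \<sigma>[of "fst n"] edge(1,2)[of "fst n"]
      by (auto simp: source_def Let_def intro!: mult_nonneg_nonneg divide_nonneg_pos)
  qed
  have Mw: "(\<Sum>m\<in>UNIV. M n m * (\<sigma> (fst m) * g (endpoint d m))) \<ge> 0" for n
    using bc[unfolded boundary_conditions_iff[OF g(1,2) ode], rule_format, of n] source[of n] by (simp only:)
  have W: "\<sigma> (fst n) * g (endpoint d n) \<ge> 0" for n
    by (rule M_matrix_nonneg[of M, OF M_off M_col Mw])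
  then have gE: "g (endpoint d n) \<ge> 0" for n using \<sigma>[of "fst n"] by (meson zero_le_mult_iff not_le order_less_imp_le)
  have gnn: "g (i, x) \<ge> 0" if "x \<in> {0..d i}" for i x
    using edge_nonneg[OF edge g(1,2) ode f0 _ _ that] gE[of "(i, False)"] gE[of "(i, True)"] by (simp add: endpoint_pair)
  have "AE x\<in>{0<..<d i} in lborel. 0 \<le> u (i, x)" for i
    using g(3)[of i] by eventually_elim (use gnn in auto)
  then show "AE_nonneg d u" by (simp add: AE_nonneg_def)
  have "S_integral d f = S_integral d (\<lambda>s. 1 * u s + (- h) * A u s)"
    using eq D_X[OF u] f by (intro S_integral_cong[symmetric] L1_space_linear) auto
  also have "\<dots> = S_integral d u - h * S_integral d (A u)"
    using S_integral_linear[OF D_X[OF u], of 1 "- h"] by simp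
  finally have mass: "S_integral d f = S_integral d u
      + h * (\<Sum>m\<in>UNIV. (exit m - (\<Sum>n\<in>UNIV. jump m n)) * (\<sigma> (fst m) * g (endpoint d m)))"
    using S_integral_A[OF uX rep bc] by simp
  have "0 \<le> (\<Sum>m\<in>UNIV. (exit m - (\<Sum>n\<in>UNIV. jump m n)) * (\<sigma> (fst m) * g (endpoint d m)))"
    using jump_sum_le by (intro sum_nonneg mult_nonneg_nonneg W) auto
  then show "S_integral d u \<le> S_integral d f" using mass h by simp
  show "S_integral d u = S_integral d f" if "\<And>m. exit m = (\<Sum>n\<in>UNIV. jump m n)"
    using mass by (simp add: that)
qed

end

section \<open>Uniqueness, dissipativity and density\<close>

lemma resolvent_equation_diff:
  assumes "u \<in> D" "v \<in> D" "AE_eq d (\<lambda>s. u s - h * A u s) f" "AE_eq d (\<lambda>s. v s - h * A v s) g"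
  shows "AE_eq d (\<lambda>s. (u s - v s) - h * A (\<lambda>s. u s - v s) s) (\<lambda>s. f s - g s)"
  unfolding AE_eq_def
proof
  fix i
  from D_diff(2)[OF assms(1,2), unfolded AE_eq_def, rule_format, of i]
    assms(3)[unfolded AE_eq_def, rule_format, of i] assms(4)[unfolded AE_eq_def, rule_format, of i]
  show "AE x\<in>{0<..<d i} in lborel. (u (i, x) - v (i, x)) - h * A (\<lambda>s. u s - v s) (i, x) = f (i, x) - g (i, x)"
  proof (eventually_elim, intro impI)
    fix x
    assume "x \<in> {0<..<d i}" "x \<in> {0<..<d i} \<longrightarrow> A (\<lambda>s. u s - v s) (i, x) = A u (i, x) - A v (i, x)"
      "x \<in> {0<..<d i} \<longrightarrow> u (i, x) - h * A u (i, x) = f (i, x)" "x \<in> {0<..<d i} \<longrightarrow> v (i, x) - h * A v (i, x) = g (i, x)"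
    then have e: "A (\<lambda>s. u s - v s) (i, x) = A u (i, x) - A v (i, x)"
      "u (i, x) - h * A u (i, x) = f (i, x)" "v (i, x) - h * A v (i, x) = g (i, x)" by auto
    show "(u (i, x) - v (i, x)) - h * A (\<lambda>s. u s - v s) (i, x) = f (i, x) - g (i, x)"
      unfolding e(1) right_diff_distrib using e(2,3) by linarith
  qed
qed

text \<open>Positivity implies uniqueness: the difference of two solutions, in either order, solves
  the equation with right-hand side zero and is therefore nonnegative.\<close>

lemma resolvent_unique:
  assumes h: "h > 0" and u: "u \<in> D" "AE_eq d (\<lambda>s. u s - h * A u s) f"
    and v: "v \<in> D" "AE_eq d (\<lambda>s. v s - h * A v s) f"
  shows "AE_eq d u v"
proof -
  have *: "AE_nonneg d (\<lambda>s. u s - v s)"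
    if "u \<in> D" "AE_eq d (\<lambda>s. u s - h * A u s) f" "v \<in> D" "AE_eq d (\<lambda>s. v s - h * A v s) f" for u v
  proof (rule resolvent_nonneg(1)[OF h _ D_diff(1)[OF that(1,3)]])
    show "(\<lambda>_. 0) \<in> X" using subspace_0[OF subspace_L1_space] by (simp add: zero_fun_def)
    show "AE_eq d (\<lambda>s. u s - v s - h * A (\<lambda>s. u s - v s) s) (\<lambda>_. 0)"
      using resolvent_equation_diff[OF that(1,3,2,4)] by simp
  qed (simp add: AE_nonneg_def)
  show ?thesis
    unfolding AE_eq_def
  proof
    fix i
    from *[OF u v, unfolded AE_nonneg_def, rule_format, of i] *[OF v u, unfolded AE_nonneg_def, rule_format, of i]
    show "AE x\<in>{0<..<d i} in lborel. u (i, x) = v (i, x)" by eventually_elim auto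
  qed
qed

text \<open>Contractivity follows from positivity by splitting the right-hand side into its positive and negative parts.\<close>

lemma L1_dissipative:
  assumes h: "h > 0" and u: "u \<in> D"
  shows "L1_norm d u \<le> L1_norm d (\<lambda>s. u s - h * A u s)"
proof -
  define f where "f = (\<lambda>s. u s - h * A u s)"
  define fp where "fp = (\<lambda>s. (1/2) * \<bar>f s\<bar> + (1/2) * f s)"
  define fn where "fn = (\<lambda>s. (1/2) * \<bar>f s\<bar> + (- 1/2) * f s)"
  have f: "f \<in> X" using L1_space_linear[OF D_X[OF u], of 1 "- h"] by (simp add: f_def)
  have fpn: "fp \<in> X" "fn \<in> X" unfolding fp_def fn_def by (intro L1_space_linear L1_space_abs f)+
  obtain v where v: "v \<in> D" "AE_eq d (\<lambda>s. v s - h * A v s) fp" using resolvent_exists[OF h fpn(1)] by blast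
  obtain w where w: "w \<in> D" "AE_eq d (\<lambda>s. w s - h * A w s) fn" using resolvent_exists[OF h fpn(2)] by blast
  have "AE_nonneg d fp" "AE_nonneg d fn"
    by (auto simp: AE_nonneg_def fp_def fn_def abs_real_def intro!: always_eventually)
  note V = resolvent_nonneg(1,2)[OF h fpn(1) v this(1)] and W = resolvent_nonneg(1,2)[OF h fpn(2) w this(2)]
  have "AE_eq d (\<lambda>s. (v s - w s) - h * A (\<lambda>s. v s - w s) s) (\<lambda>s. fp s - fn s)"
    using resolvent_equation_diff[OF v(1) w(1) v(2) w(2)] .
  then have "AE_eq d (\<lambda>s. (v s - w s) - h * A (\<lambda>s. v s - w s) s) f" by (simp add: fp_def fn_def)
  from resolvent_unique[OF h u _ D_diff(1)[OF v(1) w(1)] this]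
  have uvw: "AE_eq d u (\<lambda>s. v s - w s)" by (simp add: AE_eq_def f_def)
  have "L1_norm d u \<le> S_integral d (\<lambda>s. 1 * v s + 1 * w s)"
    unfolding L1_norm_eq_S_integral
  proof (rule S_integral_mono)
    show "(\<lambda>s. \<bar>u s\<bar>) \<in> X" "(\<lambda>s. 1 * v s + 1 * w s) \<in> X"
      by (intro L1_space_abs L1_space_linear D_X u v w)+
    fix i
    from uvw[unfolded AE_eq_def, rule_format, of i] V(1)[unfolded AE_nonneg_def, rule_format, of i]
      W(1)[unfolded AE_nonneg_def, rule_format, of i]
    show "AE x\<in>{0<..<d i} in lborel. \<bar>u (i, x)\<bar> \<le> 1 * v (i, x) + 1 * w (i, x)" by eventually_elim auto
  qed
  also have "\<dots> = S_integral d v + S_integral d w" using S_integral_linear[OF D_X(1)[OF v(1)] D_X(1)[OF w(1)], of 1 1] by simp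
  also have "\<dots> \<le> 1 * S_integral d fp + 1 * S_integral d fn" using V W by simp
  also have "\<dots> = S_integral d (\<lambda>s. 1 * fp s + 1 * fn s)" by (rule S_integral_linear[OF fpn, symmetric])
  also have "(\<lambda>s. 1 * fp s + 1 * fn s) = (\<lambda>s. \<bar>f s\<bar>)" by (auto simp: fp_def fn_def)
  finally show ?thesis by (simp add: L1_norm_eq_S_integral f_def)
qed

lemma D_dense:
  assumes f: "f \<in> X" and e: "e > 0"
  shows "\<exists>u\<in>D. L1_norm d (\<lambda>s. f s - u s) < e"
proof -
  \<comment> \<open>The error is shared equally among the edges.\<close>
  have e': "e / real CARD('e) > 0" using e by simp
  let ?P = "\<lambda>i q q' q''. primitive_on (d i) q q' \<and> primitive_on (d i) q' q'' \<and>
      q 0 = 0 \<and> q (d i) = 0 \<and> q' 0 = 0 \<and> q' (d i) = 0 \<and>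
      (LBINT x:{0<..<d i}. \<bar>f (i, x) - q x\<bar>) < e / real CARD('e)"
  have "\<exists>q q' q''. ?P i q q' q''" for i
    by (rule L1_dense_flat_ends[OF d L1_spaceD[OF f] e']) blast
  then obtain q q' q'' where q: "\<And>i. ?P i (q i) (q' i) (q'' i)" by (rule choice3[of ?P]) (rule that)
  define u where "u = (\<lambda>(i, x). q i x)"
  define u' where "u' = (\<lambda>(i, x). q' i x)"
  define u'' where "u'' = (\<lambda>(i, x). q'' i x)"
  have X: "u \<in> X"
    using set_integrable_continuous_Ioo[OF primitive_on_continuous] q unfolding L1_space_def u_def by fastforce
  have "W21_representative d u u u' u''" using q by (simp add: W21_representative_def u_def u'_def u''_def)
  moreover have "u (endpoint d n) = 0" "u' (endpoint d n) = 0" for n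
    using q by (cases n; auto simp: endpoint_def u_def u'_def)+
  then have "BC u u'" by (simp add: boundary_conditions_def)
  ultimately have "u \<in> D" using D_iff X by blast
  moreover have "L1_norm d (\<lambda>s. f s - u s) < (\<Sum>i\<in>(UNIV::'e set). e / real CARD('e))"
    unfolding L1_norm_def u_def prod.case by (intro sum_strict_mono) (use q in auto)
  then have "L1_norm d (\<lambda>s. f s - u s) < e" by simp
  ultimately show ?thesis by blast
qed

lemma dissipative_operator_A_star: "dissipative_operator X (L1_norm d) D A"
proof
  note pointwise = scaleR_fun_def fun_diff_def plus_fun_def
  show "subspace X" by (rule subspace_L1_space)
  fix a b :: real and x y :: "'e \<times> real \<Rightarrow> real"
  show "L1_norm d (a *\<^sub>R x) = \<bar>a\<bar> * L1_norm d x" using L1_norm_scale by (simp add: pointwise)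
  { assume "x \<in> X" "y \<in> X"
    then show "L1_norm d (x + y) \<le> L1_norm d x + L1_norm d y"
      using L1_norm_triangle by (simp add: pointwise) }
  { assume "x \<in> D" then show "x \<in> X" "A x \<in> X" using D_X by auto }
  { assume *: "x \<in> D" "y \<in> X" "L1_norm d (x - y) = 0"
    then have xy: "AE_eq d x y" using L1_norm_diff_zero_iff[OF D_X(1)[OF *(1)] *(2)] by (simp add: pointwise)
    from D_cong[OF *(1,2) xy] show "y \<in> D \<and> L1_norm d (A x - A y) = 0"
      using L1_norm_diff_zero_iff[OF D_X(2)[OF *(1)] D_X(2)] by (simp add: pointwise) }
  { assume *: "x \<in> D" "y \<in> D"
    have "(\<lambda>s. a * A x s + b * A y s) \<in> X" using L1_space_linear D_X(2) * by blast
    then show "a *\<^sub>R x + b *\<^sub>R y \<in> D \<and> L1_norm d (A (a *\<^sub>R x + b *\<^sub>R y) - (a *\<^sub>R A x + b *\<^sub>R A y)) = 0"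
      using D_linear[OF *, of a b] L1_norm_diff_zero_iff[OF D_X(2)[OF D_linear(1)[OF *, of a b]]]
      by (simp add: pointwise) }
next
  fix f :: "nat \<Rightarrow> 'e \<times> real \<Rightarrow> real"
  assume "\<And>n. f n \<in> X" "\<And>e. e > 0 \<Longrightarrow> \<exists>N. \<forall>m\<ge>N. \<forall>n\<ge>N. L1_norm d (f m - f n) < e"
  then show "\<exists>g\<in>X. (\<lambda>n. L1_norm d (f n - g)) \<longlonglongrightarrow> 0"
    using L1_space_complete[of f d] by (simp add: fun_diff_def)
next
  fix h :: real and x :: "'e \<times> real \<Rightarrow> real"
  assume "h > 0" "x \<in> D"
  then show "L1_norm d x \<le> L1_norm d (x - h *\<^sub>R A x)"
    using L1_dissipative by (simp add: fun_diff_def scaleR_fun_def)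
next
  fix h :: real and f :: "'e \<times> real \<Rightarrow> real"
  assume h: "h > 0" and f: "f \<in> X"
  obtain u where u: "u \<in> D" "AE_eq d (\<lambda>s. u s - h * A u s) f" using resolvent_exists[OF h f] by blast
  have "(\<lambda>s. u s - h * A u s) \<in> X" using L1_space_linear[OF D_X[OF u(1)], of 1 "- h"] by simp
  then show "\<exists>x\<in>D. L1_norm d (x - h *\<^sub>R A x - f) = 0"
    using u L1_norm_diff_zero_iff[OF _ f] by (intro bexI[of _ u]) (simp_all add: fun_diff_def scaleR_fun_def)
next
  fix f :: "'e \<times> real \<Rightarrow> real" and e :: real
  assume "f \<in> X" "e > 0"
  then show "\<exists>g\<in>D. L1_norm d (f - g) < e" using D_dense by (simp add: fun_diff_def)
qed

section \<open>The semigroup, its positivity and its mass\<close>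

definition semigroup where "semigroup = dissipative_operator.T X (L1_norm d) D A"

lemma generates_semigroup: "generates X (L1_norm d) D A semigroup"
  unfolding semigroup_def by (rule dissipative_operator_generates[OF dissipative_operator_A_star])

lemma semigroup_invariant:
  assumes Q: "Q \<subseteq> X"
    and closed: "\<And>x y. \<lbrakk>\<And>n::nat. x n \<in> Q; y \<in> X; (\<lambda>n. L1_norm d (\<lambda>s. x n s - y s)) \<longlonglongrightarrow> 0\<rbrakk> \<Longrightarrow> y \<in> Q"
    and resolvent: "\<And>h x f. \<lbrakk>h > 0; x \<in> D; f \<in> Q; AE_eq d (\<lambda>s. x s - h * A x s) f\<rbrakk> \<Longrightarrow> x \<in> Q"
    and "t \<ge> 0" "f \<in> Q"
  shows "semigroup t f \<in> Q"
  unfolding semigroup_def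
proof (rule dissipative_operator.T_invariant[OF dissipative_operator_A_star Q _ _ assms(4,5)])
  show "y \<in> Q" if "\<And>n::nat. x n \<in> Q" "y \<in> X" "(\<lambda>n. L1_norm d (x n - y)) \<longlonglongrightarrow> 0" for x y
    using closed[of x y] that by (simp add: fun_diff_def)
  show "x \<in> Q" if *: "h > 0" "x \<in> D" "f \<in> Q" "L1_norm d (x - h *\<^sub>R A x - f) = 0" for h x f
  proof (rule resolvent[OF *(1,2,3)])
    have "(\<lambda>s. x s - h * A x s) \<in> X" using L1_space_linear[OF D_X[OF *(2)], of 1 "- h"] by simp
    then show "AE_eq d (\<lambda>s. x s - h * A x s) f"
      using L1_norm_diff_zero_iff[of _ d f] * Q by (simp add: fun_diff_def scaleR_fun_def subset_iff)
  qed
qed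

lemma sub_markov_semigroup: "sub_markov d semigroup"
  unfolding sub_markov_def
proof (intro conjI allI ballI impI)
  show "c0_semigroup X (L1_norm d) semigroup" using generates_semigroup by (simp add: generates_def)
  fix t :: real and f assume t: "t \<ge> 0" and f: "f \<in> X" "AE_nonneg d f"
  \<comment> \<open>The integral is compared with that of the initial \<open>f\<close>, so that
    further resolvent steps, which can only lower it, remain in the set.\<close>
  let ?Q = "{u \<in> X. AE_nonneg d u \<and> S_integral d u \<le> S_integral d f}"
  have "semigroup t f \<in> ?Q"
  proof (rule semigroup_invariant[OF _ _ _ t])
    show "y \<in> ?Q" if x: "\<And>n::nat. x n \<in> ?Q" and y: "y \<in> X" "(\<lambda>n. L1_norm d (\<lambda>s. x n s - y s)) \<longlonglongrightarrow> 0" for x y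
      using AE_nonneg_L1_limit[of x d y] LIMSEQ_le_const2[OF S_integral_L1_limit[of x d y]] x y by auto
    show "x \<in> ?Q" if "h > 0" "x \<in> D" "g \<in> ?Q" "AE_eq d (\<lambda>s. x s - h * A x s) g" for h x g
      using resolvent_nonneg(1,2)[of h g x] that D_X by auto
  qed (use f in auto)
  then show "AE_nonneg d (semigroup t f)" "S_integral d (semigroup t f) \<le> S_integral d f" by auto
qed

lemma markov_semigroup:
  assumes balance: "\<And>m. exit m = (\<Sum>n\<in>UNIV. jump m n)" shows "markov d semigroup"
  unfolding markov_def
proof (intro conjI allI ballI impI sub_markov_semigroup)
  fix t :: real and f assume t: "t \<ge> 0" and f: "f \<in> X" "AE_nonneg d f"
  let ?Q = "{u \<in> X. AE_nonneg d u \<and> S_integral d u = S_integral d f}"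
  have "semigroup t f \<in> ?Q"
  proof (rule semigroup_invariant[OF _ _ _ t])
    show "y \<in> ?Q" if x: "\<And>n::nat. x n \<in> ?Q" and y: "y \<in> X" "(\<lambda>n. L1_norm d (\<lambda>s. x n s - y s)) \<longlonglongrightarrow> 0" for x y
      using AE_nonneg_L1_limit[of x d y] S_integral_L1_limit[of x d y] x y by (simp add: LIMSEQ_const_iff)
    show "x \<in> ?Q" if "h > 0" "x \<in> D" "g \<in> ?Q" "AE_eq d (\<lambda>s. x s - h * A x s) g" for h x g
      using resolvent_nonneg(1)[of h g x] resolvent_nonneg(3)[of h g x, OF _ _ _ _ _ balance] that D_X by auto
  qed (use f in auto)
  then show "S_integral d (semigroup t f) = S_integral d f" by auto
qed

text \<open>A conservative semigroup fixes \<open>1\<close>, so \<open>1\<close> lies in the domain of its generator; its boundary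
  conditions are the balance equations.\<close>

lemma conservative_imp_balance:
  assumes gen: "generates (C_space d) (C_norm d) (A_dom \<gamma> d l r lc rc k) (A_op d \<sigma> k) U"
    and cons: "conservative d U"
  shows "exit m = (\<Sum>n\<in>UNIV. jump m n)"
proof -
  \<comment> \<open>Nonemptiness is what makes the supremum of zeros equal to zero.\<close>
  have ne: "edge_union d \<noteq> {}" using less_imp_le[OF d] by (auto simp: edge_union_def)
  have zero: "C_norm d (\<lambda>s. (U t (\<lambda>_. 1) s - 1) / t - 0) = 0" if "t > 0" for t
  proof -
    have "\<bar>(U t (\<lambda>_. 1) s - 1) / t - 0\<bar> = 0" if "s \<in> edge_union d" for s
      using cons \<open>t > 0\<close> that by (simp add: conservative_def)
    then have "(SUP s\<in>edge_union d. \<bar>(U t (\<lambda>_. 1) s - 1) / t - 0\<bar>) = (SUP s\<in>edge_union d. 0)"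
      by (intro SUP_cong refl)
    then show ?thesis unfolding C_norm_def using ne by simp
  qed
  have "((\<lambda>t. C_norm d (\<lambda>s. (U t (\<lambda>_. 1) s - 1) / t - 0)) \<longlongrightarrow> 0) (at_right 0)"
    by (rule tendsto_eventually, rule eventually_mono[OF eventually_at_right_less]) (rule zero)
  moreover have "(\<lambda>_. 1) \<in> C_space d" "(\<lambda>_. 0) \<in> C_space d" by (auto simp: C_space_def)
  ultimately have one: "(\<lambda>_. 1) \<in> A_dom \<gamma> d l r lc rc k" using gen unfolding generates_def by blast
  have deriv: "edge_deriv d (\<lambda>_. 1) (i, x) = 0" if "x \<in> {0..d i}" for i x
  proof -
    have c: "((\<lambda>y. 1) has_vector_derivative (0::real)) (at x within {0..d i})" by (rule has_vector_derivative_const)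
    show ?thesis
      using vector_derivative_within_closed_interval[OF _ _ c] d[of i] that by (simp add: edge_deriv_def)
  qed
  have bc: "k * edge_deriv d (\<lambda>_. 1) (i, 0) = l i * 1 - (\<Sum>j\<in>-{i}. lc i j * vertex_value \<gamma> d (\<lambda>_. 1) (left_vertex \<gamma> i) j)"
    "- k * edge_deriv d (\<lambda>_. 1) (i, d i) = r i * 1 - (\<Sum>j\<in>-{i}. rc i j * vertex_value \<gamma> d (\<lambda>_. 1) (right_vertex \<gamma> i) j)" for i
    using one unfolding A_dom_def by blast+
  have "edge_deriv d (\<lambda>_. 1) (i, 0) = 0" "edge_deriv d (\<lambda>_. 1) (i, d i) = 0" for i
    using deriv less_imp_le[OF d] by auto
  then have L: "l i = (\<Sum>j\<in>-{i}. lc i j * vertex_value \<gamma> d (\<lambda>_. 1) (left_vertex \<gamma> i) j)"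
    and R: "r i = (\<Sum>j\<in>-{i}. rc i j * vertex_value \<gamma> d (\<lambda>_. 1) (right_vertex \<gamma> i) j)" for i
    using bc[of i] by simp_all
  show ?thesis
    unfolding jump_row_sum using L R by (cases m) (auto simp: exit_rate_def endpoint_vertex_def)
qed

end

theorem theorem2p4:
  fixes V :: "(real^3) set"
    and \<gamma> :: "'e::finite \<Rightarrow> real \<Rightarrow> real^3"
    and d \<sigma> l r :: "'e \<Rightarrow> real"
    and lc rc :: "'e \<Rightarrow> 'e \<Rightarrow> real"
    and \<kappa> :: "nat \<Rightarrow> real"
  assumes graph: "geometric_graph V \<gamma> d"
    and sigma_pos: "\<And>i. \<sigma> i > 0"
    and l_nonneg: "\<And>i. l i \<ge> 0"
    and r_nonneg: "\<And>i. r i \<ge> 0"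
    and lc_nonneg: "\<And>i j. i \<noteq> j \<Longrightarrow> lc i j \<ge> 0"
    and rc_nonneg: "\<And>i j. i \<noteq> j \<Longrightarrow> rc i j \<ge> 0"
    and lc_sum: "\<And>i. (\<Sum>j\<in>-{i}. lc i j) \<le> l i"
    and rc_sum: "\<And>i. (\<Sum>j\<in>-{i}. rc i j) \<le> r i"
    and lc_incident: "\<And>i j. i \<noteq> j \<Longrightarrow> \<not> incident \<gamma> j (left_vertex \<gamma> i) \<Longrightarrow> lc i j = 0"
    and rc_incident: "\<And>i j. i \<noteq> j \<Longrightarrow> \<not> incident \<gamma> j (right_vertex \<gamma> i) \<Longrightarrow> rc i j = 0"
    and kappa_pos: "\<And>n. n \<ge> 1 \<Longrightarrow> \<kappa> n > 0"
    and kappa_mono: "\<And>m n. 1 \<le> m \<Longrightarrow> m \<le> n \<Longrightarrow> \<kappa> m \<le> \<kappa> n"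
    and kappa_lim: "filterlim \<kappa> at_top sequentially"
  shows "\<forall>n\<ge>1.
      (\<exists>T. generates (L1_space d) (L1_norm d)
             (A_star_dom \<gamma> d \<sigma> l r lc rc (\<kappa> n)) (A_star_op d \<sigma> (\<kappa> n)) T \<and> sub_markov d T) \<and>
      (\<forall>U. generates (C_space d) (C_norm d)
             (A_dom \<gamma> d l r lc rc (\<kappa> n)) (A_op d \<sigma> (\<kappa> n)) U \<and> conservative d U \<longrightarrow>
        (\<exists>T. generates (L1_space d) (L1_norm d)
               (A_star_dom \<gamma> d \<sigma> l r lc rc (\<kappa> n)) (A_star_op d \<sigma> (\<kappa> n)) T \<and> markov d T))"
proof (intro allI impI)
  fix n :: nat assume n: "1 \<le> n"
  have "d i > 0 \<and> left_vertex \<gamma> i \<noteq> right_vertex \<gamma> i" for i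
    using graph unfolding geometric_graph_def by blast
  then interpret diffusion_network \<gamma> d \<sigma> l r lc rc "\<kappa> n"
    using sigma_pos l_nonneg r_nonneg lc_nonneg rc_nonneg lc_sum rc_sum kappa_pos[OF n]
    by unfold_locales auto
  show "(\<exists>T. generates (L1_space d) (L1_norm d)
             (A_star_dom \<gamma> d \<sigma> l r lc rc (\<kappa> n)) (A_star_op d \<sigma> (\<kappa> n)) T \<and> sub_markov d T) \<and>
      (\<forall>U. generates (C_space d) (C_norm d)
             (A_dom \<gamma> d l r lc rc (\<kappa> n)) (A_op d \<sigma> (\<kappa> n)) U \<and> conservative d U \<longrightarrow>
        (\<exists>T. generates (L1_space d) (L1_norm d)
               (A_star_dom \<gamma> d \<sigma> l r lc rc (\<kappa> n)) (A_star_op d \<sigma> (\<kappa> n)) T \<and> markov d T))"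
    using generates_semigroup sub_markov_semigroup markov_semigroup conservative_imp_balance by blast
qed

end
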